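(* With the notation of the context, let $T=T_3^{[3]}=w^2$, where $$w=s_{2}s_{6}s_{7}s_{5}s_{6}s_{4}s_{5}s_{6}s_{7}s_{3}s_{4}s_{5}s_{6}s_{7}s_{1}s_{0}s_{4}s_{5}s_{6}s_{7}s_{3}s_{4}s_{5}s_{6}s_{0}s_{4}s_{5}s_{3}s_{4}\quad\text{with each } s_i=s_i^{[3]}.$$ Let $U(z)=z^{-3}\prod_{i=3}^8(z-e_i)$. Then $$\frac{\{T^{-1}(y)-(z+\frac{T^{-1}(h_2)}{z})\}\{y-(\frac{h_1}{z}+\frac{h_2z}{h_1})\}}{\{T^{-1}(y)-(\frac{h_1}{z}+\frac{T^{-1}(h_2)z}{h_1})\}\{y-(z+\frac{h_2}{z})\}}=\frac{U(\frac{h_1}{z})}{U(z)}\quad\text{for } x=z+\frac{h_1}{z},$$ $$\frac{\{T(x)-(z+\frac{T(h_1)}{z})\}\{x-(\frac{h_2}{z}+\frac{h_1z}{h_2})\}}{\{T(x)-(\frac{h_2}{z}+\frac{T(h_1)z}{h_2})\}\{x-(z+\frac{h_1}{z})\}}=\frac{U(\frac{h_2}{z})}{U(z)}\quad\text{for } y=z+\frac{h_2}{z}.$$ This pair of equations is equivalent, under the change of variables given in the context, to the $q$-$E_7^{(1)}$ equation $$\frac{\{g-G(\frac{\kappa_1}{u})\}\{\underline g-\underline G(\frac{\kappa_1}{u})\}}{\{g-G(u)\}\{\underline g-\underline G(u)\}}=\frac{V(\frac{\kappa_1}{u})}{V(u)}\ \text{ for } f=F(u),\qquad \frac{\{f-F(\frac{\kappa_2}{u})\}\{\overline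 f-\overline F(\frac{\kappa_2}{u})\}}{\{f-F(u)\}\{\overline f-\overline F(u)\}}=\frac{V(\frac{\kappa_2}{u})}{V(u)}\ \text{ for } g=G(u),$$ where $F(u)=u+\frac{\kappa_1}{u}$, $G(u)=u+\frac{\kappa_2}{u}$, $\overline F(u)=u+\frac{\kappa_1}{qu}$, $\underline G(u)=u+\frac{\kappa_2}{qu}$, $V(u)=u^{-3}\prod_{i=3}^8(u-v_i)$; and its singular points are the six points $$(x,y)=\Big(e_i+\frac{h_1}{e_i},\,e_i+\frac{h_2}{e_i}\Big)_{i=3,\dots,8}$$ together with the double point $(x,y)=\Big(\frac1\varepsilon,\frac{1-e_1e_2/h_1}{(1-e_1e_2/h_2)\varepsilon}\Big)_2$, $\varepsilon\to0$, i.e. the point $(\infty,\infty)$ and the point infinitely near to it in the direction $\lim y/x=\frac{1-e_1e_2/h_1}{1-e_1e_2/h_2}$.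
   Context: All maps are $\mathbb C$-automorphisms of the rational function field $K=\mathbb C(e_1,\dots,e_8,h_1,h_2,x,y)$ (the two equations are read as identities after adjoining $z$ with $x=z+h_1/z$, resp. $y=z+h_2/z$); composition is $(\alpha\beta)(F)=\alpha(\beta(F))$ (rightmost factor first); generators not mentioned are fixed. Put $q=h_1^2h_2^2/\prod_{i=1}^8e_i$, $h_-=h_1-h_2$, $a_1=e_3+e_4$, $a_2=e_3e_4$. Representation 3 of the affine Weyl group of type $E_7^{(1)}$: $s_0^{[3]}:e_3\leftrightarrow e_4$; $s_j^{[3]}:e_j\leftrightarrow e_{j+1}$ for $j=4,5,6,7$; $s_2^{[3]}:h_1\leftrightarrow h_2,\ x\leftrightarrow y$; $$s_1^{[3]}:e_1\mapsto\tfrac{h_1}{e_2},\ e_2\mapsto\tfrac{h_1}{e_1},\ h_2\mapsto\tfrac{h_1h_2}{e_1e_2},\ y\mapsto\frac{-h_2(e_1e_2-h_1)x+h_1(e_1e_2-h_2)y}{e_1e_2h_-};$$ $$s_3^{[3]}:e_3\mapsto\tfrac{h_1}{e_4},\ e_4\mapsto\tfrac{h_1}{e_3},\ h_2\mapsto\tfrac{h_1h_2}{e_3e_4},\ y\mapsto\frac{a_2h_-xy+a_1h_2(a_2-h_1)x-a_1h_1(a_2-h_2)y+(a_2-h_1)(a_2-h_2)h_-}{a_2\{(a_2-h_2)x-(a_2-h_1)y-a_1h_-\}}.$$ Change of variables: with an auxiliary variable $\lambda$ on which $T$ acts by $T(\lambda)=\lambda T(h_1)/h_2$, put $v_i=e_i/\lambda$,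 $\kappa_i=h_i/\lambda^2$, $u=z/\lambda$, $f=x/\lambda$, $g=y/\lambda$, and $\overline f=T(f)$, $\underline g=T^{-1}(g)$. (One has $T(h_1)=qh_2^2/h_1$, $T^{-1}(h_2)=qh_1^2/h_2$, and $\kappa_1^2\kappa_2^2=q\prod_{i=1}^8v_i$.) Singular points: the points of $\mathbb P^1\times\mathbb P^1$ (coordinates $(x,y)$, parameters generic), including infinitely near points, at which the rational functions $T^{-1}(y)$ or $T(x)$ of $(x,y)$ determined by the two equations are indeterminate. *)

theory Defs
  imports
    Complex_Main
    "HOL-Library.Countable"
    "HOL-Library.Poly_Mapping"
    "HOL-Computational_Algebra.Polynomial"
    "HOL-Computational_Algebra.Fraction_Field"
begin

text \<open>\<open>K\<close> is the field C(e1,...,e8,h1,h2,x,y), with one generator for each variable.\<close>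

datatype gen = Ge1 | Ge2 | Ge3 | Ge4 | Ge5 | Ge6 | Ge7 | Ge8 | Gh1 | Gh2 | Gx | Gy

text \<open>
  The library proves that the polynomials over linearly ordered variables form an integral domain.
  The order on the generators serves only this purpose and is arbitrary.
\<close>

instance gen :: countable
  by countable_datatype

instantiation gen :: linorder
begin

definition less_eq_gen :: "gen \<Rightarrow> gen \<Rightarrow> bool" where
  "less_eq_gen a b \<longleftrightarrow> to_nat a \<le> to_nat b"

definition less_gen :: "gen \<Rightarrow> gen \<Rightarrow> bool" where
  "less_gen a b \<longleftrightarrow> to_nat a < to_nat b"

instance
  by standard (auto simp: less_eq_gen_def less_gen_def)

end

type_synonym K = "((gen \<Rightarrow>\<^sub>0 nat) \<Rightarrow>\<^sub>0 complex) fract"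

definition const :: "complex \<Rightarrow> K" where
  "const c = Fract (Poly_Mapping.single 0 c) 1"

definition Var :: "gen \<Rightarrow> K" where
  "Var g = Fract (Poly_Mapping.single (Poly_Mapping.single g 1) 1) 1"

text \<open>Indices run over 1,...,8.\<close>

definition ge :: "nat \<Rightarrow> gen" where
  "ge i = [Ge1, Ge2, Ge3, Ge4, Ge5, Ge6, Ge7, Ge8] ! (i - 1)"

definition par_e :: "nat \<Rightarrow> K" where "par_e i = Var (ge i)"
definition par_h1 :: K where "par_h1 = Var Gh1"
definition par_h2 :: K where "par_h2 = Var Gh2"
definition coord_x :: K where "coord_x = Var Gx"
definition coord_y :: K where "coord_y = Var Gy"

definition par_q :: K where
  "par_q = par_h1\<^sup>2 * par_h2\<^sup>2 / (\<Prod>i=1..8. par_e i)"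

definition field_hom :: "('a::field \<Rightarrow> 'b::field) \<Rightarrow> bool" where
  "field_hom \<phi> \<longleftrightarrow>
     \<phi> 1 = 1 \<and> (\<forall>a b. \<phi> (a + b) = \<phi> a + \<phi> b) \<and> (\<forall>a b. \<phi> (a * b) = \<phi> a * \<phi> b)"

definition C_automorphism :: "(K \<Rightarrow> K) \<Rightarrow> bool" where
  "C_automorphism \<phi> \<longleftrightarrow> bij \<phi> \<and> field_hom \<phi> \<and> (\<forall>c. \<phi> (const c) = const c)"

definition is_aut_with :: "(gen \<Rightarrow> K) \<Rightarrow> (K \<Rightarrow> K) \<Rightarrow> bool" where
  "is_aut_with \<sigma> \<phi> \<longleftrightarrow> C_automorphism \<phi> \<and> (\<forall>g. \<phi> (Var g) = \<sigma> g)"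

definition aut_of :: "(gen \<Rightarrow> K) \<Rightarrow> K \<Rightarrow> K" where
  "aut_of \<sigma> = (THE \<phi>. is_aut_with \<sigma> \<phi>)"

text \<open>
  The images of the generators under the simple reflections (\<open>j = 0,\<dots>,7\<close>); updating \<^const>\<open>Var\<close>
  leaves the generators that are not mentioned fixed.
\<close>

definition weyl_img :: "nat \<Rightarrow> gen \<Rightarrow> K" where
  "weyl_img j =
    (let e = par_e; h1 = par_h1; h2 = par_h2; x = coord_x; y = coord_y;
         hm = h1 - h2; a1 = e 3 + e 4; a2 = e 3 * e 4
     in
     if j = 0 then Var(ge 3 := e 4, ge 4 := e 3)
     else if j = 1 then Var(
       ge 1 := h1 / e 2, ge 2 := h1 / e 1, Gh2 := h1 * h2 / (e 1 * e 2),
       Gy := (- h2 * (e 1 * e 2 - h1) * x + h1 * (e 1 * e 2 - h2) * y) / (e 1 * e 2 * hm))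
     else if j = 2 then Var(Gh1 := h2, Gh2 := h1, Gx := y, Gy := x)
     else if j = 3 then Var(
       ge 3 := h1 / e 4, ge 4 := h1 / e 3, Gh2 := h1 * h2 / (e 3 * e 4),
       Gy := (a2 * hm * x * y + a1 * h2 * (a2 - h1) * x - a1 * h1 * (a2 - h2) * y
                + (a2 - h1) * (a2 - h2) * hm)
             / (a2 * ((a2 - h2) * x - (a2 - h1) * y - a1 * hm)))
     else Var(ge j := e (j + 1), ge (j + 1) := e j))"

definition weyl_s :: "nat \<Rightarrow> K \<Rightarrow> K" where
  "weyl_s j = aut_of (weyl_img j)"

definition weyl_w :: "K \<Rightarrow> K" where
  "weyl_w = foldr (\<circ>) (map weyl_s
     [2,6,7,5,6,4,5,6,7,3,4,5,6,7,1,0,4,5,6,7,3,4,5,6,0,4,5,3,4]) id"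

definition T :: "K \<Rightarrow> K" where "T = weyl_w \<circ> weyl_w"

definition T_inv :: "K \<Rightarrow> K" where "T_inv = inv T"

text \<open>The field \<open>K(\<lambda>)\<close>.\<close>

type_synonym K_lam = "K poly fract"

definition incl :: "K \<Rightarrow> K_lam" where "incl k = Fract [:k:] 1"

definition lam :: K_lam where "lam = Fract [:0, 1:] 1"

definition extends_T :: "(K_lam \<Rightarrow> K_lam) \<Rightarrow> bool" where
  "extends_T \<tau> \<longleftrightarrow> bij \<tau> \<and> field_hom \<tau> \<and> (\<forall>k. \<tau> (incl k) = incl (T k)) \<and>
     \<tau> lam = lam * incl (T par_h1) / incl par_h2"

definition T_lam :: "K_lam \<Rightarrow> K_lam" where
  "T_lam = (THE \<tau>. extends_T \<tau>)"

definition T_lam_inv :: "K_lam \<Rightarrow> K_lam" where "T_lam_inv = inv T_lam"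

definition var_v :: "nat \<Rightarrow> K_lam" where "var_v i = incl (par_e i) / lam"
definition var_k1 :: K_lam where "var_k1 = incl par_h1 / lam\<^sup>2"
definition var_k2 :: K_lam where "var_k2 = incl par_h2 / lam\<^sup>2"
definition var_f :: K_lam where "var_f = incl coord_x / lam"
definition var_g :: K_lam where "var_g = incl coord_y / lam"

text \<open>
  An equation between fractions always includes the claim that the denominators do not vanish,
  so that division by zero plays no role.
\<close>

definition frac_eq :: "'a::field \<Rightarrow> 'a \<Rightarrow> 'a \<Rightarrow> 'a \<Rightarrow> bool" where
  "frac_eq a b c d \<longleftrightarrow> b \<noteq> 0 \<and> d \<noteq> 0 \<and> a / b = c / d"

text \<open>With the parameters \<open>e\<^sub>i\<close> this is \<open>U\<close>, with the parameters \<open>v\<^sub>i\<close> it is \<open>V\<close>.\<close>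

definition U :: "(nat \<Rightarrow> 'a::field) \<Rightarrow> 'a \<Rightarrow> 'a" where
  "U e z = (\<Prod>i=3..8. z - e i) / z ^ 3"

text \<open>
  The equations in the variables \<open>x, y, z\<close>; the arguments \<open>y'\<close>, \<open>h2'\<close> stand for
  \<open>T\<^sup>-\<^sup>1(y)\<close>, \<open>T\<^sup>-\<^sup>1(h\<^sub>2)\<close>, and \<open>x'\<close>, \<open>h1'\<close> for \<open>T(x)\<close>, \<open>T(h\<^sub>1)\<close>.
\<close>

definition eq_y ::
  "(nat \<Rightarrow> 'a::field) \<Rightarrow> 'a \<Rightarrow> 'a \<Rightarrow> 'a \<Rightarrow> 'a \<Rightarrow> 'a \<Rightarrow> 'a \<Rightarrow> bool" where
  "eq_y e h1 h2 h2' y y' z \<longleftrightarrow>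
     frac_eq ((y' - (z + h2' / z)) * (y - (h1 / z + h2 * z / h1)))
             ((y' - (h1 / z + h2' * z / h1)) * (y - (z + h2 / z)))
             (U e (h1 / z)) (U e z)"

definition eq_x ::
  "(nat \<Rightarrow> 'a::field) \<Rightarrow> 'a \<Rightarrow> 'a \<Rightarrow> 'a \<Rightarrow> 'a \<Rightarrow> 'a \<Rightarrow> 'a \<Rightarrow> bool" where
  "eq_x e h1 h2 h1' x x' z \<longleftrightarrow>
     frac_eq ((x' - (z + h1' / z)) * (x - (h2 / z + h1 * z / h2)))
             ((x' - (h2 / z + h1' * z / h2)) * (x - (z + h1 / z)))
             (U e (h2 / z)) (U e z)"

text \<open>
  The two halves of the \<open>q\<close>-\<open>E\<^sub>7\<close> equation; \<open>g'\<close> and \<open>f'\<close> stand for the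
  down-shift of \<open>g\<close> and the up-shift of \<open>f\<close>.
\<close>

definition qE7_g ::
  "'a::field \<Rightarrow> (nat \<Rightarrow> 'a) \<Rightarrow> 'a \<Rightarrow> 'a \<Rightarrow> 'a \<Rightarrow> 'a \<Rightarrow> 'a \<Rightarrow> bool" where
  "qE7_g q v k1 k2 g g' u \<longleftrightarrow>
     (let G = \<lambda>u. u + k2 / u; G' = \<lambda>u. u + k2 / (q * u) in
      frac_eq ((g - G (k1 / u)) * (g' - G' (k1 / u)))
              ((g - G u) * (g' - G' u))
              (U v (k1 / u)) (U v u))"

definition qE7_f ::
  "'a::field \<Rightarrow> (nat \<Rightarrow> 'a) \<Rightarrow> 'a \<Rightarrow> 'a \<Rightarrow> 'a \<Rightarrow> 'a \<Rightarrow> 'a \<Rightarrow> bool" where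
  "qE7_f q v k1 k2 f f' u \<longleftrightarrow>
     (let F = \<lambda>u. u + k1 / u; F' = \<lambda>u. u + k1 / (q * u) in
      frac_eq ((f - F (k2 / u)) * (f' - F' (k2 / u)))
              ((f - F u) * (f' - F' u))
              (U v (k2 / u)) (U v u))"

text \<open>
  The function field \<open>F(x,y)\<close> of \<open>P\<^sup>1 \<times> P\<^sup>1\<close> over a field \<open>F\<close> is represented as the field of
  fractions of \<open>F[x][y]\<close>.
\<close>

definition cst :: "'a::field \<Rightarrow> 'a poly poly fract" where "cst a = Fract [:[:a:]:] 1"
definition fx :: "'a::field poly poly fract" where "fx = Fract [:[:0, 1:]:] 1"
definition fy :: "'a::field poly poly fract" where "fy = Fract [:0, 1:] 1"

datatype 'a proj1 = Affine 'a | Infinity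

text \<open>
  \<open>Near p d\<close> is the point in direction \<open>d\<close> on the exceptional curve of the blow-up at \<open>p\<close>,
  which may itself be infinitely near.  If \<open>(s, t)\<close> are the local parameters chosen at \<open>p\<close>,
  then \<open>d\<close> is the value of \<open>t / s\<close>.
\<close>

datatype 'a bpoint = Proper "'a proj1" "'a proj1" | Near "'a bpoint" "'a proj1"

primrec loc_coord :: "'a::field poly poly fract \<Rightarrow> 'a proj1 \<Rightarrow> 'a poly poly fract" where
  "loc_coord z (Affine a) = z - cst a"
| "loc_coord z Infinity = 1 / z"

primrec local_params ::
  "'a::field bpoint \<Rightarrow> 'a poly poly fract \<times> 'a poly poly fract" where
  "local_params (Proper a b) = (loc_coord fx a, loc_coord fy b)"
| "local_params (Near p d) =
     (case local_params p of (s, t) \<Rightarrow>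
        (case d of Affine c \<Rightarrow> (s, t / s - cst c) | Infinity \<Rightarrow> (s / t, t)))"

text \<open>
  \<open>eval2 A s t\<close> is \<open>A(s, t)\<close>, where the outer variable of \<open>A\<close> is replaced by \<open>t\<close>.
\<close>

definition eval2 ::
  "'a::field poly poly \<Rightarrow> 'a poly poly fract \<Rightarrow> 'a poly poly fract \<Rightarrow> 'a poly poly fract" where
  "eval2 A s t = poly (map_poly (\<lambda>p. poly (map_poly cst p) s) A) t"

text \<open>
  The local ring at \<open>p\<close> is the localization of \<open>F[s, t]\<close> at the origin.  A rational function is
  determinate at \<open>p\<close> if, as a map to \<open>P\<^sup>1\<close>, it can be written \<open>[A(s,t) : B(s,t)]\<close> with
  \<open>A\<close>, \<open>B\<close> not both vanishing at the origin.
\<close>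

definition indeterminate_at :: "'a::field poly poly fract \<Rightarrow> 'a bpoint \<Rightarrow> bool" where
  "indeterminate_at r p \<longleftrightarrow>
     (case local_params p of (s, t) \<Rightarrow>
        \<not> (\<exists>A B. (poly (poly A 0) 0 \<noteq> 0 \<or> poly (poly B 0) 0 \<noteq> 0) \<and>
                 r * eval2 B s t = eval2 A s t))"

text \<open>
  Parameters are generic: \<open>\<theta>\<close> embeds \<open>K\<close> into \<open>F(x,y)\<close>, mapping \<open>x, y\<close> to the coordinates and the
  parameters to elements \<open>e\<^sub>i, h\<^sub>1, h\<^sub>2\<close> of \<open>F\<close>.  As \<open>\<theta>\<close> is injective, these are algebraically
  independent over the complex numbers.  \<open>F\<close> may be any extension of the field of parameters, so
  that all geometric points are covered.
\<close>

definition generic_fibre ::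
  "(K \<Rightarrow> 'a::field poly poly fract) \<Rightarrow> (nat \<Rightarrow> 'a) \<Rightarrow> 'a \<Rightarrow> 'a \<Rightarrow> bool" where
  "generic_fibre \<theta> e h1 h2 \<longleftrightarrow>
     field_hom \<theta> \<and> (\<forall>c. \<theta> (const c) \<in> range cst) \<and>
     (\<forall>i\<in>{1..8}. \<theta> (par_e i) = cst (e i)) \<and> \<theta> par_h1 = cst h1 \<and> \<theta> par_h2 = cst h2 \<and>
     \<theta> coord_x = fx \<and> \<theta> coord_y = fy"

definition singular_points :: "(K \<Rightarrow> 'a::field poly poly fract) \<Rightarrow> 'a bpoint set" where
  "singular_points \<theta> =
     {p. indeterminate_at (\<theta> (T_inv coord_y)) p \<or> indeterminate_at (\<theta> (T coord_x)) p}"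

definition simple_point :: "(nat \<Rightarrow> 'a::field) \<Rightarrow> 'a \<Rightarrow> 'a \<Rightarrow> nat \<Rightarrow> 'a bpoint" where
  "simple_point e h1 h2 i = Proper (Affine (e i + h1 / e i)) (Affine (e i + h2 / e i))"

text \<open>
  The infinitely near part of the double point.  At \<open>(\<infinity>,\<infinity>)\<close> the local parameters are
  \<open>(s, t) = (1/x, 1/y)\<close>, so the direction \<open>t / s = x / y\<close> is the reciprocal of \<open>lim y / x\<close>.
\<close>

definition double_point_near :: "(nat \<Rightarrow> 'a::field) \<Rightarrow> 'a \<Rightarrow> 'a \<Rightarrow> 'a bpoint" where
  "double_point_near e h1 h2 =
     (let slope = (1 - e 1 * e 2 / h1) / (1 - e 1 * e 2 / h2)
      in Near (Proper Infinity Infinity) (Affine (1 / slope)))"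

end

theory Submission
  imports Defs "HOL-Algebra.Algebraic_Closure_Type"
begin

text \<open>
  The word \<open>w\<close> is \<open>s\<^sub>2 R\<close>, where \<open>R\<close> does not involve \<open>s\<^sub>2\<close> and hence fixes \<open>x\<close> and \<open>h\<^sub>1\<close>. On the fibre
  \<open>x = z + h\<^sub>1/z\<close> put \<open>\<rho> = (y - z - h\<^sub>2/z) / (y - h\<^sub>1/z - h\<^sub>2z/h\<^sub>1)\<close>. Every reflection in \<open>R\<close> permutes the
  parameters up to \<open>e \<mapsto> h\<^sub>1/e\<close> and multiplies \<open>\<rho>\<close> by a factor, which is trivial except for \<open>s\<^sub>3\<close>; the
  three factors coming from \<open>s\<^sub>3\<close> multiply to \<open>U(h\<^sub>1/z)/U(z)\<close>. It follows that \<open>R\<close> is an involution, so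
  that \<open>T\<^sup>-\<^sup>1(y) = R(y)\<close> and \<open>T(x) = s\<^sub>2(R(y))\<close>, and both equations say how \<open>R\<close> acts on \<open>\<rho>\<close>.

  Eliminating \<open>z\<close> gives \<open>T\<^sup>-\<^sup>1(y) = N/D\<close> with \<open>N\<close> and \<open>D\<close> linear in \<open>y\<close> and of degrees \<open>4\<close> and \<open>3\<close> in \<open>x\<close>. Their
  resultant with respect to \<open>y\<close> has degree \<open>6\<close> in \<open>x\<close> and the simple roots \<open>e\<^sub>i + h\<^sub>1/e\<^sub>i\<close>, so that \<open>N\<close> and \<open>D\<close>
  meet transversally at the six simple points. At \<open>(\<infinity>,\<infinity>)\<close> they meet transversally after one blow-up.
  A transversal common zero is a point of indeterminacy that is resolved by blowing it up once.
\<close>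

text \<open>The parameter \<open>z\<close> lies in a quadratic extension of K. Identities on the
  fibre are therefore proved in an algebraic closure, and those from which \<open>z\<close> has
  disappeared return to K because the embedding is injective. R is an involution for two reasons:
  the factor of s_3 at (a, b) is inverse to the one at (h1/a, h1/b), and the product of three such
  factors does not depend on how e_3,...,e_8 are paired. Elimination of \<open>z\<close> works
  because cross-multiplying the first equation gives expressions that change sign under z <-> h1/z;
  divided by z - h1/z they are polynomials in x. Division is total, so each denominator must be
  shown not to vanish; this comes down to nonzero polynomials in the generators, recognised by a
  nonzero value at a complex point. For T(x) the roles of x and y are exchanged, but the local
  parameters at a point are ordered, so the blow-up of (infinity, infinity) is studied in both of
  its charts.\<close>

hide_const (open) up_ring.coeff up_ring.monom Polynomials.degree module.smult

section \<open>Field homomorphisms\<close>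

context
  fixes \<phi> :: "'a::field \<Rightarrow> 'b::field"
  assumes hom: "field_hom \<phi>"
begin

lemma field_hom_1: "\<phi> 1 = 1"
  and field_hom_add: "\<phi> (a + b) = \<phi> a + \<phi> b"
  and field_hom_mult: "\<phi> (a * b) = \<phi> a * \<phi> b"
  using hom by (auto simp: field_hom_def)

lemma field_hom_0: "\<phi> 0 = 0"
  using field_hom_add[of 0 0] by (metis add_0_right add_left_cancel)

lemma field_hom_minus: "\<phi> (- a) = - \<phi> a"
  using field_hom_add[of a "- a"] by (simp add: field_hom_0 add_eq_0_iff)

lemma field_hom_diff: "\<phi> (a - b) = \<phi> a - \<phi> b"
  using field_hom_add[of a "- b"] by (simp add: field_hom_minus)

lemma field_hom_eq_0_iff: "\<phi> a = 0 \<longleftrightarrow> a = 0"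
  using field_hom_mult[of a "inverse a"] by (cases "a = 0") (auto simp: field_hom_0 field_hom_1)

lemma field_hom_eq_iff: "\<phi> a = \<phi> b \<longleftrightarrow> a = b"
  using field_hom_eq_0_iff[of "a - b"] by (simp add: field_hom_diff)

lemma field_hom_divide: "\<phi> (a / b) = \<phi> a / \<phi> b"
proof (cases "b = 0")
  case False
  then have "\<phi> (a / b) * \<phi> b = \<phi> a" "\<phi> b \<noteq> 0"
    by (simp_all flip: field_hom_mult add: field_hom_eq_0_iff)
  then show ?thesis
    by (simp add: eq_divide_eq)
qed (simp add: field_hom_0)

lemma field_hom_power: "\<phi> (a ^ n) = \<phi> a ^ n"
  by (induction n) (simp_all add: field_hom_1 field_hom_mult)

lemma field_hom_numeral: "\<phi> (numeral n) = numeral n"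
  by (induction n) (simp_all only: numeral.simps field_hom_1 field_hom_add)

lemma field_hom_prod: "\<phi> (\<Prod>i\<in>A. f i) = (\<Prod>i\<in>A. \<phi> (f i))"
  by (induction A rule: infinite_finite_induct) (simp_all add: field_hom_1 field_hom_mult)

lemmas field_hom_simps = field_hom_1 field_hom_add field_hom_mult field_hom_0 field_hom_minus
  field_hom_diff field_hom_divide field_hom_power field_hom_numeral

end

lemma field_hom_comp: "field_hom \<phi> \<Longrightarrow> field_hom \<psi> \<Longrightarrow> field_hom (\<phi> \<circ> \<psi>)"
  by (simp add: field_hom_def)

lemma field_hom_inv:
  assumes "field_hom \<phi>" "bij \<phi>"
  shows "field_hom (inv_into UNIV \<phi>)"
proof -
  have "\<phi> (inv_into UNIV \<phi> a) = a" for a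
    using assms(2) by (simp add: bij_is_surj surj_f_inv_f)
  then have "inv_into UNIV \<phi> 1 = 1" "inv_into UNIV \<phi> (a + b) = inv_into UNIV \<phi> a + inv_into UNIV \<phi> b" "inv_into UNIV \<phi> (a * b) = inv_into UNIV \<phi> a * inv_into UNIV \<phi> b" for a b
    by (simp_all add: field_hom_simps[OF assms(1)] flip: field_hom_eq_iff[OF assms(1)])
  then show ?thesis
    by (simp add: field_hom_def)
qed

lemma field_hom_to_ac: "field_hom to_ac"
  by (simp add: field_hom_def)

lemma map_poly_ring_hom:
  fixes f :: "'a::comm_ring_1 \<Rightarrow> 'b::comm_ring_1"
  assumes f: "f 0 = 0" "\<And>a b. f (a + b) = f a + f b" "\<And>a b. f (a * b) = f a * f b"
  shows "map_poly f (p + q) = map_poly f p + map_poly f q"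
    and "map_poly f (p * q) = map_poly f p * map_poly f q"
    and "map_poly f (pCons a p) = pCons (f a) (map_poly f p)"
proof -
  have "f (sum g A) = (\<Sum>x\<in>A. f (g x))" for g :: "nat \<Rightarrow> 'a" and A
    by (induction A rule: infinite_finite_induct) (simp_all add: f)
  then show "map_poly f (p + q) = map_poly f p + map_poly f q"
    "map_poly f (p * q) = map_poly f p * map_poly f q"
    "map_poly f (pCons a p) = pCons (f a) (map_poly f p)"
    by (auto intro!: poly_eqI simp: coeff_map_poly coeff_mult f map_poly_pCons)
qed

lemma map_poly_field_hom:
  assumes "field_hom \<phi>"
  shows "map_poly \<phi> (p + q) = map_poly \<phi> p + map_poly \<phi> q"
    and "map_poly \<phi> (p * q) = map_poly \<phi> p * map_poly \<phi> q"
    and "map_poly \<phi> (pCons a p) = pCons (\<phi> a) (map_poly \<phi> p)"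
  by (rule map_poly_ring_hom; simp add: field_hom_simps[OF assms])+

section \<open>Evaluation of polynomials in the generators\<close>

type_synonym cpoly = "(gen \<Rightarrow>\<^sub>0 nat) \<Rightarrow>\<^sub>0 complex"

lemma UNIV_gen: "UNIV = {Ge1, Ge2, Ge3, Ge4, Ge5, Ge6, Ge7, Ge8, Gh1, Gh2, Gx, Gy}"
  using gen.exhaust by auto

lemma finite_UNIV_gen: "finite (UNIV :: gen set)"
  by (simp add: UNIV_gen)

definition pvar :: "gen \<Rightarrow> cpoly" where
  "pvar g = Poly_Mapping.single (Poly_Mapping.single g 1) 1"

definition pconst :: "complex \<Rightarrow> cpoly" where
  "pconst c = Poly_Mapping.single 0 c"

definition mon_eval :: "(gen \<Rightarrow> 'b::field) \<Rightarrow> (gen \<Rightarrow>\<^sub>0 nat) \<Rightarrow> 'b" where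
  "mon_eval \<sigma> m = (\<Prod>g\<in>UNIV. \<sigma> g ^ Poly_Mapping.lookup m g)"

text \<open>The coefficient map \<kappa> has two uses: the identity specialises the generators to
  complex numbers, \<open>const\<close> substitutes elements of K for them.\<close>

definition cpoly_eval :: "(complex \<Rightarrow> 'b::field) \<Rightarrow> (gen \<Rightarrow> 'b) \<Rightarrow> cpoly \<Rightarrow> 'b" where
  "cpoly_eval \<kappa> \<sigma> p = (\<Sum>m\<in>Poly_Mapping.keys p. \<kappa> (Poly_Mapping.lookup p m) * mon_eval \<sigma> m)"

lemma poly_mapping_single_add_induct [case_names zero single add]:
  fixes p :: "'a \<Rightarrow>\<^sub>0 'b::comm_monoid_add"
  assumes "P 0" "\<And>k c. P (Poly_Mapping.single k c)" "\<And>p q. P p \<Longrightarrow> P q \<Longrightarrow> P (p + q)"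
  shows "P p"
proof (induction p rule: update_induct)
  case (update f a b)
  have "Poly_Mapping.update a b f = f + Poly_Mapping.single a b"
  proof (rule poly_mapping_eqI)
    fix k
    show "Poly_Mapping.lookup (Poly_Mapping.update a b f) k =
        Poly_Mapping.lookup (f + Poly_Mapping.single a b) k"
      using update(1)
      by (auto simp: lookup_update lookup_add lookup_single not_in_keys_iff_lookup_eq_zero when_def)
  qed
  then show ?case
    using assms update by simp
qed (rule assms(1))

lemma cpoly_induct [case_names const var add mult]:
  assumes "\<And>c. P (pconst c)" "\<And>g. P (pvar g)"
    and add: "\<And>p q. P p \<Longrightarrow> P q \<Longrightarrow> P (p + q)" and mult: "\<And>p q. P p \<Longrightarrow> P q \<Longrightarrow> P (p * q)"
  shows "P p"
proof -
  have 0: "P 0" "P 1"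
    using assms(1)[of 0] assms(1)[of 1] by (simp_all add: pconst_def)
  have pow: "P (pvar g ^ n)" for g n
    by (induction n) (use assms 0 in auto)
  have pow_eq: "Poly_Mapping.single (Poly_Mapping.single g n) 1 = pvar g ^ n" for g n
  proof (induction n)
    case (Suc n)
    have "Poly_Mapping.single g (Suc n) = Poly_Mapping.single g 1 + Poly_Mapping.single g n"
      by (simp flip: single_add)
    then show ?case
      using Suc mult_single[of "Poly_Mapping.single g 1" "1::complex" "Poly_Mapping.single g n" 1]
      by (simp add: pvar_def)
  qed simp
  have mon: "P (Poly_Mapping.single m 1)" for m
  proof (induction m rule: poly_mapping_single_add_induct)
    case (add p q)
    then show ?case
      using mult[of "Poly_Mapping.single p 1" "Poly_Mapping.single q 1"] by (simp add: mult_single)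
  qed (use 0 pow pow_eq in auto)
  have "P (Poly_Mapping.single m c)" for m c
    using mult[OF assms(1)[of c] mon[of m]] by (simp add: pconst_def mult_single)
  then show ?thesis
    by (induction p rule: poly_mapping_single_add_induct) (use 0 add in auto)
qed

lemma mon_eval_add: "mon_eval \<sigma> (m + n) = mon_eval \<sigma> m * mon_eval \<sigma> n"
  by (simp add: mon_eval_def lookup_add power_add prod.distrib)

lemma mon_eval_single: "mon_eval \<sigma> (Poly_Mapping.single g 1) = \<sigma> g"
proof -
  have "mon_eval \<sigma> (Poly_Mapping.single g 1) = (\<Prod>g'\<in>UNIV. if g' = g then \<sigma> g' else 1)"
    unfolding mon_eval_def by (rule prod.cong) (auto simp: lookup_single when_def)
  then show ?thesis
    by (simp add: prod.delta[OF finite_UNIV_gen])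
qed

lemma mon_eval_0 [simp]: "mon_eval \<sigma> 0 = 1"
  by (simp add: mon_eval_def)

context
  fixes \<kappa> :: "complex \<Rightarrow> 'b::field" and \<sigma> :: "gen \<Rightarrow> 'b"
  assumes \<kappa>: "field_hom \<kappa>"
begin

lemma cpoly_eval_single: "cpoly_eval \<kappa> \<sigma> (Poly_Mapping.single m c) = \<kappa> c * mon_eval \<sigma> m"
  by (simp add: cpoly_eval_def field_hom_0[OF \<kappa>])

lemma cpoly_eval_const: "cpoly_eval \<kappa> \<sigma> (pconst c) = \<kappa> c"
  by (simp add: pconst_def cpoly_eval_single)

lemma cpoly_eval_var: "cpoly_eval \<kappa> \<sigma> (pvar g) = \<sigma> g"
  by (simp add: pvar_def cpoly_eval_single mon_eval_single[simplified] field_hom_1[OF \<kappa>])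

lemma cpoly_eval_0: "cpoly_eval \<kappa> \<sigma> 0 = 0"
  by (simp add: cpoly_eval_def)

lemma cpoly_eval_1: "cpoly_eval \<kappa> \<sigma> 1 = 1"
  using cpoly_eval_const[of 1] by (simp add: pconst_def field_hom_1[OF \<kappa>])

lemma cpoly_eval_add: "cpoly_eval \<kappa> \<sigma> (p + q) = cpoly_eval \<kappa> \<sigma> p + cpoly_eval \<kappa> \<sigma> q"
  unfolding cpoly_eval_def
  by (rule setsum_keys_plus_distrib) (simp_all add: field_hom_simps[OF \<kappa>] distrib_right)

lemma cpoly_eval_mult: "cpoly_eval \<kappa> \<sigma> (p * q) = cpoly_eval \<kappa> \<sigma> p * cpoly_eval \<kappa> \<sigma> q"
proof (induction p rule: poly_mapping_single_add_induct)
  case (single m c)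
  show ?case
    by (induction q rule: poly_mapping_single_add_induct)
      (simp_all add: mult_single cpoly_eval_single cpoly_eval_add cpoly_eval_0 mon_eval_add
         field_hom_mult[OF \<kappa>] distrib_left)
qed (simp_all add: cpoly_eval_0 cpoly_eval_add distrib_right)

lemma cpoly_eval_minus: "cpoly_eval \<kappa> \<sigma> (- p) = - cpoly_eval \<kappa> \<sigma> p"
  using cpoly_eval_add[of p "- p"] by (simp add: cpoly_eval_0 add_eq_0_iff)

lemma cpoly_eval_diff: "cpoly_eval \<kappa> \<sigma> (p - q) = cpoly_eval \<kappa> \<sigma> p - cpoly_eval \<kappa> \<sigma> q"
  using cpoly_eval_add[of p "- q"] by (simp add: cpoly_eval_minus)

lemma cpoly_eval_power: "cpoly_eval \<kappa> \<sigma> (p ^ n) = cpoly_eval \<kappa> \<sigma> p ^ n"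
  by (induction n) (simp_all add: cpoly_eval_1 cpoly_eval_mult)

lemmas cpoly_eval_simps = cpoly_eval_const cpoly_eval_var cpoly_eval_0 cpoly_eval_1 cpoly_eval_add
  cpoly_eval_mult cpoly_eval_minus cpoly_eval_diff cpoly_eval_power

end

section \<open>The field K\<close>

lemma to_fract_power: "to_fract (p ^ n) = to_fract p ^ n"
  by (induction n) (simp_all add: to_fract_1 to_fract_mult)

lemma to_fract_numeral: "to_fract (numeral n) = numeral n"
  by (induction n) (simp_all only: numeral.simps to_fract_1 to_fract_add)

lemma Fract_eq_to_fract_divide: "Fract p q = to_fract p / to_fract q"
  by (simp add: to_fract_def)

lemma fract_to_fract_cases:
  obtains p q where "r = to_fract p / to_fract q" "q \<noteq> 0"
  by (cases r) (auto simp: Fract_eq_to_fract_divide)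

lemma to_fract_pvar: "to_fract (pvar g) = Var g"
  by (simp add: to_fract_def pvar_def Var_def)

lemma to_fract_pconst: "to_fract (pconst c) = const c"
  by (simp add: to_fract_def pconst_def const_def)

lemma field_hom_const: "field_hom const"
  by (simp add: field_hom_def const_def single_add mult_single One_fract_def)

lemma K_induct [case_names const var add mult divide]:
  fixes r :: K
  assumes "\<And>c. P (const c)" "\<And>g. P (Var g)"
    and "\<And>p q. P p \<Longrightarrow> P q \<Longrightarrow> P (p + q)" and "\<And>p q. P p \<Longrightarrow> P q \<Longrightarrow> P (p * q)"
    and "\<And>p q. P p \<Longrightarrow> P q \<Longrightarrow> P (p / q)"
  shows "P r"
proof -
  have "P (to_fract p)" for p
    by (induction p rule: cpoly_induct) (use assms in \<open>auto simp: to_fract_pvar to_fract_pconst to_fract_add to_fract_mult\<close>)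
  then show ?thesis
    using assms(5) by (metis fract_to_fract_cases)
qed

lemma field_hom_K_eqI:
  fixes \<phi> \<psi> :: "K \<Rightarrow> 'b::field"
  assumes hom: "field_hom \<phi>" "field_hom \<psi>"
    and "\<And>c. \<phi> (const c) = \<psi> (const c)" "\<And>g. \<phi> (Var g) = \<psi> (Var g)"
  shows "\<phi> = \<psi>"
proof
  fix r :: K
  show "\<phi> r = \<psi> r"
    by (induction r rule: K_induct)
      (simp_all add: assms field_hom_simps[OF hom(1)] field_hom_simps[OF hom(2)])
qed

text \<open>The universal property of a field of fractions: since \<open>E\<close> has no kernel,
  denominators stay nonzero, and cross-multiplication shows that the value does not depend on the
  chosen fraction.\<close>

lemma field_hom_fract_exists:
  fixes E :: "'p::idom \<Rightarrow> 'b::field"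
  assumes E: "E 1 = 1" "\<And>p q. E (p + q) = E p + E q" "\<And>p q. E (p * q) = E p * E q"
    and inj: "\<And>p. p \<noteq> 0 \<Longrightarrow> E p \<noteq> 0"
  obtains \<phi> :: "'p fract \<Rightarrow> 'b"
  where "field_hom \<phi>" "\<And>p. \<phi> (to_fract p) = E p"
proof -
  define \<phi> where "\<phi> r = (SOME v. \<exists>p q. q \<noteq> 0 \<and> r = to_fract p / to_fract q \<and> v = E p / E q)" for r
  have \<phi>: "\<phi> (to_fract p / to_fract q) = E p / E q" if "q \<noteq> 0" for p q
  proof -
    have "v = E p / E q" if q': "q' \<noteq> 0" "to_fract p / to_fract q = to_fract p' / to_fract q'" "v = E p' / E q'"
      for p' q' v
    proof -
      have "p * q' = p' * q"
        using q' \<open>q \<noteq> 0\<close>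
        by (simp add: frac_eq_eq del: to_fract_mult flip: to_fract_mult)
      then have "E p * E q' = E p' * E q"
        by (metis E(3))
      then show ?thesis
        using q'(3) inj[OF q'(1)] inj[OF \<open>q \<noteq> 0\<close>] by (simp add: frac_eq_eq)
    qed
    then show ?thesis
      unfolding \<phi>_def using that by (intro some_equality) blast+
  qed
  have 1: "\<phi> (to_fract p) = E p" for p
    using \<phi>[of 1 p] by (simp add: E(1))
  have "\<phi> 1 = 1"
    using 1[of 1] by (simp add: E(1))
  moreover have "\<phi> (a + b) = \<phi> a + \<phi> b \<and> \<phi> (a * b) = \<phi> a * \<phi> b" for a b
  proof -
    obtain p q where a: "a = to_fract p / to_fract q" "q \<noteq> 0" by (rule fract_to_fract_cases)
    obtain r s where b: "b = to_fract r / to_fract s" "s \<noteq> 0" by (rule fract_to_fract_cases)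
    have "a + b = to_fract (p * s + r * q) / to_fract (q * s)" "a * b = to_fract (p * r) / to_fract (q * s)"
      using a(2) b(2) unfolding a(1) b(1) by (simp_all add: divide_simps)
    then have "\<phi> (a + b) = E (p * s + r * q) / E (q * s)" "\<phi> (a * b) = E (p * r) / E (q * s)"
      using a(2) b(2) by (simp_all only: \<phi> no_zero_divisors not_False_eq_True)
    then show ?thesis
      using inj[OF a(2)] inj[OF b(2)] a b by (simp add: \<phi> E add_frac_eq)
  qed
  ultimately have "field_hom \<phi>"
    by (simp add: field_hom_def)
  then show ?thesis
    using that 1 by blast
qed

text \<open>The genericity test: one complex specialisation with a nonzero value suffices. The
  points \<tau> used below are mostly zero in order to kill all but a few monomials.\<close>

lemma to_fract_cpoly_neq_0:
  assumes "cpoly_eval (\<lambda>c. c) \<tau> p \<noteq> 0"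
  shows "to_fract p \<noteq> 0"
  using assms by (auto simp: to_fract_eq_0_iff cpoly_eval_def)

lemma field_hom_ident: "field_hom (\<lambda>c. c)"
  by (simp add: field_hom_def)

lemma Var_neq_0 [simp]: "Var g \<noteq> 0"
  unfolding to_fract_pvar[symmetric]
  by (rule to_fract_cpoly_neq_0[where \<tau> = "\<lambda>_. 1"]) (simp add: cpoly_eval_var[OF field_hom_ident])

lemma is_aut_with_unique: "is_aut_with \<sigma> \<phi> \<Longrightarrow> is_aut_with \<sigma> \<psi> \<Longrightarrow> \<phi> = \<psi>"
  by (rule field_hom_K_eqI) (auto simp: is_aut_with_def C_automorphism_def)

lemma aut_of_eq: "is_aut_with \<sigma> \<phi> \<Longrightarrow> aut_of \<sigma> = \<phi>"
  unfolding aut_of_def using is_aut_with_unique by (intro the_equality)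

text \<open>
  If the substitution \<open>\<sigma>\<close> is an involution as far as it can be composed with itself, then every
  polynomial is recovered from its image, up to a power of the denominator; hence the evaluation
  at \<open>\<sigma>\<close> has trivial kernel.
\<close>

lemma is_aut_with_aut_of:
  fixes \<sigma> :: "gen \<Rightarrow> K"
  assumes N: "\<And>g. \<sigma> g * to_fract D = to_fract (N g)"
    and D: "cpoly_eval const \<sigma> D \<noteq> 0"
    and inv: "\<And>g. cpoly_eval const \<sigma> (N g) = Var g * cpoly_eval const \<sigma> D"
  shows "is_aut_with \<sigma> (aut_of \<sigma>)"
proof -
  let ?E = "cpoly_eval const \<sigma>"
  note E = cpoly_eval_simps[OF field_hom_const]
  have "\<exists>k n. ?E p * to_fract D ^ k = to_fract n \<and> ?E n = to_fract p * ?E D ^ k" for p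
  proof (induction p rule: cpoly_induct)
    case (const c)
    show ?case
      by (rule exI[of _ 0], rule exI[of _ "pconst c"]) (simp add: E to_fract_pconst)
  next
    case (var g)
    show ?case
      by (rule exI[of _ 1], rule exI[of _ "N g"]) (simp add: E N inv to_fract_pvar)
  next
    case (add p q)
    then obtain k n k' n' where
      "to_fract n = ?E p * to_fract D ^ k" "?E n = to_fract p * ?E D ^ k"
      "to_fract n' = ?E q * to_fract D ^ k'" "?E n' = to_fract q * ?E D ^ k'" by metis
    then show ?case
      by (intro exI[of _ "k + k'"] exI[of _ "n * D ^ k' + n' * D ^ k"])
        (simp add: E to_fract_add to_fract_mult to_fract_power power_add algebra_simps)
  next
    case (mult p q)
    then obtain k n k' n' where
      "to_fract n = ?E p * to_fract D ^ k" "?E n = to_fract p * ?E D ^ k"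
      "to_fract n' = ?E q * to_fract D ^ k'" "?E n' = to_fract q * ?E D ^ k'" by metis
    then show ?case
      by (intro exI[of _ "k + k'"] exI[of _ "n * n'"])
        (simp add: E to_fract_mult power_add mult_ac)
  qed
  then have inj: "?E p \<noteq> 0" if "p \<noteq> 0" for p
    using that D by (metis E(3) to_fract_0 to_fract_eq_0_iff mult_eq_0_iff power_not_zero)
  obtain \<phi> where \<phi>: "field_hom \<phi>" "\<And>p. \<phi> (to_fract p) = ?E p"
    using field_hom_fract_exists[of ?E] inj E by metis
  note h = field_hom_simps[OF \<phi>(1)]
  have c: "\<phi> (const c) = const c" for c
    using \<phi>(2)[of "pconst c"] by (simp add: E to_fract_pconst)
  have v: "\<phi> (Var g) = \<sigma> g" for g
    using \<phi>(2)[of "pvar g"] by (simp add: E to_fract_pvar)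
  have vv: "\<phi> (\<sigma> g) = Var g" for g
  proof -
    have "\<phi> (\<sigma> g) * ?E D = Var g * ?E D"
      using N[of g] inv[of g] by (metis \<phi>(2) h(3))
    then show ?thesis using D by simp
  qed
  have "\<phi> \<circ> \<phi> = id"
    by (rule field_hom_K_eqI) (simp_all add: field_hom_comp \<phi> c v vv, simp add: field_hom_def)
  then have "bij \<phi>"
    using o_bij by blast
  then have "is_aut_with \<sigma> \<phi>"
    by (simp add: is_aut_with_def C_automorphism_def \<phi> c v)
  then show ?thesis
    by (simp add: aut_of_eq)
qed

section \<open>The simple reflections\<close>

abbreviation "ev \<equiv> cpoly_eval const"

lemma is_aut_with_Var_involution:
  assumes "\<And>g. \<pi> (\<pi> g) = g"
  shows "is_aut_with (\<lambda>g. Var (\<pi> g)) (aut_of (\<lambda>g. Var (\<pi> g)))"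
  by (rule is_aut_with_aut_of[where D = 1 and N = "\<lambda>g. pvar (\<pi> g)"])
    (simp_all add: assms cpoly_eval_simps[OF field_hom_const] to_fract_pvar)

lemma is_aut_with_Var_swap:
  "is_aut_with (Var(g := Var g', g' := Var g)) (aut_of (Var(g := Var g', g' := Var g)))"
proof -
  define \<pi> where "\<pi> = id(g := g', g' := g)"
  have "Var(g := Var g', g' := Var g) = (\<lambda>g. Var (\<pi> g))"
    by (auto simp: \<pi>_def)
  moreover have "\<pi> (\<pi> g) = g" for g
    by (simp add: \<pi>_def)
  ultimately show ?thesis
    using is_aut_with_Var_involution[of \<pi>] by simp
qed

lemma is_aut_with_weyl_2: "is_aut_with (weyl_img 2) (weyl_s 2)"
proof -
  define \<pi> where "\<pi> = id(Gh1 := Gh2, Gh2 := Gh1, Gx := Gy, Gy := Gx)"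
  have "weyl_img 2 = (\<lambda>g. Var (\<pi> g))"
    by (auto simp: \<pi>_def weyl_img_def Let_def par_h1_def par_h2_def coord_x_def coord_y_def)
  moreover have "\<pi> (\<pi> g) = g" for g
    by (simp add: \<pi>_def)
  ultimately show ?thesis
    using is_aut_with_Var_involution[of \<pi>] by (simp add: weyl_s_def)
qed

lemmas Var_defs = par_e_def par_h1_def par_h2_def coord_x_def coord_y_def

lemma par_h1_neq_h2: "par_h1 \<noteq> par_h2"
proof -
  have "to_fract (pvar Gh1 - pvar Gh2) \<noteq> 0"
    by (rule to_fract_cpoly_neq_0[where \<tau> = "(\<lambda>_. 0)(Gh1 := 1)"])
      (simp add: cpoly_eval_simps[OF field_hom_ident])
  then show ?thesis
    by (simp add: Var_defs to_fract_pvar)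
qed

lemma par_e1_e2_neq_h2: "par_e 1 * par_e 2 \<noteq> par_h2"
proof -
  have "to_fract (pvar Ge1 * pvar Ge2 - pvar Gh2) \<noteq> 0"
    by (rule to_fract_cpoly_neq_0[where \<tau> = "(\<lambda>_. 0)(Gh2 := 1)"])
      (simp add: cpoly_eval_simps[OF field_hom_ident])
  then show ?thesis
    by (simp add: Var_defs to_fract_pvar ge_def)
qed

text \<open>A common denominator for all images under s_1, as \<open>is_aut_with_aut_of\<close>
  expects; \<open>num1\<close> holds the numerators over it.\<close>

definition den1 :: cpoly where
  "den1 = pvar Ge1 * pvar Ge2 * (pvar Gh1 - pvar Gh2)"

definition num1 :: "gen \<Rightarrow> cpoly" where
  "num1 = (\<lambda>g. pvar g * den1)(
     Ge1 := pvar Gh1 * pvar Ge1 * (pvar Gh1 - pvar Gh2),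
     Ge2 := pvar Gh1 * pvar Ge2 * (pvar Gh1 - pvar Gh2),
     Gh2 := pvar Gh1 * pvar Gh2 * (pvar Gh1 - pvar Gh2),
     Gy := - pvar Gh2 * (pvar Ge1 * pvar Ge2 - pvar Gh1) * pvar Gx
         + pvar Gh1 * (pvar Ge1 * pvar Ge2 - pvar Gh2) * pvar Gy)"

text \<open>This makes s_1 an involution on y: h/b, h/a and h k/(a b) are the images of a, b and k.
  Since y' enters through an equation without fractions, nothing has to be divided by h - k.\<close>

lemma weyl_1_num_identity:
  fixes a b h k x y y' :: "'a::field"
  assumes nz: "a \<noteq> 0" "b \<noteq> 0" "h \<noteq> 0"
    and y': "y' * (a * b * (h - k)) = - k * (a * b - h) * x + h * (a * b - k) * y"
  shows "- (h * k / (a * b)) * (h / b * (h / a) - h) * x + h * (h / b * (h / a) - h * k / (a * b)) * y'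
    = y * (h / b * (h / a) * (h - h * k / (a * b)))" (is "?l = ?r")
proof -
  \<comment> \<open>The factor (a b)^2 clears the images of the parameters and leaves y' only in the
    combination that the hypothesis evaluates.\<close>
  have "?l * (a * b)\<^sup>2 = h\<^sup>2 * (k * (a * b - h) * x + y' * (a * b * (h - k)))"
    using nz by (simp add: field_simps power2_eq_square)
  also have "\<dots> = ?r * (a * b)\<^sup>2"
    unfolding y' using nz by (simp add: field_simps power2_eq_square)
  finally show ?thesis
    by (subst (asm) mult_right_cancel) (use nz in simp_all)
qed

lemma is_aut_with_weyl_1: "is_aut_with (weyl_img 1) (weyl_s 1)"
proof -
  have ne: "Var Gh1 \<noteq> Var Gh2" 
    using par_h1_neq_h2 by (simp add: Var_defs)
  have ne': "Var Ge1 * Var Ge2 \<noteq> Var Gh2"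
    using par_e1_e2_neq_h2 by (simp add: Var_defs ge_def)
  have img: "weyl_img 1 = Var(Ge1 := Var Gh1 / Var Ge2, Ge2 := Var Gh1 / Var Ge1,
      Gh2 := Var Gh1 * Var Gh2 / (Var Ge1 * Var Ge2),
      Gy := (- Var Gh2 * (Var Ge1 * Var Ge2 - Var Gh1) * Var Gx
              + Var Gh1 * (Var Ge1 * Var Ge2 - Var Gh2) * Var Gy)
            / (Var Ge1 * Var Ge2 * (Var Gh1 - Var Gh2)))"
    by (simp add: weyl_img_def Let_def Var_defs ge_def)
  note E = cpoly_eval_simps[OF field_hom_const]
  show ?thesis
    unfolding weyl_s_def img
  proof (rule is_aut_with_aut_of[where D = den1 and N = num1], goal_cases)
    case (1 g)
    show ?case
      using ne by (cases g) (simp_all add: den1_def num1_def to_fract_pvar field_simps)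
  next
    case 2
    show ?case
      using ne ne' by (simp add: den1_def E field_simps)
  next
    case (3 g)
    show ?case
    proof (cases "g = Gy")
      case True
      show ?thesis
        unfolding True
        using weyl_1_num_identity[of "Var Ge1" "Var Ge2" "Var Gh1"
          "(- Var Gh2 * (Var Ge1 * Var Ge2 - Var Gh1) * Var Gx
              + Var Gh1 * (Var Ge1 * Var Ge2 - Var Gh2) * Var Gy)
            / (Var Ge1 * Var Ge2 * (Var Gh1 - Var Gh2))" "Var Gh2" "Var Gx" "Var Gy"] ne
        by (simp add: den1_def num1_def E)
    next
      case False
      then show ?thesis
        by (simp add: den1_def num1_def E mult_ac)
    qed
  qed
qed

text \<open>The denominator of s_3 must stay nonzero when s_3 is substituted into it. Its product
  with its own image splits into factors free of y; the last two vanish on the fibres x = a + h/a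
  and x = b + h/b.\<close>

lemma weyl_3_den_identity:
  fixes a b h k x y y' :: "'a::field"
  defines "q \<equiv> (a * b - k) * x - (a * b - h) * y - (a + b) * (h - k)"
  assumes nz: "a \<noteq> 0" "b \<noteq> 0" "h \<noteq> 0"
    and y': "y' * (a * b * q) = a * b * (h - k) * x * y + (a + b) * k * (a * b - h) * x
      - (a + b) * h * (a * b - k) * y + (a * b - h) * (a * b - k) * (h - k)"
  shows "((h / b * (h / a) - h * k / (a * b)) * x - (h / b * (h / a) - h) * y'
           - (h / b + h / a) * (h - h * k / (a * b))) * q * (a * b)\<^sup>2
         = h * (h - k) * (a * b - k) * (a * x - a\<^sup>2 - h) * (b * x - b\<^sup>2 - h)"
    (is "?q' * q * _ = _")
proof -
  have "?q' * (a * b)\<^sup>2 = h * ((h - k) * x * (a * b) - (a + b) * h * (a * b - k) - (h - a * b) * (y' * (a * b)))"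
    using nz by (simp add: field_simps power2_eq_square)
  then have "?q' * q * (a * b)\<^sup>2
      = h * ((h - k) * x * (a * b) - (a + b) * h * (a * b - k) - (h - a * b) * (y' * (a * b))) * q"
    by (simp add: mult_ac)
  also have "\<dots> = h * (((h - k) * x * (a * b) - (a + b) * h * (a * b - k)) * q
     - (h - a * b) * (y' * (a * b * q)))"
    by (simp add: algebra_simps)
  also have "\<dots> = h * (h - k) * (a * b - k) * (a * x - a\<^sup>2 - h) * (b * x - b\<^sup>2 - h)"
    unfolding y' unfolding q_def by (simp add: algebra_simps power2_eq_square)
  finally show ?thesis .
qed

text \<open>\<open>p\<close>, \<open>m\<close> and \<open>t\<close> are the images of a b, k and a +
  b under s_3, so this is the involution property of s_3 on y, with the denominator moved to the
  right.\<close>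

lemma weyl_3_num_identity:
  fixes a b h k x y y' :: "'a::field"
  assumes nz: "a \<noteq> 0" "b \<noteq> 0"
    and y': "y' * (a * b * ((a * b - k) * x - (a * b - h) * y - (a + b) * (h - k))) =
      a * b * (h - k) * x * y + (a + b) * k * (a * b - h) * x
      - (a + b) * h * (a * b - k) * y + (a * b - h) * (a * b - k) * (h - k)"
  defines "p \<equiv> h / b * (h / a)" and "m \<equiv> h * k / (a * b)" and "t \<equiv> h / b + h / a"
  shows "p * (h - m) * x * y' + t * m * (p - h) * x - t * h * (p - m) * y' + (p - h) * (p - m) * (h - m)
    = y * (p * ((p - m) * x - (p - h) * y' - t * (h - m)))" (is "?l = ?r")
proof -
  have *: "p * (a * b) = h\<^sup>2" "m * (a * b) = h * k" "t * (a * b) = h * (a + b)"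
    using nz by (simp_all add: p_def m_def t_def field_simps power2_eq_square)
  have "?l * (a * b) ^ 3 = (p * (a * b)) * (h * (a * b) - m * (a * b)) * x * y' * (a * b)
      + (t * (a * b)) * (m * (a * b)) * (p * (a * b) - h * (a * b)) * x
      - (t * (a * b)) * h * (p * (a * b) - m * (a * b)) * y' * (a * b)
      + (p * (a * b) - h * (a * b)) * (p * (a * b) - m * (a * b)) * (h * (a * b) - m * (a * b))"
    by (simp add: algebra_simps power3_eq_cube)
  also have "\<dots> = h ^ 3 * ((a * b) * (a * b - k) * x * y' + (a + b) * k * (h - a * b) * x
      - (a + b) * (h - k) * (a * b) * y' + (h - a * b) * (h - k) * (a * b - k))"
    unfolding * by (simp add: algebra_simps power2_eq_square power3_eq_cube)
  \<comment> \<open>The relation between y and y' enters here; it lets y be taken out as a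
    factor.\<close>
  also have "(a * b) * (a * b - k) * x * y' + (a + b) * k * (h - a * b) * x
      - (a + b) * (h - k) * (a * b) * y' + (h - a * b) * (h - k) * (a * b - k)
    = y * ((h - k) * x * (a * b) - (a + b) * h * (a * b - k) - (h - a * b) * (y' * (a * b)))"
    using y' by (simp add: algebra_simps)
  also have "h ^ 3 * \<dots> = y * (p * (a * b)) * ((p * (a * b) - m * (a * b)) * x * (a * b)
      - (p * (a * b) - h * (a * b)) * y' * (a * b) - (t * (a * b)) * (h * (a * b) - m * (a * b)))"
    unfolding * by (simp add: algebra_simps power2_eq_square power3_eq_cube)
  also have "\<dots> = ?r * (a * b) ^ 3"
    by (simp add: algebra_simps power3_eq_cube)
  finally show ?thesis
    by (subst (asm) mult_right_cancel) (use nz in simp_all)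
qed

definition quo3 :: cpoly where
  "quo3 = (pvar Ge3 * pvar Ge4 - pvar Gh2) * pvar Gx - (pvar Ge3 * pvar Ge4 - pvar Gh1) * pvar Gy
     - (pvar Ge3 + pvar Ge4) * (pvar Gh1 - pvar Gh2)"

definition den3 :: cpoly where
  "den3 = pvar Ge3 * pvar Ge4 * quo3"

definition num3 :: "gen \<Rightarrow> cpoly" where
  "num3 = (\<lambda>g. pvar g * den3)(
     Ge3 := pvar Gh1 * pvar Ge3 * quo3,
     Ge4 := pvar Gh1 * pvar Ge4 * quo3,
     Gh2 := pvar Gh1 * pvar Gh2 * quo3,
     Gy := pvar Ge3 * pvar Ge4 * (pvar Gh1 - pvar Gh2) * pvar Gx * pvar Gy
        + (pvar Ge3 + pvar Ge4) * pvar Gh2 * (pvar Ge3 * pvar Ge4 - pvar Gh1) * pvar Gx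
        - (pvar Ge3 + pvar Ge4) * pvar Gh1 * (pvar Ge3 * pvar Ge4 - pvar Gh2) * pvar Gy
        + (pvar Ge3 * pvar Ge4 - pvar Gh1) * (pvar Ge3 * pvar Ge4 - pvar Gh2) * (pvar Gh1 - pvar Gh2))"

lemma weyl_3_den_neq_0:
  "(par_e 3 * par_e 4 - par_h2) * coord_x - (par_e 3 * par_e 4 - par_h1) * coord_y
     - (par_e 3 + par_e 4) * (par_h1 - par_h2) \<noteq> 0"
proof -
  have "to_fract quo3 \<noteq> 0"
    by (rule to_fract_cpoly_neq_0[where \<tau> = "(\<lambda>_. 0)(Gh1 := 1, Gy := 1)"])
      (simp add: quo3_def cpoly_eval_simps[OF field_hom_ident])
  then show ?thesis
    by (simp add: quo3_def to_fract_pvar Var_defs ge_def)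
qed

lemma is_aut_with_weyl_3: "is_aut_with (weyl_img 3) (weyl_s 3)"
proof -
  let ?a = "Var Ge3" and ?b = "Var Ge4" and ?h = "Var Gh1" and ?k = "Var Gh2"
    and ?x = "Var Gx" and ?y = "Var Gy"
  define q where "q = (?a * ?b - ?k) * ?x - (?a * ?b - ?h) * ?y - (?a + ?b) * (?h - ?k)"
  define ny where "ny = ?a * ?b * (?h - ?k) * ?x * ?y + (?a + ?b) * ?k * (?a * ?b - ?h) * ?x
      - (?a + ?b) * ?h * (?a * ?b - ?k) * ?y + (?a * ?b - ?h) * (?a * ?b - ?k) * (?h - ?k)"
  define y' where "y' = ny / (?a * ?b * q)"
  have quo3: "to_fract quo3 = q"
    by (simp add: quo3_def q_def to_fract_pvar)
  have q: "q \<noteq> 0"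
    using weyl_3_den_neq_0 by (simp add: q_def Var_defs ge_def)
  have y': "y' * (?a * ?b * q) = ny"
    using q by (simp add: y'_def)
  define q' where "q' = (?h / ?b * (?h / ?a) - ?h * ?k / (?a * ?b)) * ?x - (?h / ?b * (?h / ?a) - ?h) * y'
           - (?h / ?b + ?h / ?a) * (?h - ?h * ?k / (?a * ?b))"
  have img: "weyl_img 3 = Var(Ge3 := ?h / ?b, Ge4 := ?h / ?a, Gh2 := ?h * ?k / (?a * ?b), Gy := y')"
    by (simp add: weyl_img_def Let_def Var_defs ge_def y'_def ny_def q_def)
  note E = cpoly_eval_simps[OF field_hom_const]
  have ev_quo: "ev (weyl_img 3) quo3 = q'"
    by (simp add: img quo3_def E q'_def)
  have "q' * q * (?a * ?b)\<^sup>2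
      = ?h * (?h - ?k) * (?a * ?b - ?k) * (?a * ?x - ?a\<^sup>2 - ?h) * (?b * ?x - ?b\<^sup>2 - ?h)"
    unfolding q'_def q_def
    by (rule weyl_3_den_identity) (use y' in \<open>simp_all add: q_def ny_def\<close>)
  also have "\<dots> = to_fract (pvar Gh1 * (pvar Gh1 - pvar Gh2) * (pvar Ge3 * pvar Ge4 - pvar Gh2)
      * (pvar Ge3 * pvar Gx - (pvar Ge3)\<^sup>2 - pvar Gh1) * (pvar Ge4 * pvar Gx - (pvar Ge4)\<^sup>2 - pvar Gh1))"
    by (simp add: to_fract_pvar power2_eq_square)
  also have "\<dots> \<noteq> 0"
    by (rule to_fract_cpoly_neq_0[where \<tau> = "(\<lambda>_. 0)(Gh1 := 1, Gh2 := 2)"])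
      (simp add: cpoly_eval_simps[OF field_hom_ident])
  finally have q': "q' \<noteq> 0"
    by auto
  have ny': "ev (weyl_img 3) (num3 Gy) = ?y * (?h / ?b * (?h / ?a) * q')"
    unfolding q'_def
    by (rule trans[OF _ weyl_3_num_identity]) (use y' in \<open>simp_all add: num3_def img E q_def ny_def\<close>)
  have num3_y: "to_fract (num3 Gy) = ny"
    by (simp add: num3_def ny_def to_fract_pvar)
  show ?thesis
    unfolding weyl_s_def
  proof (rule is_aut_with_aut_of[where D = den3 and N = num3])
    fix g
    show "weyl_img 3 g * to_fract den3 = to_fract (num3 g)"
    proof (cases "g = Gy")
      case True
      then show ?thesis
        using y' by (simp add: num3_y img den3_def quo3 to_fract_pvar)
    next
      case False
      then show ?thesis
        by (simp add: img num3_def den3_def quo3 to_fract_pvar)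
    qed
    show "ev (weyl_img 3) (num3 g) = Var g * ev (weyl_img 3) den3"
    proof (cases "g = Gy")
      case True
      then show ?thesis
        unfolding True ny' by (simp add: den3_def E ev_quo, simp add: img)
    next
      case False
      then show ?thesis
        by (simp add: num3_def den3_def E ev_quo, simp add: img mult_ac)
    qed
  next
    show "ev (weyl_img 3) den3 \<noteq> 0"
      using q' by (simp add: den3_def E ev_quo, simp add: img)
  qed
qed

theorem is_aut_with_weyl: "j \<le> 7 \<Longrightarrow> is_aut_with (weyl_img j) (weyl_s j)"
proof -
  assume "j \<le> 7"
  have swap: "is_aut_with (weyl_img j) (weyl_s j)" if "j \<in> {0, 4, 5, 6, 7}"
  proof -
    have "\<exists>g g'. weyl_img j = Var(g := Var g', g' := Var g)"
      using that by (auto simp: weyl_img_def Let_def par_e_def)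
    then show ?thesis
      using is_aut_with_Var_swap by (auto simp: weyl_s_def)
  qed
  have "j = 0 \<or> j = 1 \<or> j = 2 \<or> j = 3 \<or> j = 4 \<or> j = 5 \<or> j = 6 \<or> j = 7"
    using \<open>j \<le> 7\<close> by linarith
  then show ?thesis
    using swap is_aut_with_weyl_1 is_aut_with_weyl_2 is_aut_with_weyl_3 by blast
qed

section \<open>The action of the reflections on a cross ratio\<close>

text \<open>The second inequality concerns the discriminant of z^2 - x z + h1. The third concerns
  the curve (z + h1/z, z + h2/z): there z (x - y) = h1 - h2, and inserting this in z (x - z) = h1
  eliminates z.\<close>

lemma generic_neq:
  shows par_e_prod_neq_h2: "par_e 3 * par_e 4 \<noteq> par_h2"
    and coord_x_sq_neq: "coord_x\<^sup>2 \<noteq> 4 * par_h1"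
    and generic_curve:
      "(par_h1 - par_h2) * (coord_x * (coord_x - coord_y) - (par_h1 - par_h2))
         \<noteq> par_h1 * (coord_x - coord_y)\<^sup>2"
proof -
  note S = cpoly_eval_simps[OF field_hom_ident] 
  have "to_fract (pvar Ge3 * pvar Ge4 - pvar Gh2) \<noteq> 0"
    by (rule to_fract_cpoly_neq_0[where \<tau> = "(\<lambda>_. 0)(Gh2 := 1)"]) (simp add: S)
  then show "par_e 3 * par_e 4 \<noteq> par_h2"
    by (simp add: Var_defs to_fract_pvar ge_def)
  have "to_fract ((pvar Gx)\<^sup>2 - (pvar Gh1 + pvar Gh1 + pvar Gh1 + pvar Gh1)) \<noteq> 0"
    by (rule to_fract_cpoly_neq_0[where \<tau> = "(\<lambda>_. 0)(Gx := 1)"]) (simp add: S)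
  then show "coord_x\<^sup>2 \<noteq> 4 * par_h1"
    by (simp add: Var_defs to_fract_pvar to_fract_power to_fract_numeral)
  have "to_fract ((pvar Gh1 - pvar Gh2) * (pvar Gx * (pvar Gx - pvar Gy) - (pvar Gh1 - pvar Gh2))
      - pvar Gh1 * (pvar Gx - pvar Gy)\<^sup>2) \<noteq> 0"
    by (rule to_fract_cpoly_neq_0[where \<tau> = "(\<lambda>_. 0)(Gh1 := 1)"]) (simp add: S)
  then show "(par_h1 - par_h2) * (coord_x * (coord_x - coord_y) - (par_h1 - par_h2))
      \<noteq> par_h1 * (coord_x - coord_y)\<^sup>2"
    by (simp add: Var_defs to_fract_pvar to_fract_power)
qed

lemma par_neq_0 [simp]: "par_e i \<noteq> 0" "par_h1 \<noteq> 0" "par_h2 \<noteq> 0" "coord_x \<noteq> 0" "coord_y \<noteq> 0"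
  by (simp_all add: Var_defs)

lemma coord_x_neq: 
  assumes "i \<in> {1..8}"
  shows "coord_x \<noteq> par_e i + par_h1 / par_e i"
proof -
  have "to_fract (pvar (ge i) * pvar Gx - (pvar (ge i))\<^sup>2 - pvar Gh1) \<noteq> 0"
  proof (rule to_fract_cpoly_neq_0[where \<tau> = "(\<lambda>_. 0)(Gh1 := 1)"])
    have "ge i \<noteq> Gh1"
      using assms by (auto simp: atLeastAtMost_iff ge_def numeral_eq_Suc le_Suc_eq)
    then show "cpoly_eval (\<lambda>c. c) ((\<lambda>_. 0)(Gh1 := 1)) (pvar (ge i) * pvar Gx - (pvar (ge i))\<^sup>2 - pvar Gh1) \<noteq> 0"
      by (simp add: cpoly_eval_simps[OF field_hom_ident])
  qed
  then have "Var (ge i) * Var Gx - (Var (ge i))\<^sup>2 - Var Gh1 \<noteq> 0"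
    by (simp add: to_fract_pvar to_fract_power)
  then show ?thesis
    by (auto simp: Var_defs field_simps power2_eq_square)
qed

context
  fixes \<phi> :: "K \<Rightarrow> 'l::field" and z :: 'l
  assumes hom: "field_hom \<phi>" and z: "z \<noteq> 0" and x: "\<phi> coord_x = z + \<phi> par_h1 / z"
begin

lemma uniformizer_neq_e: "i \<in> {1..8} \<Longrightarrow> z \<noteq> \<phi> (par_e i)"
  using coord_x_neq[of i] x by (auto simp flip: field_hom_simps[OF hom] simp: field_hom_eq_iff[OF hom])

lemma uniformizer_y_neq: "\<phi> coord_y \<noteq> z + \<phi> par_h2 / z"
proof
  assume y: "\<phi> coord_y = z + \<phi> par_h2 / z"
  have *: "z * (\<phi> coord_x - \<phi> coord_y) = \<phi> par_h1 - \<phi> par_h2" "z * (\<phi> coord_x - z) = \<phi> par_h1"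
    using z by (simp_all add: x y field_simps)
  have "(\<phi> par_h1 - \<phi> par_h2) * (\<phi> coord_x * (\<phi> coord_x - \<phi> coord_y) - (\<phi> par_h1 - \<phi> par_h2))
      = z * (\<phi> coord_x - z) * (\<phi> coord_x - \<phi> coord_y)\<^sup>2"
    unfolding *(1)[symmetric] by (simp add: power2_eq_square algebra_simps)
  then have "(\<phi> par_h1 - \<phi> par_h2) * (\<phi> coord_x * (\<phi> coord_x - \<phi> coord_y) - (\<phi> par_h1 - \<phi> par_h2))
      = \<phi> par_h1 * (\<phi> coord_x - \<phi> coord_y)\<^sup>2"
    unfolding *(2) .
  then show False
    using generic_curve by (simp flip: field_hom_simps[OF hom] add: field_hom_eq_iff[OF hom])
qed

lemma uniformizer_neq_conj: "z \<noteq> \<phi> par_h1 / z"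
proof
  assume *: "z = \<phi> par_h1 / z"
  then have "\<phi> coord_x = z + z" "\<phi> par_h1 = z * z"
    using x z by (metis, simp add: field_simps)
  then have "\<phi> (coord_x\<^sup>2) = \<phi> (4 * par_h1)"
    by (simp add: field_hom_simps[OF hom] power2_eq_square algebra_simps)
  then show False
    using coord_x_sq_neq by (simp add: field_hom_eq_iff[OF hom])
qed

end

text \<open>
  On the fibre \<open>x = z + h/z\<close> the sections \<open>y = z + k/z\<close> and \<open>y = h/z + kz/h\<close> are exchanged
  by \<open>z \<mapsto> h/z\<close>. In the coordinate \<open>cross_ratio\<close>, which vanishes on the first and has its pole
  on the second, the reflections act by multiplication.
\<close>

definition cross_ratio :: "'l::field \<Rightarrow> 'l \<Rightarrow> 'l \<Rightarrow> 'l \<Rightarrow> 'l" where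
  "cross_ratio h k z y = (y - (z + k / z)) / (y - (h / z + k * z / h))"

text \<open>On a fibre s_1 is an affine map of y whose slope does not involve z. It carries the
  section z + k/z to the one for the new k and, since z and h/z have the same x, the conjugate
  section likewise; the slope cancels in the quotient.\<close>

lemma cross_ratio_weyl_1:
  fixes h k z y :: "'l::field"
  assumes nz: "h \<noteq> 0" "z \<noteq> 0" "p \<noteq> 0" "h \<noteq> k" "p \<noteq> k"
  shows "cross_ratio h (h * k / p) z ((- k * (p - h) * (z + h / z) + h * (p - k) * y) / (p * (h - k)))
    = cross_ratio h k z y"
proof -
  have *: "(- k * (p - h) * (z + h / z) + h * (p - k) * y) / (p * (h - k)) - (z + h * k / p / z)
      = h * (p - k) / (p * (h - k)) * (y - (z + k / z))" if "z \<noteq> 0" for z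
    using nz that by (simp add: divide_simps) (simp add: algebra_simps)
  have "h / (h / z) = z" "k / (h / z) = k * z / h" "h * k / p / (h / z) = h * k / p * z / h"
    using nz by simp_all
  then show ?thesis
    unfolding cross_ratio_def using nz *[of z] *[of "h / z"] by (simp add: add.commute)
qed

text \<open>The term z (h/z - a) (h/z - b) divided by its conjugate under z <-> h/z. Up to a factor
  symmetric in z and h/z, s_3 multiplies y - (z + k/z) by this term.\<close>

definition weyl_3_factor :: "'l::field \<Rightarrow> 'l \<Rightarrow> 'l \<Rightarrow> 'l \<Rightarrow> 'l" where
  "weyl_3_factor h z a b = z * ((h / z - a) * (h / z - b)) / (h / z * ((z - a) * (z - b)))"

lemma cross_ratio_weyl_3:
  fixes h k z y a b :: "'l::field"
  defines "x \<equiv> z + h / z"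
  defines "q \<equiv> (a * b - k) * x - (a * b - h) * y - (a + b) * (h - k)"
  assumes nz: "h \<noteq> 0" "z \<noteq> 0" "a \<noteq> 0" "b \<noteq> 0" "q \<noteq> 0" "a * b \<noteq> k"
  shows "cross_ratio h (h * k / (a * b)) z
      ((a * b * (h - k) * x * y + (a + b) * k * (a * b - h) * x
      - (a + b) * h * (a * b - k) * y + (a * b - h) * (a * b - k) * (h - k)) / (a * b * q))
    = cross_ratio h k z y * weyl_3_factor h z a b"
proof -
  define y' where "y' = (a * b * (h - k) * x * y + (a + b) * k * (a * b - h) * x
      - (a + b) * h * (a * b - k) * y + (a * b - h) * (a * b - k) * (h - k)) / (a * b * q)"
  \<comment> \<open>This factor depends on z only through x, so it is the same for z and h/z and
    cancels.\<close>
  define c where "c = (a * b - k) / (a * b * q)"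
  have *: "y' - (z + h * k / (a * b) / z) = c * (z * ((h / z - a) * (h / z - b))) * (y - (z + k / z))"
    if "z \<noteq> 0" "x = z + h / z" for z
  proof -
    define w where "w = h / z"
    have h: "h = z * w"
      using that by (simp add: w_def)
    have "a * b * q * (y' - (z + h * k / (a * b) / z))
        = a * b * (h - k) * x * y + (a + b) * k * (a * b - h) * x
      - (a + b) * h * (a * b - k) * y + (a * b - h) * (a * b - k) * (h - k) - (a * b * z + w * k) * q"
      using nz that by (simp add: y'_def right_diff_distrib' h) (simp add: field_simps)
    also have "z * \<dots> = (a * b - k) * (z * ((w - a) * (w - b))) * (z * y - (z * z + k))"
      unfolding q_def that(2) w_def[symmetric] unfolding h by (simp add: algebra_simps)
    also have "z * y - (z * z + k) = z * (y - (z + k / z))"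
      using that by (simp add: algebra_simps)
    finally have "a * b * q * (y' - (z + h * k / (a * b) / z))
        = (a * b - k) * (z * ((w - a) * (w - b))) * (y - (z + k / z))"
      using that by (simp add: mult_ac)
    then show ?thesis
      using nz by (simp add: c_def w_def field_simps)
  qed
  have c: "c \<noteq> 0"
    using nz by (simp add: c_def)
  have w: "h / (h / z) = z" "k / (h / z) = k * z / h" "h * k / (a * b) / (h / z) = h * k / (a * b) * z / h"
    using nz by simp_all
  have "y' - (h / z + h * k / (a * b) * z / h) = c * (h / z * ((z - a) * (z - b))) * (y - (h / z + k * z / h))"
    using *[of "h / z"] nz unfolding w by (simp add: x_def add.commute)
  then show ?thesis
    unfolding cross_ratio_def weyl_3_factor_def y'_def[symmetric]
    using *[of z] nz c by (simp add: x_def mult_ac)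
qed

text \<open>Bookkeeping for a word of reflections: the values of \<phi> on the generators, with y
  recorded by its cross ratio. Composing \<phi> with a reflection on the right changes the tuple by
  one rule, so a word is read from its left end; \<open>h\<close> and \<open>z\<close> are constant
  because s_2 does not occur in the words tracked.\<close>

definition fibre_point ::
  "(K \<Rightarrow> 'l::field) \<Rightarrow> 'l \<Rightarrow> 'l \<Rightarrow> 'l \<Rightarrow> 'l \<Rightarrow> 'l \<Rightarrow> 'l \<Rightarrow> 'l \<Rightarrow> 'l \<Rightarrow> 'l \<Rightarrow> 'l \<Rightarrow> 'l \<Rightarrow> 'l \<Rightarrow> bool" where
  "fibre_point \<phi> h z e1 e2 e3 e4 e5 e6 e7 e8 k r \<longleftrightarrow>
     field_hom \<phi> \<and> z \<noteq> 0 \<and> \<phi> coord_x = z + h / z \<and> \<phi> par_h1 = h \<and> \<phi> par_h2 = k \<and>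
     \<phi> (par_e 1) = e1 \<and> \<phi> (par_e 2) = e2 \<and> \<phi> (par_e 3) = e3 \<and> \<phi> (par_e 4) = e4 \<and>
     \<phi> (par_e 5) = e5 \<and> \<phi> (par_e 6) = e6 \<and> \<phi> (par_e 7) = e7 \<and> \<phi> (par_e 8) = e8 \<and>
     cross_ratio h k z (\<phi> coord_y) = r"

lemma weyl_s_Var: "j \<le> 7 \<Longrightarrow> weyl_s j (Var g) = weyl_img j g"
  using is_aut_with_weyl by (simp add: is_aut_with_def)

lemma field_hom_weyl_s: "j \<le> 7 \<Longrightarrow> field_hom (weyl_s j)"
  and bij_weyl_s: "j \<le> 7 \<Longrightarrow> bij (weyl_s j)"
  using is_aut_with_weyl by (auto simp: is_aut_with_def C_automorphism_def)

lemma fibre_point_perm: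
  assumes "fibre_point \<phi> h z e1 e2 e3 e4 e5 e6 e7 e8 k r"
  shows "fibre_point (\<phi> \<circ> weyl_s 0) h z e1 e2 e4 e3 e5 e6 e7 e8 k r"
    and "fibre_point (\<phi> \<circ> weyl_s 4) h z e1 e2 e3 e5 e4 e6 e7 e8 k r"
    and "fibre_point (\<phi> \<circ> weyl_s 5) h z e1 e2 e3 e4 e6 e5 e7 e8 k r"
    and "fibre_point (\<phi> \<circ> weyl_s 6) h z e1 e2 e3 e4 e5 e7 e6 e8 k r"
    and "fibre_point (\<phi> \<circ> weyl_s 7) h z e1 e2 e3 e4 e5 e6 e8 e7 k r"
  using assms
  by (simp_all add: fibre_point_def field_hom_comp field_hom_weyl_s Var_defs weyl_s_Var
      weyl_img_def Let_def ge_def)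

lemma fibre_point_weyl_1:
  assumes "fibre_point \<phi> h z e1 e2 e3 e4 e5 e6 e7 e8 k r"
  shows "fibre_point (\<phi> \<circ> weyl_s 1) h z (h / e2) (h / e1) e3 e4 e5 e6 e7 e8 (h * k / (e1 * e2)) r"
proof -
  have hom: "field_hom \<phi>"
    using assms by (simp add: fibre_point_def)
  note [simp] = field_hom_simps[OF hom] field_hom_eq_0_iff[OF hom]
  have nz: "h \<noteq> 0" "e1 * e2 \<noteq> 0" "h \<noteq> k" "e1 * e2 \<noteq> k"
    using assms par_h1_neq_h2 par_e1_e2_neq_h2 field_hom_eq_iff[OF hom, of "par_e 1 * par_e 2" par_h2]
      field_hom_eq_iff[OF hom, of par_h1 par_h2]
    by (auto simp: fibre_point_def)
  have y: "\<phi> (weyl_s 1 coord_y) = (- k * (e1 * e2 - h) * (z + h / z) + h * (e1 * e2 - k) * \<phi> coord_y)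
      / (e1 * e2 * (h - k))"
    using assms unfolding fibre_point_def
    by (simp add: coord_y_def weyl_s_Var) (simp add: weyl_img_def Let_def coord_y_def)
  show ?thesis
    using assms field_hom_comp[OF hom field_hom_weyl_s[of 1]] cross_ratio_weyl_1[of h z "e1 * e2" k "\<phi> coord_y"] nz
    unfolding fibre_point_def comp_apply y
    by (simp add: comp_def)
      (simp add: Var_defs weyl_s_Var, simp add: weyl_img_def Let_def ge_def Var_defs)
qed

lemma fibre_point_weyl_3:
  assumes "fibre_point \<phi> h z e1 e2 e3 e4 e5 e6 e7 e8 k r"
  shows "fibre_point (\<phi> \<circ> weyl_s 3) h z e1 e2 (h / e4) (h / e3) e5 e6 e7 e8
    (h * k / (e3 * e4)) (r * weyl_3_factor h z e3 e4)"
proof -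
  have hom: "field_hom \<phi>"
    using assms by (simp add: fibre_point_def)
  note [simp] = field_hom_simps[OF hom] field_hom_eq_0_iff[OF hom]
  have nz: "h \<noteq> 0" "e3 \<noteq> 0" "e4 \<noteq> 0" "z \<noteq> 0" "e3 * e4 \<noteq> k"
    using assms par_e_prod_neq_h2 field_hom_eq_iff[OF hom, of "par_e 3 * par_e 4" par_h2]
    by (auto simp: fibre_point_def)
  have q: "(e3 * e4 - k) * (z + h / z) - (e3 * e4 - h) * \<phi> coord_y - (e3 + e4) * (h - k) \<noteq> 0"
    using weyl_3_den_neq_0 assms unfolding field_hom_eq_0_iff[OF hom, symmetric]
    by (auto simp: fibre_point_def)
  have y: "\<phi> (weyl_s 3 coord_y) = (e3 * e4 * (h - k) * (z + h / z) * \<phi> coord_y + (e3 + e4) * k * (e3 * e4 - h) * (z + h / z)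
      - (e3 + e4) * h * (e3 * e4 - k) * \<phi> coord_y + (e3 * e4 - h) * (e3 * e4 - k) * (h - k)) / (e3 * e4 *
      ((e3 * e4 - k) * (z + h / z) - (e3 * e4 - h) * \<phi> coord_y - (e3 + e4) * (h - k)))"
    using assms unfolding fibre_point_def
    by (simp add: coord_y_def weyl_s_Var) (simp add: weyl_img_def Let_def coord_y_def)
  show ?thesis
    using assms field_hom_comp[OF hom field_hom_weyl_s[of 3]] cross_ratio_weyl_3[of h z e3 e4 k "\<phi> coord_y"] nz q
    unfolding fibre_point_def comp_apply y
    by (simp add: comp_def)
      (simp add: Var_defs weyl_s_Var, simp add: weyl_img_def Let_def ge_def Var_defs)
qed

section \<open>The half step\<close>

lemma foldl_comp_eq: "foldl (\<circ>) \<phi> fs = \<phi> \<circ> foldr (\<circ>) fs id"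
  by (induction fs arbitrary: \<phi>) (simp_all add: comp_assoc)

definition weyl_R :: "K \<Rightarrow> K" where
  "weyl_R = foldr (\<circ>) (map weyl_s
     [6,7,5,6,4,5,6,7,3,4,5,6,7,1,0,4,5,6,7,3,4,5,6,0,4,5,3,4]) id"

lemma prod_3_8: "(\<Prod>i=3..8::nat. f i) = f 3 * f 4 * f 5 * f 6 * f 7 * (f 8 :: 'a::comm_monoid_mult)"
proof -
  have "{3..8::nat} = {3, 4, 5, 6, 7, 8}"
    by auto
  then show ?thesis
    by (simp add: mult_ac)
qed

lemma prod_1_8:
  "(\<Prod>i=1..8::nat. f i) = f 1 * f 2 * f 3 * f 4 * f 5 * f 6 * f 7 * (f 8 :: 'a::comm_monoid_mult)"
proof -
  have "{1..8::nat} = {1, 2, 3, 4, 5, 6, 7, 8}"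
    by auto
  then show ?thesis
    by (simp add: mult_ac)
qed

text \<open>
  The word pairs the parameters \<open>e\<^sub>3,\<dots>,e\<^sub>8\<close> as \<open>37\<close>, \<open>85\<close>, \<open>64\<close> when it
  meets the three occurrences of the reflection \<open>s\<^sub>3\<close>.
\<close>

lemma fibre_point_weyl_R:
  assumes "fibre_point \<phi> h z e1 e2 e3 e4 e5 e6 e7 e8 k r"
  shows "fibre_point (\<phi> \<circ> weyl_R) h z (h / e2) (h / e1) (h / e4) (h / e3) (h / e6) (h / e5) (h / e8) (h / e7)
     (h ^ 4 * k / (e1 * e2 * e3 * e4 * e5 * e6 * e7 * e8))
     (r * (weyl_3_factor h z e3 e7 * weyl_3_factor h z e8 e5 * weyl_3_factor h z e6 e4))"
proof -
  note * = assms
  note * = fibre_point_perm(4)[OF *]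
  note * = fibre_point_perm(5)[OF *]
  note * = fibre_point_perm(3)[OF *]
  note * = fibre_point_perm(4)[OF *]
  note * = fibre_point_perm(2)[OF *]
  note * = fibre_point_perm(3)[OF *]
  note * = fibre_point_perm(4)[OF *]
  note * = fibre_point_perm(5)[OF *]
  note * = fibre_point_weyl_3[OF *]
  note * = fibre_point_perm(2)[OF *]
  note * = fibre_point_perm(3)[OF *]
  note * = fibre_point_perm(4)[OF *]
  note * = fibre_point_perm(5)[OF *]
  note * = fibre_point_weyl_1[OF *]
  note * = fibre_point_perm(1)[OF *]
  note * = fibre_point_perm(2)[OF *]
  note * = fibre_point_perm(3)[OF *]
  note * = fibre_point_perm(4)[OF *]
  note * = fibre_point_perm(5)[OF *]
  note * = fibre_point_weyl_3[OF *]
  note * = fibre_point_perm(2)[OF *]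
  note * = fibre_point_perm(3)[OF *]
  note * = fibre_point_perm(4)[OF *]
  note * = fibre_point_perm(1)[OF *]
  note * = fibre_point_perm(2)[OF *]
  note * = fibre_point_perm(3)[OF *]
  note * = fibre_point_weyl_3[OF *]
  note * = fibre_point_perm(2)[OF *]
  have hom: "field_hom \<phi>"
    using assms by (simp add: fibre_point_def)
  have nz: "h \<noteq> 0" "e1 \<noteq> 0" "e2 \<noteq> 0" "e3 \<noteq> 0" "e4 \<noteq> 0" "e5 \<noteq> 0" "e6 \<noteq> 0" "e7 \<noteq> 0" "e8 \<noteq> 0"
    using assms by (auto simp: fibre_point_def field_hom_eq_0_iff[OF hom])
  have inv: "h / (h / e) = e" for e
    using nz by simp
  have word: "\<phi> \<circ> weyl_R = foldl (\<circ>) \<phi>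
      (map weyl_s [6,7,5,6,4,5,6,7,3,4,5,6,7,1,0,4,5,6,7,3,4,5,6,0,4,5,3,4])"
    by (simp only: foldl_comp_eq weyl_R_def)
  \<comment> \<open>The nested form is the one produced by the letters s_3, s_1, s_3, s_3, each
    multiplying the image of h2 by h over a product of two parameters.\<close>
  have k: "h ^ 4 * k / (e1 * e2 * e3 * e4 * e5 * e6 * e7 * e8)
      = h * (h * (h * (h * k / (e3 * e7)) / (e1 * e2)) / (e8 * e5)) / (e6 * e4)"
    by (simp add: eval_nat_numeral mult_ac)
  show ?thesis
    unfolding word k using * by (simp only: foldl.simps list.map inv mult.assoc)
qed

text \<open>Each of the six parameters occurs once in either pairing, so the factors combine to the
  full products in U. The second pairing is met in the second pass through R, where 3 and 4, 5 and
  6, 7 and 8 have been exchanged.\<close>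

lemma prod_weyl_3_factor:
  assumes "h \<noteq> 0" "z \<noteq> 0"
  shows "weyl_3_factor h z (e 3) (e 7) * weyl_3_factor h z (e 8) (e 5) * weyl_3_factor h z (e 6) (e 4)
    = U e (h / z) / U e z"
    and "weyl_3_factor h z (e 4) (e 8) * weyl_3_factor h z (e 7) (e 6) * weyl_3_factor h z (e 5) (e 3)
    = U e (h / z) / U e z"
  using assms by (simp_all add: weyl_3_factor_def U_def prod_3_8 power3_eq_cube mult_ac)

text \<open>Replacing a and b by h/a and h/b exchanges the roles of z and h/z up to monomials that
  cancel, which inverts the quotient.\<close>

lemma weyl_3_factor_conj:
  assumes "h \<noteq> 0" "z \<noteq> 0" "a \<noteq> 0" "b \<noteq> 0"
  shows "weyl_3_factor h z (h / a) (h / b) = 1 / weyl_3_factor h z a b"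
proof -
  have "(h / z - h / a) * (h / z - h / b) = h / z * (h / z) * ((z - a) * (z - b)) / (a * b)"
    and "(z - h / a) * (z - h / b) = z * z * ((h / z - a) * (h / z - b)) / (a * b)"
    using assms by (simp_all add: field_simps)
  then show ?thesis
    using assms by (simp add: weyl_3_factor_def)
qed

lemma fibre_pointI:
  assumes "field_hom \<phi>" "z \<noteq> 0" "\<phi> coord_x = z + \<phi> par_h1 / z"
  shows "fibre_point \<phi> (\<phi> par_h1) z (\<phi> (par_e 1)) (\<phi> (par_e 2)) (\<phi> (par_e 3)) (\<phi> (par_e 4))
     (\<phi> (par_e 5)) (\<phi> (par_e 6)) (\<phi> (par_e 7)) (\<phi> (par_e 8)) (\<phi> par_h2)
     (cross_ratio (\<phi> par_h1) (\<phi> par_h2) z (\<phi> coord_y))"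
  using assms by (simp add: fibre_point_def)

lemma fibre_pointD:
  "fibre_point \<phi> h z e1 e2 e3 e4 e5 e6 e7 e8 k r \<Longrightarrow> cross_ratio h (\<phi> par_h2) z (\<phi> coord_y) = r"
  by (simp add: fibre_point_def)

lemma to_ac_uniformizer:
  obtains z where "z \<noteq> 0" "to_ac coord_x = z + to_ac par_h1 / z"
proof -
  obtain z where "poly [:to_ac par_h1, - to_ac coord_x, 1:] z = 0"
    using alg_closed_imp_poly_has_root[of "[:to_ac par_h1, - to_ac coord_x, 1:]"] by auto
  then have "to_ac par_h1 + z * (z - to_ac coord_x) = 0"
    by simp
  then have *: "to_ac par_h1 = z * (to_ac coord_x - z)"
    by (simp only: eq_neg_iff_add_eq_0[symmetric] minus_mult_right minus_diff_eq)
  then have z: "z \<noteq> 0"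
    by (metis mult_zero_left par_neq_0(2) to_ac_eq_0_iff)
  have "to_ac coord_x = z + to_ac par_h1 / z"
    unfolding * using z by simp
  then show ?thesis
    using that z by blast
qed

text \<open>The cross ratio is a Moebius map in y with zero \<open>a\<close> and pole
  \<open>b\<close>, which differ because (z - h/z) (h - k) = h (a - b). The pole is excluded since
  division by zero would give it the value 0 as well.\<close>

lemma cross_ratio_inject:
  assumes "y1 \<noteq> h / z + k * z / h" "y2 \<noteq> h / z + k * z / h" "z \<noteq> h / z" "h \<noteq> k" "h \<noteq> 0" "z \<noteq> 0"
    and "cross_ratio h k z y1 = cross_ratio h k z y2"
  shows "y1 = y2"
proof -
  define a b where "a = z + k / z" and "b = h / z + k * z / h"
  have "(z - h / z) * (h - k) = h * (a - b)"
    using assms(5,6) by (simp add: a_def b_def field_simps)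
  then have ne: "a - b \<noteq> 0"
    using assms by (metis eq_iff_diff_eq_0 mult_eq_0_iff)
  have "(y1 - a) * (y2 - b) = (y2 - a) * (y1 - b)"
    using assms(1,2,7) by (simp add: cross_ratio_def frac_eq_eq flip: a_def b_def)
  then have "(a - b) * (y1 - y2) = 0"
    by (simp add: algebra_simps)
  then show ?thesis
    using ne by simp
qed

lemma field_hom_id: "field_hom id"
  by (simp add: field_hom_def)

lemma field_hom_weyl_R: "field_hom weyl_R"
  unfolding weyl_R_def by (simp add: field_hom_comp field_hom_weyl_s field_hom_id)

lemma uniformizer_y_neq_conj:
  assumes "field_hom \<phi>" "z \<noteq> 0" "\<phi> coord_x = z + \<phi> par_h1 / z"
  shows "\<phi> coord_y \<noteq> \<phi> par_h1 / z + \<phi> par_h2 * z / \<phi> par_h1"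
proof -
  have "\<phi> par_h1 \<noteq> 0"
    by (simp add: field_hom_eq_0_iff[OF assms(1)])
  then show ?thesis
    using uniformizer_y_neq[of \<phi> "\<phi> par_h1 / z"] assms by (simp add: add.commute)
qed

lemma weyl_s_const: "j \<le> 7 \<Longrightarrow> weyl_s j (const c) = const c"
  using is_aut_with_weyl by (simp add: is_aut_with_def C_automorphism_def)

lemma weyl_R_const: "weyl_R (const c) = const c"
  by (simp add: weyl_R_def weyl_s_const)

lemma Var_cases:
  assumes "\<And>i. i \<in> {1, 2, 3, 4, 5, 6, 7, 8} \<Longrightarrow> P (par_e i)" "P par_h1" "P par_h2" "P coord_x" "P coord_y"
  shows "P (Var g)"
  using assms(1)[of 1] assms(1)[of 2] assms(1)[of 3] assms(1)[of 4] assms(1)[of 5] assms(1)[of 6]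
    assms(1)[of 7] assms(1)[of 8] assms(2-)
  by (cases g) (simp_all add: Var_defs ge_def)

text \<open>One pass of \<open>fibre_point_weyl_R\<close> gives the fixed elements and the image of
  h2. After two passes each e_i has become h1/(h1/e_i), the factors have cancelled, and y is
  recovered from its cross ratio.\<close>

lemma weyl_R_fixed: "weyl_R par_h1 = par_h1" "weyl_R coord_x = coord_x"
  and weyl_R_h2: "weyl_R par_h2 = par_q * par_h1\<^sup>2 / par_h2"
  and weyl_R_invol: "weyl_R (weyl_R r) = r"
proof -
  obtain z where z: "z \<noteq> 0" "to_ac coord_x = z + to_ac par_h1 / z"
    by (rule to_ac_uniformizer)
  note 0 = fibre_pointI[OF field_hom_to_ac z]
  note 1 = fibre_point_weyl_R[OF 0]
  note 2 = fibre_point_weyl_R[OF 1]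
  show h1: "weyl_R par_h1 = par_h1" and x: "weyl_R coord_x = coord_x"
    using 1 z(2) unfolding fibre_point_def comp_apply by (metis to_ac_eq_iff)+
  have "to_ac (weyl_R par_h2) = to_ac (par_q * par_h1\<^sup>2 / par_h2)"
    using 1 unfolding fibre_point_def comp_apply
    by (simp add: par_q_def prod_1_8[simplified] power2_eq_square power4_eq_xxxx mult_ac)
  then show "weyl_R par_h2 = par_q * par_h1\<^sup>2 / par_h2"
    by (simp only: to_ac_eq_iff)
  let ?h = "to_ac par_h1" and ?k = "to_ac par_h2" and ?\<phi> = "to_ac \<circ> weyl_R \<circ> weyl_R"
  have hom: "field_hom ?\<phi>"
    by (simp add: field_hom_comp field_hom_weyl_R field_hom_to_ac)
  have vals: "?\<phi> (par_e i) = to_ac (par_e i)" if "i \<in> {1,2,3,4,5,6,7,8}" for i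
    using 2 that unfolding fibre_point_def by auto
  have h2: "?\<phi> par_h2 = ?k"
    using 2 unfolding fibre_point_def by (simp add: power4_eq_xxxx mult_ac)
  have h: "?\<phi> par_h1 = ?h" and x': "?\<phi> coord_x = to_ac coord_x"
    using h1 x by simp_all
  let ?e = "\<lambda>i. to_ac (par_e i)"
  have U: "U ?e (?h / z) \<noteq> 0" "U ?e z \<noteq> 0"
    using uniformizer_neq_e[OF field_hom_to_ac z] uniformizer_neq_e[OF field_hom_to_ac, of "?h / z"] z
    by (auto simp: U_def prod_3_8 add.commute)
  have "cross_ratio ?h ?k z (?\<phi> coord_y) = cross_ratio ?h ?k z (to_ac coord_y)"
  proof -
    have h: "?h \<noteq> 0"
      by simp
    note F = prod_weyl_3_factor[of ?h z ?e, OF h z(1)]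
    \<comment> \<open>The factors of the second pass are taken at inverted parameters, so their
      product is the inverse of that of the first pass.\<close>
    have "weyl_3_factor ?h z (?h / ?e 4) (?h / ?e 8) * weyl_3_factor ?h z (?h / ?e 7) (?h / ?e 6)
        * weyl_3_factor ?h z (?h / ?e 5) (?h / ?e 3) = 1 / (U ?e (?h / z) / U ?e z)"
      using z(1) unfolding F(2)[symmetric] by (simp add: weyl_3_factor_conj)
    note F' = F(1) this
    have nz: "U ?e (?h / z) / U ?e z \<noteq> 0"
      using U by simp
    have cancel: "c * a * (1 / a) = c" if "a \<noteq> 0" for a c :: "K alg_closure"
      using that by simp
    show ?thesis
      using fibre_pointD[OF 2] unfolding h2 F' cancel[OF nz] .
  qed
  then have y: "?\<phi> coord_y = to_ac coord_y"
  proof (rule cross_ratio_inject[rotated -1])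
    have "?\<phi> coord_x = z + ?\<phi> par_h1 / z"
      unfolding h x' by (rule z(2))
    from uniformizer_y_neq_conj[OF hom z(1) this]
    show "?\<phi> coord_y \<noteq> ?h / z + ?k * z / ?h"
      unfolding h h2 .
    show "to_ac coord_y \<noteq> ?h / z + ?k * z / ?h"
      by (rule uniformizer_y_neq_conj[OF field_hom_to_ac z])
    show "z \<noteq> ?h / z"
      by (rule uniformizer_neq_conj[OF field_hom_to_ac z])
  qed (use z(1) par_h1_neq_h2 in simp_all)
  have "?\<phi> (Var g) = to_ac (Var g)" for g
    by (rule Var_cases) (fact vals h2 h x' y)+
  then have "?\<phi> = to_ac"
    by (intro field_hom_K_eqI hom field_hom_to_ac) (simp_all add: weyl_R_const)
  then show "weyl_R (weyl_R r) = r"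
    by (metis comp_apply to_ac_eq_iff)
qed

section \<open>The translation T and its inverse in terms of R and s_2\<close>

lemma weyl_w_eq: "weyl_w = weyl_s 2 \<circ> weyl_R"
  by (simp add: weyl_w_def weyl_R_def)

lemma weyl_2_Var: "weyl_s 2 (Var g) = Var ((id(Gh1 := Gh2, Gh2 := Gh1, Gx := Gy, Gy := Gx)) g)"
  by (simp add: weyl_s_Var) (simp add: weyl_img_def Let_def Var_defs)

lemma ge_neq:
  assumes "i \<in> {1..8}"
  shows "ge i \<noteq> Gh1" "ge i \<noteq> Gh2" "ge i \<noteq> Gx" "ge i \<noteq> Gy"
  using assms by (auto simp: ge_def numeral_eq_Suc le_Suc_eq)

lemma weyl_2_simps:
  "weyl_s 2 par_h1 = par_h2" "weyl_s 2 par_h2 = par_h1" "weyl_s 2 coord_x = coord_y" "weyl_s 2 coord_y = coord_x"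
  by (simp_all add: Var_defs weyl_2_Var)

lemma weyl_2_par_e: "1 \<le> i \<Longrightarrow> i \<le> 8 \<Longrightarrow> weyl_s 2 (par_e i) = par_e i"
  by (simp add: Var_defs weyl_2_Var ge_neq)

lemma weyl_2_invol: "weyl_s 2 (weyl_s 2 r) = r"
proof -
  have "weyl_s 2 \<circ> weyl_s 2 = id"
    by (rule field_hom_K_eqI)
      (simp_all add: field_hom_comp field_hom_weyl_s field_hom_id weyl_s_const weyl_2_Var)
  then show ?thesis
    by (simp add: fun_eq_iff)
qed

lemma T_inv_eq: "T_inv = weyl_R \<circ> weyl_s 2 \<circ> weyl_R \<circ> weyl_s 2"
  unfolding T_inv_def
  by (rule inv_equality)
    (simp_all add: T_def weyl_w_eq fun_eq_iff weyl_R_invol weyl_2_invol)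

lemma T_eq: "T = weyl_s 2 \<circ> weyl_R \<circ> weyl_s 2 \<circ> weyl_R"
  by (simp add: T_def weyl_w_eq comp_assoc)

lemma T_T_inv: "T (T_inv r) = r" "T_inv (T r) = r"
  by (simp_all add: T_eq T_inv_eq weyl_R_invol weyl_2_invol)

lemma field_hom_T: "field_hom T"
  by (simp add: T_eq field_hom_comp field_hom_weyl_R field_hom_weyl_s)

text \<open>One of the two copies of R meets x or h1, which it fixes, so a single R remains.\<close>

lemma T_inv_vals: "T_inv coord_y = weyl_R coord_y" "T_inv par_h2 = weyl_R par_h2"
  and T_vals: "T coord_x = weyl_s 2 (weyl_R coord_y)" "T par_h1 = weyl_s 2 (weyl_R par_h2)"
  by (simp_all add: T_inv_eq T_eq weyl_2_simps weyl_R_fixed)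

lemma T_inv_h2: "T_inv par_h2 = par_q * par_h1\<^sup>2 / par_h2"
  by (simp add: T_inv_vals weyl_R_h2)

lemma T_h1: "T par_h1 = par_q * par_h2\<^sup>2 / par_h1"
proof -
  note h = field_hom_simps[OF field_hom_weyl_s[of 2]]
  have "weyl_s 2 par_q = par_q"
    by (simp add: par_q_def h prod_1_8[simplified] weyl_2_simps weyl_2_par_e mult_ac)
  then show ?thesis
    by (simp add: T_vals weyl_R_h2 h weyl_2_simps)
qed

theorem eq_y_holds:
  fixes \<phi> :: "K \<Rightarrow> 'l::field"
  assumes hom: "field_hom \<phi>" and z: "z \<noteq> 0" "\<phi> coord_x = z + \<phi> par_h1 / z"
  shows "eq_y (\<lambda>i. \<phi> (par_e i)) (\<phi> par_h1) (\<phi> par_h2) (\<phi> (T_inv par_h2)) (\<phi> coord_y) (\<phi> (T_inv coord_y)) z"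
proof -
  let ?h = "\<phi> par_h1" and ?k = "\<phi> par_h2" and ?m = "\<phi> (T_inv par_h2)" and ?e = "\<lambda>i. \<phi> (par_e i)"
  have h: "?h \<noteq> 0"
    by (simp add: field_hom_eq_0_iff[OF hom])
  \<comment> \<open>The composite has the same x and h1, so z parametrises its fibre too; this keeps
    T^-1(y) away from the pole of the cross ratio.\<close>
  have hom': "field_hom (\<phi> \<circ> weyl_R)"
    by (simp add: field_hom_comp field_hom_weyl_R hom)
  have "cross_ratio ?h ?m z (\<phi> (T_inv coord_y)) = cross_ratio ?h ?k z (\<phi> coord_y) * (U ?e (?h / z) / U ?e z)"
    using fibre_point_weyl_R[OF fibre_pointI[OF assms]] prod_weyl_3_factor[of ?h z ?e] z h
    unfolding fibre_point_def by (simp add: T_inv_vals)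
  moreover have "\<phi> coord_y \<noteq> z + ?k / z" "\<phi> coord_y \<noteq> ?h / z + ?k * z / ?h"
    by (rule uniformizer_y_neq uniformizer_y_neq_conj; fact)+
  moreover have "\<phi> (T_inv coord_y) \<noteq> ?h / z + ?m * z / ?h"
    using uniformizer_y_neq_conj[OF hom' z(1)] z(2) by (simp add: T_inv_vals weyl_R_fixed)
  moreover have "U ?e z \<noteq> 0"
    using uniformizer_neq_e[OF assms] z by (auto simp: U_def prod_3_8)
  moreover have "a * d / (b * c) = r" if "a / b = c / d * r" "c \<noteq> 0" "d \<noteq> 0" for a b c d r :: 'l
    using that by (simp add: times_divide_times_eq[symmetric])
  ultimately show ?thesis
    unfolding eq_y_def frac_eq_def cross_ratio_def by simp
qed

text \<open>Composing with s_2 exchanges x with y and h1 with h2 and fixes the e_i, so it turns the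
  first equation into the second.\<close>

theorem eq_x_holds:
  fixes \<phi> :: "K \<Rightarrow> 'l::field"
  assumes hom: "field_hom \<phi>" and z: "z \<noteq> 0" "\<phi> coord_y = z + \<phi> par_h2 / z"
  shows "eq_x (\<lambda>i. \<phi> (par_e i)) (\<phi> par_h1) (\<phi> par_h2) (\<phi> (T par_h1)) (\<phi> coord_x) (\<phi> (T coord_x)) z"
proof -
  have U: "U (\<lambda>i. (\<phi> \<circ> weyl_s 2) (par_e i)) t = U (\<lambda>i. \<phi> (par_e i)) t" for t
    by (simp add: U_def prod_3_8 weyl_2_par_e)
  have "field_hom (\<phi> \<circ> weyl_s 2)"
    by (simp add: field_hom_comp field_hom_weyl_s hom)
  from eq_y_holds[OF this z(1)] z(2) show ?thesis
    unfolding eq_y_def eq_x_def U by (simp add: weyl_2_simps T_vals T_inv_vals)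
qed

section \<open>The field with the auxiliary variable\<close>

lemma incl_eq: "incl k = to_fract [:k:]" and lam_eq: "lam = to_fract [:0, 1:]"
  by (simp_all add: incl_def lam_def to_fract_def)

lemma field_hom_incl: "field_hom incl"
  by (simp add: field_hom_def incl_eq flip: one_pCons to_fract_add to_fract_mult)

lemma lam_neq_0: "lam \<noteq> 0"
  by (simp add: lam_eq)

lemma K_lam_induct [case_names incl lam add mult divide]:
  fixes r :: K_lam
  assumes "\<And>k. P (incl k)" "P lam"
    and "\<And>p q. P p \<Longrightarrow> P q \<Longrightarrow> P (p + q)" "\<And>p q. P p \<Longrightarrow> P q \<Longrightarrow> P (p * q)" "\<And>p q. P p \<Longrightarrow> P q \<Longrightarrow> P (p / q)"
  shows "P r"
proof -
  have "P (to_fract p)" for p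
  proof (induction p)
    case 0
    then show ?case
      using assms(1)[of 0] by (simp add: incl_eq)
  next
    case (pCons a p)
    have "to_fract (pCons a p) = incl a + lam * to_fract p"
      by (simp add: incl_eq lam_eq flip: to_fract_add to_fract_mult)
    then show ?case
      using assms pCons by simp
  qed
  then show ?thesis
    using assms(5) by (metis fract_to_fract_cases)
qed

lemma extends_T_unique:
  assumes "extends_T \<sigma>" "extends_T \<tau>"
  shows "\<sigma> = \<tau>"
proof
  fix r
  note s = field_hom_simps[of \<sigma>] field_hom_simps[of \<tau>]
  show "\<sigma> r = \<tau> r"
    by (induction r rule: K_lam_induct) (use assms in \<open>simp_all add: extends_T_def s\<close>)
qed

text \<open>On polynomials in \<lambda> the extension applies T to the coefficients and scales
  \<lambda> by \<open>?c\<close>; both are injective, so it passes to fractions. Surjectivity is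
  checked on K and \<lambda>, which generate the field.\<close>

lemma extends_T_exists: "\<exists>\<tau>. extends_T \<tau>"
proof -
  let ?c = "T par_h1 / par_h2"
  define E where "E p = to_fract (pcompose (map_poly T p) [:0, ?c:])" for p
  have T0: "T r = 0 \<longleftrightarrow> r = 0" for r
    by (rule field_hom_eq_0_iff[OF field_hom_T])
  have c: "?c \<noteq> 0"
    by (simp add: T0)
  have "E p \<noteq> 0" if "p \<noteq> 0" for p
  proof
    assume "E p = 0"
    then have "map_poly T p = 0"
      using c by (auto simp: E_def dest: pcompose_eq_0)
    then show False
      using that by (subst (asm) map_poly_eq_0_iff) (auto simp: T0)
  qed
  then obtain \<tau> where \<tau>: "field_hom \<tau>" "\<And>p. \<tau> (to_fract p) = E p"
    by (rule field_hom_fract_exists[of E, rotated 3])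
      (auto simp: E_def map_poly_field_hom[OF field_hom_T] pcompose_add pcompose_mult
        field_hom_1[OF field_hom_T] pcompose_1 simp flip: to_fract_add to_fract_mult)
  have \<tau>_incl: "\<tau> (incl k) = incl (T k)" for k
    by (simp add: incl_eq \<tau> E_def map_poly_pCons T0)
  have \<tau>_lam: "\<tau> lam = lam * incl ?c"
    by (simp add: incl_eq lam_eq \<tau> E_def map_poly_pCons T0 field_hom_1[OF field_hom_T] pcompose_pCons
        flip: to_fract_mult)
  note s = field_hom_simps[OF \<tau>(1)] and i = field_hom_simps[OF field_hom_incl]
  have "\<exists>s. \<tau> s = r" for r
  proof (induction r rule: K_lam_induct)
    case (incl k)
    show ?case
      by (metis T_T_inv(1) \<tau>_incl)
  next
    case lam
    \<comment> \<open>The coefficient must become 1/c after T has been applied to it, hence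
      T^-1(1/c).\<close>
    have "\<tau> (lam * incl (T_inv (1 / ?c))) = lam"
      unfolding s \<tau>_lam \<tau>_incl T_T_inv mult.assoc field_hom_mult[OF field_hom_incl, symmetric]
      using c by (simp add: i)
    then show ?case by blast
  qed (metis s(2) s(3) s(7))+
  then have "bij \<tau>"
    by (metis bijI injI surjI field_hom_eq_iff[OF \<tau>(1)] surj_def)
  then show ?thesis
    using \<tau>(1) \<tau>_incl \<tau>_lam by (auto simp: extends_T_def i)
qed

theorem extends_T_T_lam: "extends_T T_lam"
  unfolding T_lam_def using extends_T_exists extends_T_unique by (metis theI)

lemma field_hom_T_lam: "field_hom T_lam"
  and T_lam_incl: "T_lam (incl k) = incl (T k)"
  and T_lam_lam: "T_lam lam = lam * incl (T par_h1) / incl par_h2"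
  and bij_T_lam: "bij T_lam"
  using extends_T_T_lam by (auto simp: extends_T_def)

lemma field_hom_T_lam_inv: "field_hom T_lam_inv"
  unfolding T_lam_inv_def by (rule field_hom_inv[OF field_hom_T_lam bij_T_lam])

lemma T_lam_inv_eqI: "T_lam s = r \<Longrightarrow> T_lam_inv r = s"
  unfolding T_lam_inv_def using bij_T_lam by (simp add: bij_is_inj inv_f_eq)

lemma T_lam_inv_incl: "T_lam_inv (incl k) = incl (T_inv k)"
  by (rule T_lam_inv_eqI) (simp add: T_lam_incl T_T_inv)

lemma T_lam_inv_lam: "T_lam_inv lam = lam * incl (T_inv par_h2) / incl par_h1"
proof (rule T_lam_inv_eqI)
  have "incl (T par_h1) \<noteq> 0" "incl par_h2 \<noteq> 0"
    by (simp_all add: field_hom_eq_0_iff[OF field_hom_incl] field_hom_eq_0_iff[OF field_hom_T])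
  then show "T_lam (lam * incl (T_inv par_h2) / incl par_h1) = lam"
    by (simp add: field_hom_simps[OF field_hom_T_lam] T_lam_incl T_lam_lam T_T_inv)
qed

section \<open>Rescaling\<close>

lemma frac_eq_scale:
  assumes "s \<noteq> 0" "t \<noteq> 0" "a' = s * a" "b' = s * b" "c' = t * c" "d' = t * d"
  shows "frac_eq a' b' c' d' \<longleftrightarrow> frac_eq a b c d"
  using assms by (simp add: frac_eq_def)

text \<open>Each factor only picks up a scale factor. Since \<open>L\<close> is the image of
  \<lambda> under T^-1, the shifted factor at z/l belongs to the section h1/z + m z/h1 and the one
  at its conjugate to z + m/z; this explains why the two forms of the equation place the shifted
  sections differently.\<close>

lemma eq_y_iff_qE7_g:
  fixes l q h1 h2 z y y' :: "'m::field"
  assumes nz: "l \<noteq> 0" "q \<noteq> 0" "h1 \<noteq> 0" "h2 \<noteq> 0" "z \<noteq> 0"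
    and m: "m = q * h1\<^sup>2 / h2" and L: "L = l * m / h1"
  shows "eq_y e h1 h2 m y y' z \<longleftrightarrow>
    qE7_g q (\<lambda>i. e i / l) (h1 / l\<^sup>2) (h2 / l\<^sup>2) (y / l) (y' / L) (z / l)"
proof -
  have L': "L = l * q * h1 / h2"
    using nz by (simp add: L m power2_eq_square)
  define G where "G u = u + h2 / l\<^sup>2 / u" for u
  define G' where "G' u = u + h2 / l\<^sup>2 / (q * u)" for u
  have U: "U (\<lambda>i. e i / l) (t / l) = 1 / l ^ 3 * U e t" for t
  proof -
    have "(\<Prod>i=3..8. t / l - e i / l) = (\<Prod>i=3..8. t - e i) / l ^ 6"
      by (simp add: prod_dividef flip: diff_divide_distrib)
    then show ?thesis
      using nz by (simp add: U_def power_divide divide_simps)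
  qed
  have w: "h1 / l\<^sup>2 / (z / l) = h1 / z / l"
    using nz by (simp add: power2_eq_square)
  have g: "y / l - G (t / l) = (y - (t + h2 / t)) / l" if "t \<noteq> 0" for t
    using nz that by (simp add: G_def field_simps power2_eq_square)
  have g': "y' / L - G' (t / l) = (y' - (q * h1 * t / h2 + h1 / t)) * h2 / (l * q * h1)" if "t \<noteq> 0" for t
    using nz that by (simp add: G'_def L' field_simps power2_eq_square)
  have w0: "h1 / z \<noteq> 0"
    using nz by simp
  have m1: "q * h1 * (h1 / z) / h2 + h1 / (h1 / z) = z + m / z"
    and m2: "q * h1 * z / h2 + h1 / z = h1 / z + m * z / h1"
    and m3: "h2 / (h1 / z) = h2 * z / h1"
    using nz by (simp_all add: m power2_eq_square mult_ac)
  have "qE7_g q (\<lambda>i. e i / l) (h1 / l\<^sup>2) (h2 / l\<^sup>2) (y / l) (y' / L) (z / l) \<longleftrightarrow>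
      frac_eq ((y / l - G (h1 / z / l)) * (y' / L - G' (h1 / z / l))) ((y / l - G (z / l)) * (y' / L - G' (z / l)))
        (1 / l ^ 3 * U e (h1 / z)) (1 / l ^ 3 * U e z)"
    unfolding qE7_g_def Let_def G_def[symmetric] G'_def[symmetric] w U ..
  also have "\<dots> \<longleftrightarrow> eq_y e h1 h2 m y y' z"
    unfolding eq_y_def
    \<comment> \<open>\<open>s\<close> is the product of the scale factors in \<open>g\<close> and
      \<open>g'\<close>; \<open>t\<close> comes from U, which is homogeneous of degree 6 -
      3.\<close>
    by (rule frac_eq_scale[where s = "h2 / (l * l * q * h1)" and t = "1 / l ^ 3"])
      (use nz in \<open>simp_all only: g[OF w0] g[OF nz(5)] g'[OF w0] g'[OF nz(5)] m1 m2 m3\<close>, simp_all add: mult_ac)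
  finally show ?thesis ..
qed

lemma eq_x_eq: "eq_x e h1 h2 m x x' z = eq_y e h2 h1 m x x' z"
  by (simp add: eq_x_def eq_y_def)

lemma qE7_f_eq: "qE7_f q v k1 k2 f f' u = qE7_g q v k2 k1 f f' u"
  by (simp add: qE7_f_def qE7_g_def)

lemma uniformizer_scale:
  fixes l h z x :: "'m::field"
  assumes "l \<noteq> 0" "z \<noteq> 0"
  shows "x = z + h / z \<longleftrightarrow> x / l = z / l + h / l\<^sup>2 / (z / l)"
proof -
  have "z / l + h / l\<^sup>2 / (z / l) = (z + h / z) / l"
    using assms by (simp add: field_simps power2_eq_square)
  then show ?thesis
    using assms by simp
qed

theorem equations_equivalent:
  fixes \<psi> :: "K_lam \<Rightarrow> 'm::field"
  assumes hom: "field_hom \<psi>" and z: "z \<noteq> 0"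
  shows "let l = \<psi> lam; u = z / l; f = x / l; g = y / l;
             f' = x' / \<psi> (T_lam lam); g' = y' / \<psi> (T_lam_inv lam);
             e = (\<lambda>i. \<psi> (incl (par_e i))); h1 = \<psi> (incl par_h1); h2 = \<psi> (incl par_h2);
             q = \<psi> (incl par_q); v = (\<lambda>i. \<psi> (var_v i)); k1 = \<psi> var_k1; k2 = \<psi> var_k2
         in
         (x = z + h1 / z \<longleftrightarrow> f = u + k1 / u) \<and>
         (y = z + h2 / z \<longleftrightarrow> g = u + k2 / u) \<and>
         (eq_y e h1 h2 (\<psi> (incl (T_inv par_h2))) y y' z \<longleftrightarrow> qE7_g q v k1 k2 g g' u) \<and>
         (eq_x e h1 h2 (\<psi> (incl (T par_h1))) x x' z \<longleftrightarrow> qE7_f q v k1 k2 f f' u)"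
proof -
  note s = field_hom_simps[OF hom] and i = field_hom_simps[OF field_hom_incl]
  have z0: "\<psi> (incl k) = 0 \<longleftrightarrow> k = 0" for k
    by (simp add: field_hom_eq_0_iff[OF hom] field_hom_eq_0_iff[OF field_hom_incl])
  have q: "par_q \<noteq> 0"
    by (simp add: par_q_def)
  have l: "\<psi> lam \<noteq> 0"
    by (simp add: field_hom_eq_0_iff[OF hom] lam_neq_0)
  have k: "\<psi> var_k1 = \<psi> (incl par_h1) / (\<psi> lam)\<^sup>2" "\<psi> var_k2 = \<psi> (incl par_h2) / (\<psi> lam)\<^sup>2"
    and v: "(\<lambda>i. \<psi> (var_v i)) = (\<lambda>i. \<psi> (incl (par_e i)) / \<psi> lam)"
    by (simp_all add: var_k1_def var_k2_def var_v_def s)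
  show ?thesis
    unfolding Let_def eq_x_eq qE7_f_eq k v
  proof (intro conjI)
    show "eq_y (\<lambda>i. \<psi> (incl (par_e i))) (\<psi> (incl par_h1)) (\<psi> (incl par_h2)) (\<psi> (incl (T_inv par_h2))) y y' z \<longleftrightarrow>
      qE7_g (\<psi> (incl par_q)) (\<lambda>i. \<psi> (incl (par_e i)) / \<psi> lam) (\<psi> (incl par_h1) / (\<psi> lam)\<^sup>2)
        (\<psi> (incl par_h2) / (\<psi> lam)\<^sup>2) (y / \<psi> lam) (y' / \<psi> (T_lam_inv lam)) (z / \<psi> lam)"
      by (rule eq_y_iff_qE7_g) (simp_all add: l z z0 q T_lam_inv_lam T_inv_h2 s i)
    show "eq_y (\<lambda>i. \<psi> (incl (par_e i))) (\<psi> (incl par_h2)) (\<psi> (incl par_h1)) (\<psi> (incl (T par_h1))) x x' z \<longleftrightarrow>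
      qE7_g (\<psi> (incl par_q)) (\<lambda>i. \<psi> (incl (par_e i)) / \<psi> lam) (\<psi> (incl par_h2) / (\<psi> lam)\<^sup>2)
        (\<psi> (incl par_h1) / (\<psi> lam)\<^sup>2) (x / \<psi> lam) (x' / \<psi> (T_lam lam)) (z / \<psi> lam)"
      by (rule eq_y_iff_qE7_g) (simp_all add: l z z0 q T_lam_lam T_h1 s i)
  qed (rule uniformizer_scale[OF l z])+
qed

lemma uniformizer_unscale:
  fixes \<psi> :: "K_lam \<Rightarrow> 'm::field"
  assumes hom: "field_hom \<psi>" and u: "u \<noteq> 0"
  shows "field_hom (\<psi> \<circ> incl)" "u * \<psi> lam \<noteq> 0" "u * \<psi> lam / \<psi> lam = u"
  using assms by (simp_all add: field_hom_comp field_hom_incl field_hom_eq_0_iff[OF hom] lam_neq_0)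

theorem qE7_g_holds:
  fixes \<psi> :: "K_lam \<Rightarrow> 'm::field"
  assumes hom: "field_hom \<psi>" and u: "u \<noteq> 0" "\<psi> var_f = u + \<psi> var_k1 / u"
  shows "qE7_g (\<psi> (incl par_q)) (\<lambda>i. \<psi> (var_v i)) (\<psi> var_k1) (\<psi> var_k2)
              (\<psi> var_g) (\<psi> (T_lam_inv var_g)) u"
proof -
  note U = uniformizer_unscale[OF hom u(1)]
  note E = equations_equivalent[OF hom U(2), unfolded Let_def U(3)]
  have "\<psi> (incl coord_x) / \<psi> lam = u + \<psi> var_k1 / u"
    using u(2) by (simp add: var_f_def field_hom_simps[OF hom])
  then have "\<psi> (incl coord_x) = u * \<psi> lam + \<psi> (incl par_h1) / (u * \<psi> lam)"
    using E by blast
  then have "eq_y (\<lambda>i. \<psi> (incl (par_e i))) (\<psi> (incl par_h1)) (\<psi> (incl par_h2)) (\<psi> (incl (T_inv par_h2)))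
      (\<psi> (incl coord_y)) (\<psi> (incl (T_inv coord_y))) (u * \<psi> lam)"
    using eq_y_holds[OF U(1,2)] by simp
  then have "qE7_g (\<psi> (incl par_q)) (\<lambda>i. \<psi> (var_v i)) (\<psi> var_k1) (\<psi> var_k2)
      (\<psi> (incl coord_y) / \<psi> lam) (\<psi> (incl (T_inv coord_y)) / \<psi> (T_lam_inv lam)) u"
    using E by blast
  then show ?thesis
    by (simp add: var_g_def field_hom_simps[OF hom] field_hom_simps[OF field_hom_T_lam_inv] T_lam_inv_incl)
qed

theorem qE7_f_holds:
  fixes \<psi> :: "K_lam \<Rightarrow> 'm::field"
  assumes hom: "field_hom \<psi>" and u: "u \<noteq> 0" "\<psi> var_g = u + \<psi> var_k2 / u"
  shows "qE7_f (\<psi> (incl par_q)) (\<lambda>i. \<psi> (var_v i)) (\<psi> var_k1) (\<psi> var_k2)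
              (\<psi> var_f) (\<psi> (T_lam var_f)) u"
proof -
  note U = uniformizer_unscale[OF hom u(1)]
  note E = equations_equivalent[OF hom U(2), unfolded Let_def U(3)]
  have "\<psi> (incl coord_y) / \<psi> lam = u + \<psi> var_k2 / u"
    using u(2) by (simp add: var_g_def field_hom_simps[OF hom])
  then have "\<psi> (incl coord_y) = u * \<psi> lam + \<psi> (incl par_h2) / (u * \<psi> lam)"
    using E by blast
  then have "eq_x (\<lambda>i. \<psi> (incl (par_e i))) (\<psi> (incl par_h1)) (\<psi> (incl par_h2)) (\<psi> (incl (T par_h1)))
      (\<psi> (incl coord_x)) (\<psi> (incl (T coord_x))) (u * \<psi> lam)"
    using eq_x_holds[OF U(1,2)] by simp
  then have "qE7_f (\<psi> (incl par_q)) (\<lambda>i. \<psi> (var_v i)) (\<psi> var_k1) (\<psi> var_k2)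
      (\<psi> (incl coord_x) / \<psi> lam) (\<psi> (incl (T coord_x)) / \<psi> (T_lam lam)) u"
    using E by blast
  then show ?thesis
    by (simp add: var_f_def field_hom_simps[OF hom] field_hom_simps[OF field_hom_T_lam] T_lam_incl)
qed

section \<open>Determinacy of rational functions\<close>

lemma cst_eq: "cst a = to_fract [:[:a:]:]" and fx_eq: "fx = to_fract [:[:0, 1:]:]" and fy_eq: "fy = to_fract [:0, 1:]"
  by (simp_all add: cst_def fx_def fy_def to_fract_def)

lemma field_hom_cst: "field_hom cst"
  by (simp add: field_hom_def cst_eq flip: one_pCons to_fract_add to_fract_mult)

lemmas cst_simps = field_hom_simps[OF field_hom_cst]
lemmas cst_eq_0_iff = field_hom_eq_0_iff[OF field_hom_cst]

definition eval1 :: "'a::field poly \<Rightarrow> 'a poly poly fract \<Rightarrow> 'a poly poly fract" where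
  "eval1 p s = poly (map_poly cst p) s"

lemma eval1_simps:
  "eval1 0 s = 0" "eval1 1 s = 1" "eval1 (p + q) s = eval1 p s + eval1 q s" "eval1 (p * q) s = eval1 p s * eval1 q s"
  "eval1 (pCons a p) s = cst a + s * eval1 p s"
  by (simp_all add: eval1_def cst_simps map_poly_field_hom[OF field_hom_cst])

lemma eval2_eq: "eval2 A s t = poly (map_poly (\<lambda>p. eval1 p s) A) t"
  by (simp add: eval2_def eval1_def)

lemmas map_poly_eval1 = map_poly_ring_hom[of "\<lambda>p. eval1 p s" for s, OF eval1_simps(1,3,4)]

lemma eval2_simps:
  "eval2 0 s t = 0" "eval2 1 s t = 1" "eval2 (A + B) s t = eval2 A s t + eval2 B s t"
  "eval2 (A * B) s t = eval2 A s t * eval2 B s t" "eval2 (pCons p A) s t = eval1 p s + t * eval2 A s t"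
  by (simp_all add: eval2_eq map_poly_eval1 eval1_simps)

lemma eval2_smult: "eval2 (smult p A) s t = eval1 p s * eval2 A s t"
  using eval2_simps(4)[of "[:p:]" A s t] by (simp add: eval2_simps eval1_simps)

lemma eval2_diff: "eval2 (A - B) s t = eval2 A s t - eval2 B s t"
  using eval2_simps(3)[of "A - B" B s t] by simp

text \<open>The inner variable of A stands for s, so \<open>coeff (coeff A i) j\<close> belongs to
  s^j t^i. The parameters are explicit, and not read off from a point, so that they can be
  exchanged.\<close>

definition det_at :: "'a::field poly poly fract \<Rightarrow> 'a poly poly fract \<Rightarrow> 'a poly poly fract \<Rightarrow> bool" where
  "det_at r s t \<longleftrightarrow> (\<exists>A B. (coeff (coeff A 0) 0 \<noteq> 0 \<or> coeff (coeff B 0) 0 \<noteq> 0) \<and>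
     r * eval2 B s t = eval2 A s t)"

lemma indeterminate_at_iff:
  "indeterminate_at r p \<longleftrightarrow> \<not> det_at r (fst (local_params p)) (snd (local_params p))"
  by (simp add: indeterminate_at_def det_at_def case_prod_unfold poly_0_coeff_0)

text \<open>This lifts an equation in the function field to one between polynomials in the local
  parameters, whose coefficients can then be compared.\<close>

definition alg_indep :: "'a::field poly poly fract \<Rightarrow> 'a poly poly fract \<Rightarrow> bool" where
  "alg_indep s t \<longleftrightarrow> (\<forall>A. eval2 A s t = 0 \<longrightarrow> A = 0)"

text \<open>Exchanges the two variables: the inner variable of each coefficient becomes the outer
  one, and the former outer variable is set to the inner one. It reduces the direction
  \<open>Infinity\<close> of a blow-up to an affine direction.\<close>

definition poly_swap :: "'a::field poly poly \<Rightarrow> 'a poly poly" where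
  "poly_swap A = poly (map_poly (map_poly (\<lambda>c. [:c:])) A) [:[:0, 1:]:]"

lemma map_poly_const: 
  "map_poly (\<lambda>c. [:c:]) (p + q) = map_poly (\<lambda>c. [:c:]) p + map_poly (\<lambda>c. [:c:]) (q :: 'a::field poly)"
  "map_poly (\<lambda>c. [:c:]) (p * q) = map_poly (\<lambda>c. [:c:]) p * map_poly (\<lambda>c. [:c:]) (q :: 'a::field poly)"
  "map_poly (\<lambda>c. [:c:]) (pCons a p) = pCons [:a:] (map_poly (\<lambda>c. [:c:]) (p :: 'a::field poly))"
  by (subst map_poly_ring_hom; simp)+

lemma poly_swap_0: "poly_swap 0 = 0"
  and poly_swap_pCons: "poly_swap (pCons p A) = map_poly (\<lambda>c. [:c:]) p + [:[:0, 1:]:] * poly_swap A"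
proof -
  have "map_poly (map_poly (\<lambda>c. [:c:])) (pCons p A) = pCons (map_poly (\<lambda>c. [:c:]) p) (map_poly (map_poly (\<lambda>c. [:c:])) A)"
    by (rule map_poly_ring_hom) (simp_all add: map_poly_const)
  then show "poly_swap (pCons p A) = map_poly (\<lambda>c. [:c:]) p + [:[:0, 1:]:] * poly_swap A"
    by (simp add: poly_swap_def)
qed (simp add: poly_swap_def)

lemma eval2_map_poly_const: "eval2 (map_poly (\<lambda>c. [:c:]) p) s t = eval1 p t"
  by (induction p) (simp_all add: map_poly_const eval1_simps eval2_simps)

lemma eval2_poly_swap: "eval2 (poly_swap A) t s = eval2 A s t"
  by (induction A)
    (simp_all only: poly_swap_0 poly_swap_pCons eval2_simps eval2_map_poly_const eval1_simps cst_simps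
      mult_zero_right add_0_right add_0_left mult_1_right)

lemma coeff_poly_swap: "coeff (coeff (poly_swap A) j) i = coeff (coeff A i) j"
proof (induction A arbitrary: i)
  case (pCons p A)
  then show ?case
    by (cases i) (simp_all add: poly_swap_pCons coeff_map_poly)
qed (simp add: poly_swap_0)

lemma alg_indep_commute:
  assumes "alg_indep s t"
  shows "alg_indep t s"
  unfolding alg_indep_def
proof (intro allI impI)
  fix A assume "eval2 A t s = 0"
  then have "poly_swap A = 0"
    using assms by (simp add: alg_indep_def flip: eval2_poly_swap[of A])
  then have "coeff (coeff A i) j = 0" for i j
    by (simp flip: coeff_poly_swap)
  then show "A = 0"
    by (simp add: poly_eq_iff)
qed

lemma det_at_commute_imp: "det_at r s t \<Longrightarrow> det_at r t s"
  unfolding det_at_def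
proof (elim exE conjE)
  fix A B assume "coeff (coeff A 0) 0 \<noteq> 0 \<or> coeff (coeff B 0) 0 \<noteq> 0" "r * eval2 B s t = eval2 A s t"
  then show "\<exists>A B. (coeff (coeff A 0) 0 \<noteq> 0 \<or> coeff (coeff B 0) 0 \<noteq> 0) \<and> r * eval2 B t s = eval2 A t s"
    by (intro exI[of _ "poly_swap A"] exI[of _ "poly_swap B"]) (simp add: eval2_poly_swap coeff_poly_swap)
qed

lemma det_at_commute: "det_at r s t \<longleftrightarrow> det_at r t s"
  using det_at_commute_imp by blast

section \<open>Algebraic independence of local parameters\<close>

lemma alg_indep_fx_fy: "alg_indep (fx :: 'a::field poly poly fract) fy"
proof -
  have 1: "eval1 p fx = to_fract [:p:]" for p :: "'a poly"
    by (induction p) (simp_all add: eval1_simps cst_eq fx_eq flip: to_fract_add to_fract_mult)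
  have "eval2 A fx fy = to_fract A" for A :: "'a poly poly"
    by (induction A) (simp_all add: eval2_simps 1 fy_eq flip: to_fract_add to_fract_mult)
  then show ?thesis
    by (simp add: alg_indep_def)
qed

lemma alg_indep_neq_0:
  assumes "alg_indep s t"
  shows "s \<noteq> 0" "t \<noteq> 0" 
  using assms[unfolded alg_indep_def, rule_format, of "[:[:0, 1:]:]"]
    assms[unfolded alg_indep_def, rule_format, of "[:0, 1:]"]
  by (auto simp: eval2_simps eval1_simps cst_simps)

lemma alg_indep_shift:
  assumes "alg_indep s t"
  shows "alg_indep s (t - cst c)"
  unfolding alg_indep_def
proof (intro allI impI)
  fix A assume "eval2 A s (t - cst c) = 0"
  moreover have "eval2 (pcompose A [:[:- c:], 1:]) s t = eval2 A s (t - cst c)"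
    by (induction A)
      (simp_all add: pcompose_pCons eval2_simps eval2_smult eval1_simps cst_simps algebra_simps)
  ultimately have "pcompose A [:[:- c:], 1:] = 0"
    using assms by (simp add: alg_indep_def)
  then show "A = 0"
    by (rule pcompose_eq_0) simp
qed

text \<open>Multiplying a relation for 1/t by a power of t gives one for t with the coefficients in
  reverse order.\<close>

lemma alg_indep_inverse:
  assumes "alg_indep s t"
  shows "alg_indep s (1 / t)"
  unfolding alg_indep_def
proof (intro allI impI)
  fix A assume A: "eval2 A s (1 / t) = 0"
  have t: "t \<noteq> 0"
    by (rule alg_indep_neq_0[OF assms])
  have inj: "eval1 p s = 0 \<longleftrightarrow> p = 0" for p
    using assms[unfolded alg_indep_def, rule_format, of "[:p:]"] by (auto simp: eval2_simps eval1_simps)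
  have "map_poly (\<lambda>p. eval1 p s) (reflect_poly A) = reflect_poly (map_poly (\<lambda>p. eval1 p s) A)"
    by (rule poly_eqI) (simp add: coeff_map_poly coeff_reflect_poly degree_map_poly inj eval1_simps)
  then have "eval2 (reflect_poly A) s t = 0"
    using A t by (simp add: eval2_eq poly_reflect_poly_nz inverse_eq_divide)
  then have "reflect_poly A = 0"
    using assms unfolding alg_indep_def by blast
  then show "A = 0"
    by simp
qed

lemma alg_indep_blow_up:
  assumes "alg_indep s t"
  shows "alg_indep s (t / s)"
  unfolding alg_indep_def
proof (intro allI impI)
  fix A assume A: "eval2 A s (t / s) = 0"
  have s: "s \<noteq> 0"
    by (rule alg_indep_neq_0[OF assms])
  \<comment> \<open>\<open>B\<close> is A(s, t/s) with denominators cleared by s^n; distinct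
    monomials stay distinct, so \<open>B\<close> vanishes only with A. The bound n is left free for
    the induction.\<close>
  have "\<exists>B. eval2 B s t = s ^ n * eval2 A s (t / s) \<and> (B = 0 \<longrightarrow> A = 0)" if "degree A \<le> n" for A n
    using that
  proof (induction A arbitrary: n)
    case 0
    show ?case by (rule exI[of _ 0]) (simp add: eval2_simps)
  next
    case (pCons p A)
    show ?case
    proof (cases "A = 0")
      case True
      then show ?thesis
        by (intro exI[of _ "[:[:0, 1:] ^ n * p:]"])
          (auto simp: eval2_simps eval1_simps, induction n, simp_all add: eval1_simps cst_simps)
    next
      case False
      then obtain m where m: "n = Suc m" "degree A \<le> m"
        using pCons.prems by (cases n) auto
      obtain B where B: "eval2 B s t = s ^ m * eval2 A s (t / s)" "B = 0 \<longrightarrow> A = 0"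
        using pCons.IH[OF m(2)] by blast
      have e: "eval1 ([:0, 1:] ^ n) s = s ^ n" for n
        by (induction n) (simp_all add: eval1_simps cst_simps)
      show ?thesis
        by (rule exI[of _ "pCons ([:0, 1:] ^ n * p) B"])
          (use s B False in \<open>simp add: eval2_simps eval1_simps e m(1) distrib_left cst_simps\<close>)
    qed
  qed
  from this[OF order_refl] obtain B where "eval2 B s t = 0" "B = 0 \<longrightarrow> A = 0"
    using A by (metis mult_zero_right)
  then show "A = 0"
    using assms by (simp add: alg_indep_def)
qed

text \<open>Substituting polynomials without constant term for the local parameters does not disturb
  constant terms. This is how the local ring at a point maps to the one at a point infinitely near
  to it.\<close>

lemma eval2_subst:
  assumes H: "eval2 H s' t' = s" "coeff (coeff H 0) 0 = 0" and G: "eval2 G s' t' = t" "coeff (coeff G 0) 0 = 0"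
  shows "\<exists>A'. eval2 A' s' t' = eval2 A s t \<and> coeff (coeff A' 0) 0 = coeff (coeff A 0) 0"
proof -
  have 1: "\<exists>p'. eval2 p' s' t' = eval1 p s \<and> coeff (coeff p' 0) 0 = coeff p 0" for p
  proof (induction p)
    case (pCons a p)
    then obtain p' where "eval2 p' s' t' = eval1 p s" by blast
    then show ?case
      by (intro exI[of _ "[:[:a:]:] + H * p'"]) (simp add: eval2_simps eval1_simps H coeff_mult)
  qed (auto intro: exI[of _ 0] simp: eval2_simps eval1_simps)
  show ?thesis
  proof (induction A)
    case (pCons p A)
    then obtain A' where A': "eval2 A' s' t' = eval2 A s t" by blast
    obtain p' where "eval2 p' s' t' = eval1 p s" "coeff (coeff p' 0) 0 = coeff p 0"
      using 1 by blast
    then show ?case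
      using A' by (intro exI[of _ "p' + G * A'"]) (simp add: eval2_simps eval1_simps G coeff_mult)
  qed (auto intro: exI[of _ 0] simp: eval2_simps eval1_simps)
qed

lemma blow_up_chart:
  assumes "s \<noteq> 0"
  shows "eval2 [:[:0, 1:]:] s (t / s - cst c) = s" "eval2 [:[:0, c:], [:0, 1:]:] s (t / s - cst c) = t"
  using assms by (simp_all add: eval2_simps eval1_simps cst_simps algebra_simps)

lemma eval2_blow_up:
  assumes "s \<noteq> 0"
  shows "\<exists>A'. eval2 A' s (t / s - cst c) = eval2 A s t \<and> coeff (coeff A' 0) 0 = coeff (coeff A 0) 0"
  by (rule eval2_subst[OF blow_up_chart(1)[OF assms] _ blow_up_chart(2)[OF assms]]) simp_all

lemma det_at_blow_up:
  assumes "s \<noteq> 0" "det_at r s t"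
  shows "det_at r s (t / s - cst c)"
  using assms(2) eval2_blow_up[OF assms(1)] unfolding det_at_def by metis

lemma linear_part:
  fixes A :: "'a::field poly poly"
  assumes "coeff (coeff A 0) 0 = 0"
  shows "\<exists>P Q. (\<forall>s t. eval2 A s t = s * eval2 P s t + t * eval2 Q s t) \<and>
    coeff (coeff P 0) 0 = coeff (coeff A 0) 1 \<and> coeff (coeff Q 0) 0 = coeff (coeff A 1) 0"
proof -
  obtain p Q where A: "A = pCons p Q" by (rule pCons_cases)
  obtain a p' where p: "p = pCons a p'" by (rule pCons_cases)
  have "a = 0"
    using assms by (simp add: A p)
  then show ?thesis
    by (intro exI[of _ "[:p':]"] exI[of _ Q]) (simp_all add: A p eval2_simps eval1_simps cst_simps)
qed

text \<open>With t = s (c + t') a polynomial vanishing at the origin becomes s times one whose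
  constant term is its linear part in the direction (1, c). The linear parts of N and D are
  independent, so they do not both vanish there.\<close>

lemma det_at_blow_up_transversal:
  assumes s: "s \<noteq> 0" and r: "r * eval2 D s t = eval2 N s t"
    and 0: "coeff (coeff N 0) 0 = 0" "coeff (coeff D 0) 0 = 0"
    and jac: "coeff (coeff N 0) 1 * coeff (coeff D 1) 0 \<noteq> coeff (coeff N 1) 0 * coeff (coeff D 0) 1"
  shows "det_at r s (t / s - cst c)"
proof -
  define t' where "t' = t / s - cst c"
  have t: "t = s * (cst c + t')"
    using s by (simp add: t'_def)
  have "\<exists>A'. eval2 A s t = s * eval2 A' s t' \<and> coeff (coeff A' 0) 0 = coeff (coeff A 0) 1 + c * coeff (coeff A 1) 0"
    if A: "coeff (coeff A 0) 0 = 0" for A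
  proof -
    obtain P Q where PQ: "\<And>s t. eval2 A s t = s * eval2 P s t + t * eval2 Q s t"
      "coeff (coeff P 0) 0 = coeff (coeff A 0) 1" "coeff (coeff Q 0) 0 = coeff (coeff A 1) 0"
      using linear_part[OF A] by blast
    obtain P' where P': "eval2 P' s t' = eval2 P s t" "coeff (coeff P' 0) 0 = coeff (coeff P 0) 0"
      using eval2_blow_up[OF s] unfolding t'_def by blast
    obtain Q' where Q': "eval2 Q' s t' = eval2 Q s t" "coeff (coeff Q' 0) 0 = coeff (coeff Q 0) 0"
      using eval2_blow_up[OF s] unfolding t'_def by blast
    have "eval2 A s t = s * eval2 (P' + [:[:c:], 1:] * Q') s t'"
      unfolding PQ(1) eval2_simps P' Q'
      by (subst t) (simp add: eval1_simps eval2_simps algebra_simps cst_simps)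
    moreover have "coeff (coeff (P' + [:[:c:], 1:] * Q') 0) 0 = coeff (coeff A 0) 1 + c * coeff (coeff A 1) 0"
      by (simp add: P' Q' PQ)
    ultimately show ?thesis
      by blast
  qed
  from this[OF 0(1)] this[OF 0(2)] obtain N' D' where
    N': "eval2 N s t = s * eval2 N' s t'" "coeff (coeff N' 0) 0 = coeff (coeff N 0) 1 + c * coeff (coeff N 1) 0" and
    D': "eval2 D s t = s * eval2 D' s t'" "coeff (coeff D' 0) 0 = coeff (coeff D 0) 1 + c * coeff (coeff D 1) 0"
    by blast
  have "r * eval2 D' s t' = eval2 N' s t'"
    using r s unfolding N' D' by (simp add: mult.left_commute)
  moreover have "coeff (coeff N' 0) 0 \<noteq> 0 \<or> coeff (coeff D' 0) 0 \<noteq> 0"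
  proof (rule ccontr)
    assume "\<not> ?thesis"
    then have "coeff (coeff N 0) 1 = - c * coeff (coeff N 1) 0" "coeff (coeff D 0) 1 = - c * coeff (coeff D 1) 0"
      by (simp_all add: N' D' add_eq_0_iff2)
    then show False
      using jac by (metis mult.assoc mult.left_commute)
  qed
  ultimately show ?thesis
    unfolding det_at_def t'_def by blast
qed

lemma linear_system_trivial:
  fixes a b :: "'a::field"
  assumes "p * b = q * a" "p' * b = q' * a" "p * q' \<noteq> p' * q"
  shows "a = 0 \<and> b = 0"
proof -
  have "(p * q' - p' * q) * b = q' * (p * b) - q * (p' * b)" "(p * q' - p' * q) * a = p * (q' * a) - p' * (q * a)"
    by (simp_all add: algebra_simps)
  moreover have "q' * (p * b) = q * (p' * b)"
    unfolding assms(1,2) by (rule mult.left_commute)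
  moreover have "p * (q' * a) = p' * (q * a)"
    unfolding assms(1,2)[symmetric] by (rule mult.left_commute)
  ultimately have "(p * q' - p' * q) * b = 0" "(p * q' - p' * q) * a = 0"
    by (simp_all only: diff_self)
  then show ?thesis
    using assms(3) by simp
qed

text \<open>
  If \<open>r = N/D\<close> where \<open>N\<close> and \<open>D\<close> vanish at the origin with independent linear parts, then comparing
  the linear parts of \<open>N B = D A\<close> shows that \<open>r = A/B\<close> forces \<open>A\<close> and \<open>B\<close> to vanish there as well;
  one blow-up resolves the indeterminacy.
\<close>

lemma transversal_point:
  assumes indep: "alg_indep s t" and r: "r * eval2 D s t = eval2 N s t"
    and 0: "coeff (coeff N 0) 0 = 0" "coeff (coeff D 0) 0 = 0"
    and jac: "coeff (coeff N 0) 1 * coeff (coeff D 1) 0 \<noteq> coeff (coeff N 1) 0 * coeff (coeff D 0) 1"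
  shows "\<not> det_at r s t" "det_at r s (t / s - cst c)" "det_at r t (s / t - cst c)"
proof -
  note nz = alg_indep_neq_0[OF indep]
  show "det_at r s (t / s - cst c)"
    by (rule det_at_blow_up_transversal[OF nz(1) r 0 jac])
  show "det_at r t (s / t - cst c)"
    by (rule det_at_blow_up_transversal[OF nz(2), of r "poly_swap D" _ "poly_swap N"])
      (use r 0 jac[symmetric] in \<open>simp_all only: eval2_poly_swap coeff_poly_swap not_False_eq_True\<close>)
  show "\<not> det_at r s t"
  proof
    assume "det_at r s t"
    then obtain A B where AB: "r * eval2 B s t = eval2 A s t"
      "coeff (coeff A 0) 0 \<noteq> 0 \<or> coeff (coeff B 0) 0 \<noteq> 0"
      unfolding det_at_def by blast
    have "eval2 (N * B - D * A) s t = 0"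
      unfolding eval2_diff eval2_simps AB(1)[symmetric] r[symmetric] by simp
    then have eq: "N * B = D * A"
      using indep unfolding alg_indep_def by (metis eq_iff_diff_eq_0)
    let ?a = "coeff (coeff A 0) 0" and ?b = "coeff (coeff B 0) 0"
    have lin: "coeff (coeff (P * Q) 0) 1 = coeff (coeff P 0) 1 * coeff (coeff Q 0) 0"
      "coeff (coeff (P * Q) 1) 0 = coeff (coeff P 1) 0 * coeff (coeff Q 0) 0"
      if "coeff (coeff P 0) 0 = 0" for P Q :: "'a poly poly"
      using that by (simp_all add: coeff_mult)
    have *: "coeff (coeff N 0) 1 * ?b = coeff (coeff D 0) 1 * ?a" "coeff (coeff N 1) 0 * ?b = coeff (coeff D 1) 0 * ?a"
      using lin[OF 0(1), of B] lin[OF 0(2), of A] eq by simp_all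
    show False
      using linear_system_trivial[OF * jac] AB(2) by blast
  qed
qed

section \<open>Low-order coefficients, Taylor shift and expansion at infinity\<close>

lemma low_coeff_mult:
  fixes A B :: "'a::field poly poly"
  shows "coeff (coeff (A * B) 0) 0 = coeff (coeff A 0) 0 * coeff (coeff B 0) 0"
    and "coeff (coeff (A * B) 0) (Suc 0) =
      coeff (coeff A 0) 0 * coeff (coeff B 0) (Suc 0) + coeff (coeff A 0) (Suc 0) * coeff (coeff B 0) 0"
    and "coeff (coeff (A * B) (Suc 0)) 0 =
      coeff (coeff A 0) 0 * coeff (coeff B (Suc 0)) 0 + coeff (coeff A (Suc 0)) 0 * coeff (coeff B 0) 0"
  by (simp_all add: coeff_mult)

lemma eval1_smult: "eval1 (smult c p) s = cst c * eval1 p s"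
  using eval1_simps(4)[of "[:c:]" p s] by (simp add: eval1_simps cst_simps)

lemma eval1_shift: "eval1 (pcompose p [:a, 1:]) s = eval1 p (cst a + s)"
  by (induction p) (simp_all add: pcompose_pCons eval1_simps eval1_smult cst_simps algebra_simps)

lemma coeff_shift:
  "coeff (pcompose p [:a, 1:]) 0 = poly p (a :: 'a::field)"
  "coeff (pcompose p [:a, 1:]) (Suc 0) = poly (pderiv p) a"
proof -
  show "coeff (pcompose p [:a, 1:]) 0 = poly p a"
    by (simp add: poly_pcompose flip: poly_0_coeff_0)
  have "coeff (pcompose p [:a, 1:]) (Suc 0) = coeff (pderiv (pcompose p [:a, 1:])) 0"
    by (simp add: coeff_pderiv)
  also have "\<dots> = poly (pderiv p) a"
    by (simp add: pderiv_pcompose pderiv_pCons poly_pcompose flip: poly_0_coeff_0)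
  finally show "coeff (pcompose p [:a, 1:]) (Suc 0) = poly (pderiv p) a" .
qed

text \<open>The polynomial seen from infinity. If \<open>k\<close> exceeds the degree, a monomial
  supplies the missing power of 1/u and the constant term becomes 0.\<close>

lemma eval1_reflect:
  assumes "degree p \<le> k" "u \<noteq> 0"
  shows "\<exists>p'. eval1 p' (1 / u) = (1 / u) ^ k * eval1 p u \<and> coeff p' 0 = coeff p k"
proof -
  have "map_poly cst (reflect_poly p) = reflect_poly (map_poly cst p)"
    by (rule poly_eqI) (simp add: coeff_map_poly coeff_reflect_poly degree_map_poly cst_eq_0_iff cst_simps)
  then have r: "eval1 (reflect_poly p) (1 / u) = (1 / u) ^ degree p * eval1 p u"
    using assms(2) by (simp add: eval1_def poly_reflect_poly_nz degree_map_poly cst_eq_0_iff inverse_eq_divide)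
  have m: "eval1 (monom 1 m) s = s ^ m" for m and s :: "'a poly poly fract"
    by (simp add: eval1_def map_poly_monom cst_simps poly_monom)
  show ?thesis
  proof (intro exI[of _ "monom 1 (k - degree p) * reflect_poly p"] conjI)
    show "eval1 (monom 1 (k - degree p) * reflect_poly p) (1 / u) = (1 / u) ^ k * eval1 p u"
      using assms(1) by (simp add: eval1_simps r m flip: power_add mult.assoc)
    show "coeff (monom 1 (k - degree p) * reflect_poly p) 0 = coeff p k"
      using assms(1) by (cases "degree p = k") (simp_all add: coeff_monom_mult coeff_eq_0)
  qed
qed

lemma alg_indep_sym_ops:
  assumes "alg_indep s t"
  shows "alg_indep (s - cst a) (t - cst b)" "alg_indep (1 / s) (1 / t)" "alg_indep (1 / s) (t - cst b)"
    "alg_indep (s - cst a) (1 / t)"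
  using assms by (meson alg_indep_commute alg_indep_shift alg_indep_inverse)+

lemma alg_indep_blow_up_shift:
  assumes "alg_indep s t"
  shows "alg_indep s (t / s - cst c)"
  by (intro alg_indep_shift alg_indep_blow_up assms)

section \<open>Base points of a pencil of bidegree (4,1)\<close>

text \<open>n1 d0 - n0 d1 is the resultant with respect to v of the numerator and denominator of
  \<open>r\<close>, and the third condition in \<open>lead\<close> says that its coefficient of
  degree 6 is nonzero. The coordinates are abstract so that (x, y) and (y, x) are both
  instances.\<close>

locale pencil =
  fixes u v r :: "'a::field poly poly fract" and n0 n1 d0 d1 :: "'a poly"
    and I :: "'i set" and px py :: "'i \<Rightarrow> 'a"
  assumes indep: "alg_indep u v"
    and r: "r * (v * eval1 d1 u + eval1 d0 u) = v * eval1 n1 u + eval1 n0 u"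
    and deg: "degree n0 \<le> 4" "degree n1 \<le> 3" "degree d0 \<le> 3" "degree d1 \<le> 2"
    and roots: "poly (n1 * d0 - n0 * d1) a = 0 \<Longrightarrow> \<exists>i\<in>I. a = px i"
    and simple_root: "i \<in> I \<Longrightarrow> poly (pderiv (n1 * d0 - n0 * d1)) (px i) \<noteq> 0"
    and d1: "i \<in> I \<Longrightarrow> poly d1 (px i) \<noteq> 0"
    and base: "i \<in> I \<Longrightarrow> poly d1 (px i) * py i + poly d0 (px i) = 0"
      "i \<in> I \<Longrightarrow> poly n1 (px i) * py i + poly n0 (px i) = 0"
    and lead: "coeff n0 4 \<noteq> 0" "coeff n1 3 \<noteq> 0"
      "coeff n1 3 * coeff d0 3 \<noteq> coeff n0 4 * coeff d1 2"
begin

lemma nz: "u \<noteq> 0" "v \<noteq> 0"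
  using alg_indep_neq_0[OF indep] .

definition affine_num :: "'a \<Rightarrow> 'a \<Rightarrow> 'a poly \<Rightarrow> 'a poly \<Rightarrow> 'a poly poly" where
  "affine_num a b p1 p0 = [:smult b (pcompose p1 [:a, 1:]) + pcompose p0 [:a, 1:], pcompose p1 [:a, 1:]:]"

lemma eval2_affine_num:
  "eval2 (affine_num a b p1 p0) (u - cst a) (v - cst b) = v * eval1 p1 u + eval1 p0 u"
  by (simp add: affine_num_def eval2_simps eval1_simps eval1_smult eval1_shift algebra_simps)

lemma coeff_affine_num:
  "coeff (coeff (affine_num a b p1 p0) 0) 0 = b * poly p1 a + poly p0 a"
  "coeff (coeff (affine_num a b p1 p0) 0) (Suc 0) = b * poly (pderiv p1) a + poly (pderiv p0) a"
  "coeff (coeff (affine_num a b p1 p0) (Suc 0)) 0 = poly p1 a"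
  by (simp_all add: affine_num_def coeff_shift)

lemma affine_eq:
  "r * eval2 (affine_num a b d1 d0) (u - cst a) (v - cst b) = eval2 (affine_num a b n1 n0) (u - cst a) (v - cst b)"
  unfolding eval2_affine_num by (rule r)

text \<open>A common zero over \<open>a\<close> makes the resultant vanish, so \<open>a\<close> is
  one of the px i; d1 is nonzero there, and the vanishing of the denominator then determines
  v.\<close>

lemma det_at_affine:
  assumes "\<not> (\<exists>i\<in>I. a = px i \<and> b = py i)"
  shows "det_at r (u - cst a) (v - cst b)"
proof -
  have "b * poly n1 a + poly n0 a \<noteq> 0 \<or> b * poly d1 a + poly d0 a \<noteq> 0"
  proof (rule ccontr)
    assume "\<not> ?thesis"
    then have *: "poly n0 a = - b * poly n1 a" "poly d0 a = - b * poly d1 a"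
      by (simp_all add: add_eq_0_iff)
    then have "poly (n1 * d0 - n0 * d1) a = 0"
      by simp
    then obtain i where i: "i \<in> I" "a = px i"
      using roots by blast
    have "poly d1 a * py i = poly d1 a * b"
      using base(1)[OF i(1)] *(2) unfolding i(2)[symmetric] by (simp add: mult.commute)
    then show False
      using assms d1[OF i(1)] i by auto
  qed
  then show ?thesis
    using affine_eq[of a b] unfolding det_at_def coeff_affine_num(1)[symmetric] by blast
qed

text \<open>At a common zero the Jacobian determinant of numerator and denominator is minus the
  derivative of the resultant, so a simple root means a transversal intersection.\<close>

lemma base_point:
  assumes i: "i \<in> I"
  defines "s \<equiv> u - cst (px i)" and "t \<equiv> v - cst (py i)"
  shows "\<not> det_at r s t" "det_at r s (t / s - cst c)" "det_at r t (s / t - cst c)"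
proof -
  let ?a = "px i" and ?b = "py i"
  have *: "poly n0 ?a = - ?b * poly n1 ?a" "poly d0 ?a = - ?b * poly d1 ?a"
    using base[OF i] by (simp_all add: add_eq_0_iff mult.commute)
  have "(?b * poly (pderiv n1) ?a + poly (pderiv n0) ?a) * poly d1 ?a
      - poly n1 ?a * (?b * poly (pderiv d1) ?a + poly (pderiv d0) ?a)
      = - poly (pderiv (n1 * d0 - n0 * d1)) ?a"
    by (simp add: pderiv_diff pderiv_mult * algebra_simps)
  then have jac: "(?b * poly (pderiv n1) ?a + poly (pderiv n0) ?a) * poly d1 ?a
      \<noteq> poly n1 ?a * (?b * poly (pderiv d1) ?a + poly (pderiv d0) ?a)"
    using simple_root[OF i] by auto
  note tp = transversal_point[of s t r "affine_num ?a ?b d1 d0" "affine_num ?a ?b n1 n0"]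
  show "\<not> det_at r s t" "det_at r s (t / s - cst c)" "det_at r t (s / t - cst c)"
    unfolding s_def t_def
    by (rule tp[unfolded s_def t_def];
      use jac in \<open>simp add: alg_indep_sym_ops[OF indep] affine_eq coeff_affine_num *\<close>)+
qed

text \<open>At v = infinity the value is n1(a) : d1(a). If both vanished, \<open>a\<close> would be
  a root of the resultant, and there d1 is nonzero.\<close>

lemma det_at_vertical: "det_at r (u - cst a) (1 / v)"
proof -
  let ?N = "[:pcompose n1 [:a, 1:], pcompose n0 [:a, 1:]:]" and ?D = "[:pcompose d1 [:a, 1:], pcompose d0 [:a, 1:]:]"
  have "poly n1 a \<noteq> 0 \<or> poly d1 a \<noteq> 0"
  proof (rule ccontr)
    assume *: "\<not> ?thesis"
    then have "poly (n1 * d0 - n0 * d1) a = 0"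
      by simp
    then show False
      using roots d1 * by blast
  qed
  moreover have "r * eval2 ?D (u - cst a) (1 / v) = eval2 ?N (u - cst a) (1 / v)"
  proof -
    have e: "eval2 [:pcompose p1 [:a, 1:], pcompose p0 [:a, 1:]:] (u - cst a) (1 / v)
        = (v * eval1 p1 u + eval1 p0 u) / v" for p1 p0
      using nz by (simp add: eval2_simps eval1_simps eval1_shift add_divide_distrib)
    show ?thesis
      unfolding e r[symmetric] by simp
  qed
  ultimately show ?thesis
    unfolding det_at_def by (intro exI[of _ ?N] exI[of _ ?D]) (simp add: coeff_shift)
qed

lemma reflected:
  obtains n0' n1' d0' d1' where
    "eval1 n0' (1 / u) = (1 / u) ^ 4 * eval1 n0 u" "coeff n0' 0 = coeff n0 4"
    "eval1 n1' (1 / u) = (1 / u) ^ 3 * eval1 n1 u" "coeff n1' 0 = coeff n1 3"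
    "eval1 d0' (1 / u) = (1 / u) ^ 3 * eval1 d0 u" "coeff d0' 0 = coeff d0 3"
    "eval1 d1' (1 / u) = (1 / u) ^ 2 * eval1 d1 u" "coeff d1' 0 = coeff d1 2"
  using eval1_reflect[OF deg(1) nz(1)] eval1_reflect[OF deg(2) nz(1)]
    eval1_reflect[OF deg(3) nz(1)] eval1_reflect[OF deg(4) nz(1)] by blast

lemma det_at_horizontal: "det_at r (1 / u) (v - cst b)"
proof -
  obtain n0' n1' d0' d1' where *:
    "eval1 n0' (1 / u) = (1 / u) ^ 4 * eval1 n0 u" "coeff n0' 0 = coeff n0 4"
    "eval1 n1' (1 / u) = (1 / u) ^ 3 * eval1 n1 u" "coeff n1' 0 = coeff n1 3"
    "eval1 d0' (1 / u) = (1 / u) ^ 3 * eval1 d0 u" "coeff d0' 0 = coeff d0 3"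
    "eval1 d1' (1 / u) = (1 / u) ^ 2 * eval1 d1 u" "coeff d1' 0 = coeff d1 2"
    by (rule reflected)
  \<comment> \<open>All terms are multiplied by u^-4; n1 and d0 fall short of this by one degree and
    d1 by two, hence the extra \<open>pCons 0\<close>.\<close>
  let ?N = "[:n0' + smult b (pCons 0 n1'), pCons 0 n1':]"
    and ?D = "[:pCons 0 d0' + smult b (pCons 0 (pCons 0 d1')), pCons 0 (pCons 0 d1'):]"
  have "eval2 ?N (1 / u) (v - cst b) = (1 / u) ^ 4 * (v * eval1 n1 u + eval1 n0 u)"
    using nz by (simp add: eval2_simps eval1_simps eval1_smult cst_simps * field_simps eval_nat_numeral)
  moreover have "eval2 ?D (1 / u) (v - cst b) = (1 / u) ^ 4 * (v * eval1 d1 u + eval1 d0 u)"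
    using nz by (simp add: eval2_simps eval1_simps eval1_smult cst_simps * field_simps eval_nat_numeral)
  ultimately have "r * eval2 ?D (1 / u) (v - cst b) = eval2 ?N (1 / u) (v - cst b)"
    using r by (simp add: mult.left_commute)
  moreover have "coeff (coeff ?N 0) 0 \<noteq> 0"
    using * lead by simp
  ultimately show ?thesis
    unfolding det_at_def by blast
qed

text \<open>
  At \<open>(\<infinity>,\<infinity>)\<close> the numerator has the linear part \<open>\<alpha> t + \<beta> s\<close> while the denominator vanishes to
  second order, so that exactly one direction remains indeterminate.
\<close>

lemma double_point_eq:
  obtains n0' n1' d0' d1' where
    "r * ((1 / u)\<^sup>2 * eval1 d1' (1 / u) + 1 / u * (1 / v) * eval1 d0' (1 / u))
      = 1 / u * eval1 n1' (1 / u) + 1 / v * eval1 n0' (1 / u)"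
    "coeff n0' 0 = coeff n0 4" "coeff n1' 0 = coeff n1 3" "coeff d0' 0 = coeff d0 3" "coeff d1' 0 = coeff d1 2"
proof -
  obtain n0' n1' d0' d1' where *:
    "eval1 n0' (1 / u) = (1 / u) ^ 4 * eval1 n0 u" "coeff n0' 0 = coeff n0 4"
    "eval1 n1' (1 / u) = (1 / u) ^ 3 * eval1 n1 u" "coeff n1' 0 = coeff n1 3"
    "eval1 d0' (1 / u) = (1 / u) ^ 3 * eval1 d0 u" "coeff d0' 0 = coeff d0 3"
    "eval1 d1' (1 / u) = (1 / u) ^ 2 * eval1 d1 u" "coeff d1' 0 = coeff d1 2"
    by (rule reflected)
  have "(1 / u)\<^sup>2 * eval1 d1' (1 / u) + 1 / u * (1 / v) * eval1 d0' (1 / u)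
      = (1 / u) ^ 4 * (1 / v) * (v * eval1 d1 u + eval1 d0 u)"
    using nz by (simp add: * field_simps eval_nat_numeral)
  moreover have "1 / u * eval1 n1' (1 / u) + 1 / v * eval1 n0' (1 / u)
      = (1 / u) ^ 4 * (1 / v) * (v * eval1 n1 u + eval1 n0 u)"
    using nz by (simp add: * field_simps eval_nat_numeral)
  ultimately show ?thesis
    using that[of d1' d0' n1' n0'] * r by (simp add: mult.left_commute)
qed

text \<open>After one factor s is cancelled, the denominator vanishes on the exceptional curve, so
  indeterminacy is decided by the constant term of the numerator, linear in c. At its root the
  Jacobian is, up to sign, the third quantity in \<open>lead\<close>.\<close>

lemma double_point_chart1:
  fixes c
  defines "s \<equiv> 1 / u" and "t' \<equiv> (1 / v) / (1 / u) - cst c"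
  shows "det_at r s t' \<longleftrightarrow> c * coeff n0 4 + coeff n1 3 \<noteq> 0"
    and "c * coeff n0 4 + coeff n1 3 = 0 \<Longrightarrow> det_at r s (t' / s - cst d)"
    and "c * coeff n0 4 + coeff n1 3 = 0 \<Longrightarrow> det_at r t' (s / t' - cst d)"
proof -
  obtain n0' n1' d0' d1' where *:
    "r * ((1 / u)\<^sup>2 * eval1 d1' (1 / u) + 1 / u * (1 / v) * eval1 d0' (1 / u))
      = 1 / u * eval1 n1' (1 / u) + 1 / v * eval1 n0' (1 / u)"
    "coeff n0' 0 = coeff n0 4" "coeff n1' 0 = coeff n1 3" "coeff d0' 0 = coeff d0 3" "coeff d1' 0 = coeff d1 2"
    by (rule double_point_eq)
  let ?N = "[:smult c n0' + n1', n0':]" and ?D = "[:pCons 0 (smult c d0' + d1'), pCons 0 d0':]"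
  have s: "s \<noteq> 0"
    using nz by (simp add: s_def)
  have t: "1 / v = s * (cst c + t')"
    using nz by (simp add: s_def t'_def)
  have "s * (r * eval2 ?D s t') = s * eval2 ?N s t'"
    using *(1) unfolding t s_def[symmetric]
    by (simp add: eval2_simps eval1_simps eval1_smult cst_simps algebra_simps power2_eq_square)
  then have eq: "r * eval2 ?D s t' = eval2 ?N s t'"
    using s by simp
  have indep': "alg_indep s t'"
    unfolding s_def t'_def by (intro alg_indep_blow_up_shift alg_indep_sym_ops indep)
  have N: "coeff (coeff ?N 0) 0 = c * coeff n0 4 + coeff n1 3"
    using * by simp
  have 0: "\<not> det_at r s t'" "det_at r s (t' / s - cst d)" "det_at r t' (s / t' - cst d)"
    if c: "c * coeff n0 4 + coeff n1 3 = 0" for d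
  proof -
    have "coeff n0 4 * (c * coeff d0 3 + coeff d1 2) = coeff n0 4 * coeff d1 2 - coeff n1 3 * coeff d0 3"
      unfolding eq_neg_iff_add_eq_0[THEN iffD2, OF c[unfolded add.commute[of "c * _"]]] by (simp add: algebra_simps)
    then have "coeff n0 4 * (c * coeff d0 3 + coeff d1 2) \<noteq> 0"
      using lead(3) by auto
    then have jac: "coeff (coeff ?N 0) 1 * coeff (coeff ?D 1) 0 \<noteq> coeff (coeff ?N 1) 0 * coeff (coeff ?D 0) 1"
      using * by simp
    show "\<not> det_at r s t'" "det_at r s (t' / s - cst d)" "det_at r t' (s / t' - cst d)"
      by (rule transversal_point[OF indep' eq _ _ jac]; use c N in simp)+
  qed
  then show "det_at r s t' \<longleftrightarrow> c * coeff n0 4 + coeff n1 3 \<noteq> 0"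
    using eq N unfolding det_at_def by metis
  show "c * coeff n0 4 + coeff n1 3 = 0 \<Longrightarrow> det_at r s (t' / s - cst d)"
    "c * coeff n0 4 + coeff n1 3 = 0 \<Longrightarrow> det_at r t' (s / t' - cst d)"
    using 0 by blast+
qed

text \<open>The other chart of the same blow-up, needed for the pencil in (y, x) and for the
  direction \<open>Infinity\<close> of the one in (x, y). Here 1/u is no longer a local parameter
  but the product t (c + s').\<close>

lemma double_point_chart2:
  fixes c
  defines "t \<equiv> 1 / v" and "s' \<equiv> (1 / u) / (1 / v) - cst c"
  shows "det_at r t s' \<longleftrightarrow> coeff n0 4 + c * coeff n1 3 \<noteq> 0"
    and "coeff n0 4 + c * coeff n1 3 = 0 \<Longrightarrow> det_at r t (s' / t - cst d)"
    and "coeff n0 4 + c * coeff n1 3 = 0 \<Longrightarrow> det_at r s' (t / s' - cst d)"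
proof -
  obtain n0' n1' d0' d1' where *:
    "r * ((1 / u)\<^sup>2 * eval1 d1' (1 / u) + 1 / u * (1 / v) * eval1 d0' (1 / u))
      = 1 / u * eval1 n1' (1 / u) + 1 / v * eval1 n0' (1 / u)"
    "coeff n0' 0 = coeff n0 4" "coeff n1' 0 = coeff n1 3" "coeff d0' 0 = coeff d0 3" "coeff d1' 0 = coeff d1 2"
    by (rule double_point_eq)
  have t0: "t \<noteq> 0"
    using nz by (simp add: t_def)
  have s: "1 / u = t * (cst c + s')"
    using nz by (simp add: t_def s'_def)
  have sub: "\<exists>A. eval2 A t s' = eval1 p (1 / u) \<and> coeff (coeff A 0) 0 = coeff p 0" for p
  proof -
    have "\<exists>A. eval2 A t s' = eval2 [:p:] (1 / u) t \<and> coeff (coeff A 0) 0 = coeff (coeff [:p:] 0) 0"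
      unfolding s'_def t_def
      by (rule eval2_subst[OF blow_up_chart(2) _ blow_up_chart(1)]) (use nz in simp_all)
    then show ?thesis
      by (simp add: eval2_simps)
  qed
  let ?S = "[:[:0, 1:]:] :: 'a poly poly" and ?c = "[:[:c:], 1:] :: 'a poly poly"
  have S: "eval2 ?S t s' = t" and C: "eval2 ?c t s' = cst c + s'"
    by (simp_all add: eval2_simps eval1_simps cst_simps)
  \<comment> \<open>Splits off the value at 1/u = 0. The rest is divisible by t, so it contributes
    neither to the constant term nor to the coefficient of s'.\<close>
  have sub1: "\<exists>M. eval2 ([:[:coeff p 0:]:] + ?S * (?c * M)) t s' = eval1 p (1 / u)" for p
  proof -
    obtain a q where p: "p = pCons a q" by (rule pCons_cases)
    obtain M where "eval2 M t s' = eval1 q (1 / u)"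
      using sub by blast
    then show ?thesis
      by (intro exI[of _ M]) (simp only: eval2_simps(3,4) S C, simp add: p eval1_simps eval2_simps cst_simps s)
  qed
  obtain M0 where M0: "eval2 ([:[:coeff n0 4:]:] + ?S * (?c * M0)) t s' = eval1 n0' (1 / u)"
    using sub1[of n0'] unfolding *(2) by blast
  obtain M1 where M1: "eval2 ([:[:coeff n1 3:]:] + ?S * (?c * M1)) t s' = eval1 n1' (1 / u)"
    using sub1[of n1'] unfolding *(3) by blast
  obtain E0 where E0: "eval2 E0 t s' = eval1 d0' (1 / u)" "coeff (coeff E0 0) 0 = coeff d0 3"
    using sub[of d0'] unfolding *(4) by blast
  obtain E1 where E1: "eval2 E1 t s' = eval1 d1' (1 / u)" "coeff (coeff E1 0) 0 = coeff d1 2"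
    using sub[of d1'] unfolding *(5) by blast
  define N where "N = ?c * ([:[:coeff n1 3:]:] + ?S * (?c * M1)) + ([:[:coeff n0 4:]:] + ?S * (?c * M0))"
  define D where "D = ?S * (?c * (?c * E1 + E0))"
  have evN: "eval2 N t s' = (cst c + s') * eval1 n1' (1 / u) + eval1 n0' (1 / u)"
    unfolding N_def eval2_simps(3)[of "?c * _"] eval2_simps(4)[of ?c] M0 M1 C ..
  have evD: "eval2 D t s' = t * ((cst c + s') * ((cst c + s') * eval1 d1' (1 / u) + eval1 d0' (1 / u)))"
    unfolding D_def eval2_simps(3,4) E0 E1 S C ..
  have clear: "t * (r * (t * (C * (C * e1 + e0)))) = t * (C * b + a)"
    if "r * ((t * C)\<^sup>2 * e1 + t * C * t * e0) = t * C * b + t * a" for C e1 e0 b a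
    using that by (simp add: algebra_simps power2_eq_square)
  have "t * (r * eval2 D t s') = t * eval2 N t s'"
    unfolding evN evD by (rule clear) (use *(1) in \<open>simp only: t_def[symmetric] s\<close>)
  then have eq: "r * eval2 D t s' = eval2 N t s'"
    using t0 by simp
  have indep': "alg_indep t s'"
    unfolding t_def s'_def by (rule alg_indep_blow_up_shift[OF alg_indep_sym_ops(2)[OF alg_indep_commute[OF indep]]])
  have N: "coeff (coeff N 0) 0 = coeff n0 4 + c * coeff n1 3" "coeff (coeff N (Suc 0)) 0 = coeff n1 3"
    by (simp_all add: N_def low_coeff_mult)
  have D: "coeff (coeff D 0) 0 = 0" "coeff (coeff D (Suc 0)) 0 = 0"
    "coeff (coeff D 0) (Suc 0) = c * (c * coeff d1 2 + coeff d0 3)"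
    by (simp_all add: D_def low_coeff_mult E0 E1)
  have 0: "\<not> det_at r t s'" "det_at r t (s' / t - cst d)" "det_at r s' (t / s' - cst d)"
    if c: "coeff n0 4 + c * coeff n1 3 = 0" for d
  proof -
    \<comment> \<open>The denominator carries the factor c + s', so at c = 0 it would lose its
      linear part; this direction is ruled out by the first condition in
      \<open>lead\<close>.\<close>
    have "c \<noteq> 0"
      using c lead by auto
    moreover have "coeff n1 3 * (c * coeff d1 2 + coeff d0 3) = coeff n1 3 * coeff d0 3 - coeff n0 4 * coeff d1 2"
      unfolding eq_neg_iff_add_eq_0[THEN iffD2, OF c] by (simp add: algebra_simps)
    then have "coeff n1 3 * (c * coeff d1 2 + coeff d0 3) \<noteq> 0"
      using lead(3) by auto
    ultimately have jac: "coeff (coeff N 0) 1 * coeff (coeff D 1) 0 \<noteq> coeff (coeff N 1) 0 * coeff (coeff D 0) 1"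
      by (simp add: N D)
    show "\<not> det_at r t s'" "det_at r t (s' / t - cst d)" "det_at r s' (t / s' - cst d)"
      by (rule transversal_point[OF indep' eq _ _ jac]; use c N D in simp)+
  qed
  then show "det_at r t s' \<longleftrightarrow> coeff n0 4 + c * coeff n1 3 \<noteq> 0"
    using eq N unfolding det_at_def by metis
  show "coeff n0 4 + c * coeff n1 3 = 0 \<Longrightarrow> det_at r t (s' / t - cst d)"
    "coeff n0 4 + c * coeff n1 3 = 0 \<Longrightarrow> det_at r s' (t / s' - cst d)"
    using 0 by blast+
qed

end

section \<open>Indeterminacy along the tower of infinitely near points\<close>

lemma alg_indep_local_params: "alg_indep (fst (local_params p)) (snd (local_params p))"
proof (induction p)
  case (Proper a b)
  then show ?case
    using alg_indep_sym_ops[OF alg_indep_fx_fy] by (cases a; cases b) simp_all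
next
  case (Near p d)
  then show ?case
    using alg_indep_blow_up_shift[OF Near] alg_indep_commute[OF alg_indep_blow_up[OF alg_indep_commute[OF Near]]]
    by (cases d) (simp_all add: case_prod_unfold)
qed

lemma cst_0: "cst 0 = 0"
  by (rule field_hom_0[OF field_hom_cst])

text \<open>Determinacy survives a blow-up, so points above a determinate point need not be
  examined.\<close>

lemma indeterminate_at_Near_imp:
  assumes "indeterminate_at r (Near p d)"
  shows "indeterminate_at r p"
proof (rule ccontr)
  let ?s = "fst (local_params p)" and ?t = "snd (local_params p)"
  note nz = alg_indep_neq_0[OF alg_indep_local_params[of p]]
  assume "\<not> indeterminate_at r p"
  then have det: "det_at r ?s ?t"
    by (simp add: indeterminate_at_iff)
  show False
  proof (cases d)
    case (Affine c)
    then show False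
      using assms det_at_blow_up[OF nz(1) det] by (simp add: indeterminate_at_iff case_prod_unfold)
  next
    case Infinity
    then show False
      using assms det_at_blow_up[OF nz(2), of r ?s 0] det
      by (simp add: indeterminate_at_iff case_prod_unfold cst_0 det_at_commute[of r _ ?t])
  qed
qed

text \<open>By induction over the tower of blow-ups a candidate lies over an indeterminate point,
  where all directions are decided by the hypotheses: only \<open>c0\<close> survives over
  (infinity, infinity), and nothing above it or above the simple points.\<close>

lemma indeterminate_at_iff_points:
  fixes r :: "'a::field poly poly fract"
  assumes affine: "\<And>a b. det_at r (fx - cst a) (fy - cst b) \<longleftrightarrow> \<not> (\<exists>i\<in>I. a = px i \<and> b = py i)"
    and horizontal: "\<And>b. det_at r (1 / fx) (fy - cst b)"
    and vertical: "\<And>a. det_at r (fx - cst a) (1 / fy)"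
    and simple: "\<And>i c. i \<in> I \<Longrightarrow> det_at r (fx - cst (px i)) ((fy - cst (py i)) / (fx - cst (px i)) - cst c)"
      "\<And>i c. i \<in> I \<Longrightarrow> det_at r (fy - cst (py i)) ((fx - cst (px i)) / (fy - cst (py i)) - cst c)"
    and double: "\<And>c. det_at r (1 / fx) ((1 / fy) / (1 / fx) - cst c) \<longleftrightarrow> c \<noteq> c0"
      "det_at r (1 / fy) ((1 / fx) / (1 / fy) - cst 0)"
    and double_near: "\<And>c. det_at r (1 / fx) (((1 / fy) / (1 / fx) - cst c0) / (1 / fx) - cst c)"
      "\<And>c. det_at r ((1 / fy) / (1 / fx) - cst c0) ((1 / fx) / ((1 / fy) / (1 / fx) - cst c0) - cst c)"
  shows "indeterminate_at r p \<longleftrightarrow> p \<in> (\<lambda>i. Proper (Affine (px i)) (Affine (py i))) ` I \<union>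
    {Proper Infinity Infinity, Near (Proper Infinity Infinity) (Affine c0)}"
proof -
  have double_iff: "indeterminate_at r (Near (Proper Infinity Infinity) d) \<longleftrightarrow> d = Affine c0" for d
  proof (cases d)
    case (Affine c)
    then show ?thesis
      using double(1)[of c] by (simp add: indeterminate_at_iff)
  next
    case Infinity
    then show ?thesis
      using double(2) by (simp add: indeterminate_at_iff cst_0 det_at_commute[of r "1 / fy"])
  qed
  have inf: "indeterminate_at r (Proper Infinity Infinity)"
    by (rule indeterminate_at_Near_imp[of _ _ "Affine c0"]) (simp add: double_iff)
  have simple_near: "\<not> indeterminate_at r (Near (Proper (Affine (px i)) (Affine (py i))) d)" if "i \<in> I" for i d
  proof (cases d)
    case (Affine c)
    then show ?thesis
      using simple(1)[OF that] by (simp add: indeterminate_at_iff)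
  next
    case Infinity
    then show ?thesis
      using simple(2)[OF that, of 0] by (simp add: indeterminate_at_iff cst_0 det_at_commute[of r "fy - cst (py i)"])
  qed
  have near_near: "\<not> indeterminate_at r (Near (Near (Proper Infinity Infinity) (Affine c0)) d)" for d
  proof (cases d)
    case (Affine c)
    then show ?thesis
      using double_near(1) by (simp add: indeterminate_at_iff)
  next
    case Infinity
    then show ?thesis
      using det_at_commute_imp[OF double_near(2)[of 0]] by (simp add: indeterminate_at_iff cst_0)
  qed
  show ?thesis
  proof (induction p)
    case (Proper a b)
    show ?case
    proof (cases a)
      case a: (Affine a')
      show ?thesis
      proof (cases b)
        case (Affine b')
        then show ?thesis
          using affine[of a' b'] a by (auto simp: indeterminate_at_iff)
      next
        case Infinity
        then show ?thesis
          using vertical[of a'] a by (auto simp: indeterminate_at_iff)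
      qed
    next
      case a: Infinity
      show ?thesis
      proof (cases b)
        case (Affine b')
        then show ?thesis
          using horizontal[of b'] a by (auto simp: indeterminate_at_iff)
      next
        case Infinity
        then show ?thesis
          using inf a by simp
      qed
    qed
  next
    case (Near p d)
    show ?case
    proof (cases "p = Proper Infinity Infinity")
      case True
      then show ?thesis
        by (auto simp: double_iff)
    next
      case False
      have "\<not> indeterminate_at r (Near p d)"
      proof
        assume *: "indeterminate_at r (Near p d)"
        then have "indeterminate_at r p"
          by (rule indeterminate_at_Near_imp)
        then have "p \<in> (\<lambda>i. Proper (Affine (px i)) (Affine (py i))) ` I \<or> p = Near (Proper Infinity Infinity) (Affine c0)"
          unfolding Near using False by auto
        then show False
        proof
          assume "p \<in> (\<lambda>i. Proper (Affine (px i)) (Affine (py i))) ` I"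
          then obtain i where "i \<in> I" "p = Proper (Affine (px i)) (Affine (py i))"
            by (rule imageE)
          then show False
            using * simple_near[of i d] by simp
        next
          assume "p = Near (Proper Infinity Infinity) (Affine c0)"
          then show False
            using * near_near[of d] by simp
        qed
      qed
      then show ?thesis
        using False by auto
    qed
  qed
qed

lemma pencil_indeterminate_x:
  assumes "pencil fx fy r n0 n1 d0 d1 I px py"
  shows "indeterminate_at r p \<longleftrightarrow> p \<in> (\<lambda>i. Proper (Affine (px i)) (Affine (py i))) ` I \<union>
    {Proper Infinity Infinity, Near (Proper Infinity Infinity) (Affine (- coeff n1 3 / coeff n0 4))}"
proof -
  interpret pencil fx fy r n0 n1 d0 d1 I px py by fact
  have c: "c * coeff n0 4 + coeff n1 3 = 0 \<longleftrightarrow> c = - coeff n1 3 / coeff n0 4" for c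
    using lead by (simp add: eq_divide_eq add_eq_0_iff2 del: divide_minus_left)
  note ch1 = double_point_chart1[unfolded c]
  show ?thesis
  proof (rule indeterminate_at_iff_points)
    show "det_at r (fx - cst a) (fy - cst b) \<longleftrightarrow> \<not> (\<exists>i\<in>I. a = px i \<and> b = py i)" for a b
      using det_at_affine base_point(1) by blast
    show "det_at r (1 / fy) (1 / fx / (1 / fy) - cst 0)"
      unfolding double_point_chart2(1) using lead by simp
  qed (rule det_at_horizontal det_at_vertical base_point double_point_chart1(1)[unfolded c]
      double_point_chart1(2,3)[unfolded c, OF refl] | assumption)+
qed

text \<open>The pencil has y as its first coordinate, but the parameters at (infinity, infinity)
  remain (1/x, 1/y). Its direction is therefore read in the second chart, which gives the reciprocal
  ratio of coefficients.\<close>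

lemma pencil_indeterminate_y:
  assumes "pencil fy fx r n0 n1 d0 d1 I py px"
  shows "indeterminate_at r p \<longleftrightarrow> p \<in> (\<lambda>i. Proper (Affine (px i)) (Affine (py i))) ` I \<union>
    {Proper Infinity Infinity, Near (Proper Infinity Infinity) (Affine (- coeff n0 4 / coeff n1 3))}"
proof -
  interpret pencil fy fx r n0 n1 d0 d1 I py px by fact
  have c: "coeff n0 4 + c * coeff n1 3 = 0 \<longleftrightarrow> c = - coeff n0 4 / coeff n1 3" for c
    using lead by (simp add: eq_divide_eq add_eq_0_iff del: divide_minus_left)
  note ch2 = double_point_chart2[unfolded c]
  show ?thesis
  proof (rule indeterminate_at_iff_points)
    show "det_at r (fx - cst a) (fy - cst b) \<longleftrightarrow> \<not> (\<exists>i\<in>I. a = px i \<and> b = py i)" for a b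
      using det_at_affine[of b a] base_point(1) by (auto simp: det_at_commute[of r "fx - cst a"])
    show "det_at r (1 / fy) (1 / fx / (1 / fy) - cst 0)"
      unfolding double_point_chart1(1) using lead by simp
    show "det_at r (1 / fx) (fy - cst b)" for b
      by (rule det_at_commute_imp[OF det_at_vertical])
    show "det_at r (fx - cst a) (1 / fy)" for a
      by (rule det_at_commute_imp[OF det_at_horizontal])
  qed (rule base_point double_point_chart2(1)[unfolded c]
      double_point_chart2(2,3)[unfolded c, OF refl] | assumption)+
qed

section \<open>The singular points\<close>

definition char_coeff :: "(nat \<Rightarrow> 'a::field) \<Rightarrow> nat \<Rightarrow> 'a" where
  "char_coeff e j = coeff (\<Prod>i=3..8. [:- e i, 1:]) j"

lemma poly_char:
  "(\<Prod>i=3..8. z - e i) = char_coeff e 0 + char_coeff e 1 * z + char_coeff e 2 * z ^ 2 + char_coeff e 3 * z ^ 3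
     + char_coeff e 4 * z ^ 4 + char_coeff e 5 * z ^ 5 + char_coeff e 6 * z ^ 6"
    (is ?t1)
  and char_coeff_6: "char_coeff e 6 = 1"
  and char_coeff_0: "char_coeff e 0 = (\<Prod>i=3..8. e i)"
proof -
  let ?p = "\<Prod>i=3..8. [:- e i, 1:]"
  have deg: "degree ?p = 6"
    by (subst degree_prod_eq_sum_degree) auto
  have "coeff ?p (degree ?p) = 1"
    by (simp add: lead_coeff_prod)
  then show "char_coeff e 6 = 1"
    by (simp add: char_coeff_def deg)
  show "char_coeff e 0 = (\<Prod>i=3..8. e i)"
    by (simp add: char_coeff_def poly_prod prod_3_8 flip: poly_0_coeff_0)
  have "(\<Prod>i=3..8. z - e i) = poly ?p z"
    by (simp add: poly_prod)
  also have "\<dots> = (\<Sum>j\<le>6. char_coeff e j * z ^ j)"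
    by (simp add: poly_altdef deg char_coeff_def)
  finally show ?t1
    by (simp add: eval_nat_numeral)
qed

lemma map_poly_field_hom_prod:
  assumes "field_hom \<phi>"
  shows "map_poly \<phi> (\<Prod>i\<in>A. f i) = (\<Prod>i\<in>A. map_poly \<phi> (f i))"
  by (induction A rule: infinite_finite_induct)
    (simp_all add: map_poly_field_hom[OF assms] field_hom_1[OF assms])

lemma char_coeff_hom:
  assumes "field_hom \<phi>"
  shows "\<phi> (char_coeff e j) = char_coeff (\<lambda>i. \<phi> (e i)) j"
proof -
  have "\<phi> (char_coeff e j) = coeff (map_poly \<phi> (\<Prod>i=3..8. [:- e i, 1:])) j"
    by (simp add: char_coeff_def coeff_map_poly field_hom_0[OF assms])
  also have "map_poly \<phi> (\<Prod>i=3..8. [:- e i, 1:]) = (\<Prod>i=3..8. [:- \<phi> (e i), 1:])"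
    by (simp add: map_poly_field_hom_prod[OF assms] map_poly_field_hom[OF assms] field_hom_simps[OF assms])
  finally show ?thesis
    by (simp add: char_coeff_def)
qed

lemma field_hom_poly:
  assumes "field_hom \<phi>"
  shows "\<phi> (poly p x) = poly (map_poly \<phi> p) (\<phi> x)"
  by (induction p) (simp_all add: map_poly_field_hom[OF assms] field_hom_simps[OF assms])

lemma map_poly_field_hom_smult:
  assumes "field_hom \<phi>"
  shows "map_poly \<phi> (smult c p) = smult (\<phi> c) (map_poly \<phi> p)"
    and "map_poly \<phi> (- p) = - map_poly \<phi> p" "map_poly \<phi> (p - q) = map_poly \<phi> p - map_poly \<phi> q"
  by (rule poly_eqI; simp add: coeff_map_poly field_hom_simps[OF assms])+

text \<open>
  Let \<open>P = \<Prod>(z - e\<^sub>i)\<close> have the coefficients \<open>c\<close>, and let \<open>x = z + w\<close>, \<open>h = zw\<close>. These are the polynomials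
  in \<open>x\<close> whose values are the quotients by \<open>z - w\<close> of \<open>w\<^sup>az\<^sup>bP(z) - z\<^sup>aw\<^sup>bP(w)\<close> for
  \<open>(a, b) = (3,0), (3,1), (3,2), (4,0), (5,0)\<close>.
\<close>

definition antisym_30 :: "'a::field \<Rightarrow> (nat \<Rightarrow> 'a) \<Rightarrow> 'a poly" where
  "antisym_30 h c = [:c 4 * h ^ 3 - c 2 * h ^ 2 - c 6 * h ^ 4 + c 0 * h, c 5 * h ^ 3 - c 1 * h, c 6 * h ^ 3 - c 0:]"

definition antisym_31 :: "'a::field \<Rightarrow> (nat \<Rightarrow> 'a) \<Rightarrow> 'a poly" where
  "antisym_31 h c = [:c 3 * h ^ 3 - c 5 * h ^ 4 - c 1 * h ^ 2, c 4 * h ^ 3 - 2 * c 6 * h ^ 4 - c 0 * h, c 5 * h ^ 3, c 6 * h ^ 3:]"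

definition antisym_32 :: "'a::field \<Rightarrow> (nat \<Rightarrow> 'a) \<Rightarrow> 'a poly" where
  "antisym_32 h c = [:c 6 * h ^ 5 - c 4 * h ^ 4 + c 2 * h ^ 3 - c 0 * h ^ 2, c 3 * h ^ 3 - 2 * c 5 * h ^ 4,
     c 4 * h ^ 3 - 3 * c 6 * h ^ 4, c 5 * h ^ 3, c 6 * h ^ 3:]"

definition antisym_40 :: "'a::field \<Rightarrow> (nat \<Rightarrow> 'a) \<Rightarrow> 'a poly" where
  "antisym_40 h c = [:c 5 * h ^ 4 - c 3 * h ^ 3 + c 1 * h ^ 2, c 6 * h ^ 4 - c 2 * h ^ 2 + 2 * c 0 * h, - c 1 * h, - c 0:]"

definition antisym_50 :: "'a::field \<Rightarrow> (nat \<Rightarrow> 'a) \<Rightarrow> 'a poly" where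
  "antisym_50 h c = [:c 6 * h ^ 5 - c 4 * h ^ 4 + c 2 * h ^ 3 - c 0 * h ^ 2, 2 * c 1 * h ^ 2 - c 3 * h ^ 3,
     3 * c 0 * h - c 2 * h ^ 2, - c 1 * h, - c 0:]"

lemmas antisym_defs = antisym_30_def antisym_31_def antisym_32_def antisym_40_def antisym_50_def

lemma poly_antisym:
  fixes z w :: "'a::field" and c
  defines "P \<equiv> \<lambda>z. c 0 + c 1 * z + c 2 * z ^ 2 + c 3 * z ^ 3 + c 4 * z ^ 4 + c 5 * z ^ 5 + c 6 * z ^ 6"
  shows "(z - w) * poly (antisym_30 (z * w) c) (z + w) = w ^ 3 * P z - z ^ 3 * P w"
    and "(z - w) * poly (antisym_31 (z * w) c) (z + w) = w ^ 3 * z * P z - z ^ 3 * w * P w"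
    and "(z - w) * poly (antisym_32 (z * w) c) (z + w) = w ^ 3 * z ^ 2 * P z - z ^ 3 * w ^ 2 * P w"
    and "(z - w) * poly (antisym_40 (z * w) c) (z + w) = w ^ 4 * P z - z ^ 4 * P w"
    and "(z - w) * poly (antisym_50 (z * w) c) (z + w) = w ^ 5 * P z - z ^ 5 * P w"
  by (simp_all add: P_def antisym_defs algebra_simps eval_nat_numeral)

text \<open>Solving \<open>eq_y\<close> for y', with m in place of T^-1(h2), gives a fraction linear
  in y. These are its coefficients after numerator and denominator have been divided by z - w, which
  leaves polynomials in x.\<close>

definition pencil_d1 :: "'a::field \<Rightarrow> 'a \<Rightarrow> 'a \<Rightarrow> (nat \<Rightarrow> 'a) \<Rightarrow> 'a poly" where
  "pencil_d1 h k m c = smult (h\<^sup>2) (antisym_30 h c)"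

definition pencil_d0 :: "'a::field \<Rightarrow> 'a \<Rightarrow> 'a \<Rightarrow> (nat \<Rightarrow> 'a) \<Rightarrow> 'a poly" where
  "pencil_d0 h k m c = smult (- h) (smult h (antisym_40 h c) + smult k (antisym_31 h c))"

definition pencil_n1 :: "'a::field \<Rightarrow> 'a \<Rightarrow> 'a \<Rightarrow> (nat \<Rightarrow> 'a) \<Rightarrow> 'a poly" where
  "pencil_n1 h k m c = smult h (smult h (antisym_31 h c) + smult m (antisym_40 h c))"

definition pencil_n0 :: "'a::field \<Rightarrow> 'a \<Rightarrow> 'a \<Rightarrow> (nat \<Rightarrow> 'a) \<Rightarrow> 'a poly" where
  "pencil_n0 h k m c = smult (- 1) (smult (h * (h\<^sup>2 + k * m)) (antisym_30 h c)
     + smult (h * k) (antisym_32 h c) + smult (h * m) (antisym_50 h c))"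

lemmas pencil_defs = pencil_d1_def pencil_d0_def pencil_n1_def pencil_n0_def

lemma poly_pencil:
  fixes z w k m :: "'a::field" and e
  defines "P \<equiv> \<lambda>z. \<Prod>i=3..8. z - e i" and "c \<equiv> char_coeff e" and "h \<equiv> z * w" and "x \<equiv> z + w"
  shows "(z - w) * (y * poly (pencil_d1 h k m c) x + poly (pencil_d0 h k m c) x)
      = h * ((h * y - (h * w + k * z)) * (w ^ 3 * P z) - (h * y - (h * z + k * w)) * (z ^ 3 * P w))"
    and "(z - w) * (y * poly (pencil_n1 h k m c) x + poly (pencil_n0 h k m c) x)
      = (h * z + m * w) * (h * y - (h * w + k * z)) * (w ^ 3 * P z)
        - (h * w + m * z) * (h * y - (h * z + k * w)) * (z ^ 3 * P w)"
proof -
  have P: "P z = c 0 + c 1 * z + c 2 * z ^ 2 + c 3 * z ^ 3 + c 4 * z ^ 4 + c 5 * z ^ 5 + c 6 * z ^ 6" for z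
    unfolding P_def c_def by (rule poly_char)
  note A = poly_antisym[of z w c, folded P h_def x_def]
  have "(z - w) * (y * poly (pencil_d1 h k m c) x + poly (pencil_d0 h k m c) x)
      = h * (h * y * ((z - w) * poly (antisym_30 h c) x)
         - h * ((z - w) * poly (antisym_40 h c) x) - k * ((z - w) * poly (antisym_31 h c) x))"
    by (simp add: pencil_defs algebra_simps power2_eq_square)
  also have "\<dots> = h * ((h * y - (h * w + k * z)) * (w ^ 3 * P z) - (h * y - (h * z + k * w)) * (z ^ 3 * P w))"
    unfolding A by (simp add: algebra_simps eval_nat_numeral)
  finally show "(z - w) * (y * poly (pencil_d1 h k m c) x + poly (pencil_d0 h k m c) x)
      = h * ((h * y - (h * w + k * z)) * (w ^ 3 * P z) - (h * y - (h * z + k * w)) * (z ^ 3 * P w))" .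
  have "(z - w) * (y * poly (pencil_n1 h k m c) x + poly (pencil_n0 h k m c) x)
      = h * y * (h * ((z - w) * poly (antisym_31 h c) x) + m * ((z - w) * poly (antisym_40 h c) x))
       - h * (h\<^sup>2 + k * m) * ((z - w) * poly (antisym_30 h c) x) - h * k * ((z - w) * poly (antisym_32 h c) x)
       - h * m * ((z - w) * poly (antisym_50 h c) x)"
    by (simp add: pencil_defs algebra_simps power2_eq_square)
  also have "\<dots> = (h * z + m * w) * (h * y - (h * w + k * z)) * (w ^ 3 * P z)
        - (h * w + m * z) * (h * y - (h * z + k * w)) * (z ^ 3 * P w)"
    unfolding A unfolding h_def by (simp add: algebra_simps eval_nat_numeral)
  finally show "(z - w) * (y * poly (pencil_n1 h k m c) x + poly (pencil_n0 h k m c) x)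
      = (h * z + m * w) * (h * y - (h * w + k * z)) * (w ^ 3 * P z)
        - (h * w + m * z) * (h * y - (h * z + k * w)) * (z ^ 3 * P w)" .
qed

lemma map_poly_antisym:
  assumes "field_hom \<phi>"
  shows "map_poly \<phi> (antisym_30 h c) = antisym_30 (\<phi> h) (\<lambda>j. \<phi> (c j))"
    "map_poly \<phi> (antisym_31 h c) = antisym_31 (\<phi> h) (\<lambda>j. \<phi> (c j))"
    "map_poly \<phi> (antisym_32 h c) = antisym_32 (\<phi> h) (\<lambda>j. \<phi> (c j))"
    "map_poly \<phi> (antisym_40 h c) = antisym_40 (\<phi> h) (\<lambda>j. \<phi> (c j))"
    "map_poly \<phi> (antisym_50 h c) = antisym_50 (\<phi> h) (\<lambda>j. \<phi> (c j))"
  by (simp_all add: antisym_defs map_poly_field_hom[OF assms] field_hom_simps[OF assms])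

lemma map_poly_pencil:
  assumes "field_hom \<phi>"
  shows "map_poly \<phi> (pencil_d1 h k m (char_coeff e)) = pencil_d1 (\<phi> h) (\<phi> k) (\<phi> m) (char_coeff (\<lambda>i. \<phi> (e i)))"
    "map_poly \<phi> (pencil_d0 h k m (char_coeff e)) = pencil_d0 (\<phi> h) (\<phi> k) (\<phi> m) (char_coeff (\<lambda>i. \<phi> (e i)))"
    "map_poly \<phi> (pencil_n1 h k m (char_coeff e)) = pencil_n1 (\<phi> h) (\<phi> k) (\<phi> m) (char_coeff (\<lambda>i. \<phi> (e i)))"
    "map_poly \<phi> (pencil_n0 h k m (char_coeff e)) = pencil_n0 (\<phi> h) (\<phi> k) (\<phi> m) (char_coeff (\<lambda>i. \<phi> (e i)))"
  by (simp_all add: pencil_defs map_poly_field_hom_smult[OF assms] map_poly_field_hom(1)[OF assms]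
      map_poly_antisym[OF assms] char_coeff_hom[OF assms] field_hom_simps[OF assms])

lemma eq_y_solved:
  assumes "eq_y e h k m y y' z" and nz: "z \<noteq> 0" "h \<noteq> 0" "z \<noteq> h / z"
  defines "c \<equiv> char_coeff e" and "x \<equiv> z + h / z"
  shows "y' * (y * poly (pencil_d1 h k m c) x + poly (pencil_d0 h k m c) x)
    = y * poly (pencil_n1 h k m c) x + poly (pencil_n0 h k m c) x"
proof -
  define w where "w = h / z"
  have h: "h = z * w"
    using nz by (simp add: w_def)
  have w: "w \<noteq> 0" "z - w \<noteq> 0"
    using nz by (simp_all add: w_def)
  define P where "P z = (\<Prod>i=3..8. z - e i)" for z
  have g: "h * (z + t / z) = h * z + t * w" "h * (h / z + t * z / h) = h * w + t * z" for t
    using nz w by (simp_all add: h field_simps)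
  have "(y' - (z + m / z)) * (y - (h / z + k * z / h)) * U e z
      = U e w * ((y' - (h / z + m * z / h)) * (y - (z + k / z)))"
    using assms(1) unfolding eq_y_def frac_eq_def w_def by (metis frac_eq_eq)
  then have "(h * (y' - (z + m / z))) * (h * (y - (h / z + k * z / h))) * (h ^ 3 * U e z)
      = (h ^ 3 * U e w) * ((h * (y' - (h / z + m * z / h))) * (h * (y - (z + k / z))))"
    by (simp add: mult_ac)
  moreover have "h ^ 3 * U e z = w ^ 3 * P z" "h ^ 3 * U e w = z ^ 3 * P w"
    using nz w by (simp_all add: U_def P_def h power_mult_distrib)
  ultimately have eq: "(h * y' - (h * z + m * w)) * (h * y - (h * w + k * z)) * (w ^ 3 * P z)
      = (z ^ 3 * P w) * ((h * y' - (h * w + m * z)) * (h * y - (h * z + k * w)))"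
    by (simp only: right_diff_distrib g)
  have "(z - w) * (y' * (y * poly (pencil_d1 h k m c) x + poly (pencil_d0 h k m c) x))
      = (z - w) * (y * poly (pencil_n1 h k m c) x + poly (pencil_n0 h k m c) x)"
  proof -
    note p = poly_pencil[of z w y k m e, folded h c_def P_def]
    have x: "x = z + w"
      by (simp add: x_def w_def)
    have "(z - w) * (y' * (y * poly (pencil_d1 h k m c) x + poly (pencil_d0 h k m c) x))
      = y' * (h * ((h * y - (h * w + k * z)) * (w ^ 3 * P z) - (h * y - (h * z + k * w)) * (z ^ 3 * P w)))"
      unfolding x mult.left_commute[of "z - w"] p ..
    \<comment> \<open>All occurrences of y' are collected in the last difference, which is zero by
      \<open>eq\<close>.\<close>
    also have "\<dots> = (h * z + m * w) * (h * y - (h * w + k * z)) * (w ^ 3 * P z)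
        - (h * w + m * z) * (h * y - (h * z + k * w)) * (z ^ 3 * P w)
        + ((h * y' - (h * z + m * w)) * (h * y - (h * w + k * z)) * (w ^ 3 * P z)
        - (z ^ 3 * P w) * ((h * y' - (h * w + m * z)) * (h * y - (h * z + k * w))))"
      by (simp add: left_diff_distrib right_diff_distrib mult_ac)
    also have "\<dots> = (z - w) * (y * poly (pencil_n1 h k m c) x + poly (pencil_n0 h k m c) x)"
      unfolding x p eq by simp
    finally show ?thesis .
  qed
  then show ?thesis
    using w by simp
qed

text \<open>No \<open>z\<close> is left in the formula, so it descends from the algebraic closure to
  K.\<close>

lemma weyl_R_coord_y:
  defines "h \<equiv> par_h1" and "k \<equiv> par_h2" and "m \<equiv> par_q * par_h1\<^sup>2 / par_h2" and "c \<equiv> char_coeff par_e"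
  shows "weyl_R coord_y * (coord_y * poly (pencil_d1 h k m c) coord_x + poly (pencil_d0 h k m c) coord_x)
    = coord_y * poly (pencil_n1 h k m c) coord_x + poly (pencil_n0 h k m c) coord_x" (is "?l = ?r")
proof -
  obtain z where z: "z \<noteq> 0" "to_ac coord_x = z + to_ac par_h1 / z"
    by (rule to_ac_uniformizer)
  have m: "T_inv par_h2 = m"
    by (simp add: T_inv_h2 m_def)
  have "to_ac ?l = to_ac ?r"
    using eq_y_solved[OF eq_y_holds[OF field_hom_to_ac z] z(1) _ uniformizer_neq_conj[OF field_hom_to_ac z]]
    unfolding m T_inv_vals(1) z(2)[symmetric] c_def h_def k_def
    by (simp add: field_hom_poly[OF field_hom_to_ac] map_poly_pencil[OF field_hom_to_ac])
  then show ?thesis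
    by (simp only: to_ac_eq_iff)
qed

text \<open>The degree leaves no room for a root outside S. If s were a double root, the quotient by
  X - s would still vanish on all of S, with too small a degree.\<close>

lemma simple_roots:
  fixes p :: "'a::field poly"
  assumes deg: "degree p \<le> card S" and p: "p \<noteq> 0" and S: "finite S" "\<forall>s\<in>S. poly p s = 0"
  shows "poly p a = 0 \<Longrightarrow> a \<in> S" "s \<in> S \<Longrightarrow> poly (pderiv p) s \<noteq> 0"
proof -
  have few: "card R \<le> degree q" if "q \<noteq> 0" "\<And>s. s \<in> R \<Longrightarrow> poly q s = 0" for q :: "'a poly" and R
  proof -
    have "card R \<le> card {x. poly q x = 0}"
      by (rule card_mono) (use that poly_roots_finite in auto)
    also have "\<dots> \<le> degree q"
      by (rule card_poly_roots_bound) (rule that)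
    finally show ?thesis .
  qed
  show "a \<in> S" if "poly p a = 0"
  proof (rule ccontr)
    assume "a \<notin> S"
    then have "card (insert a S) \<le> degree p"
      using p S(2) that by (intro few) auto
    then show False
      using deg S(1) \<open>a \<notin> S\<close> by simp
  qed
  show "poly (pderiv p) s \<noteq> 0" if s: "s \<in> S"
  proof
    assume d: "poly (pderiv p) s = 0"
    obtain q where q: "p = [:- s, 1:] * q"
      using bspec[OF S(2) s] by (auto simp: poly_eq_0_iff_dvd elim: dvdE)
    have q0: "q \<noteq> 0"
      using p q by auto
    have "poly (pderiv p) s = poly q s"
      unfolding q pderiv_mult poly_add poly_mult by (simp add: pderiv_pCons)
    then have "poly q s = 0"
      using d by simp
    then have "poly q s' = 0" if "s' \<in> S" for s'
      using bspec[OF S(2) that] by (cases "s' = s") (simp_all add: q)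
    then have "card S \<le> degree q"
      using few[OF q0] by blast
    moreover have "degree p = Suc (degree q)"
      unfolding q using q0 by (subst degree_mult_eq) simp_all
    ultimately show False
      using deg by simp
  qed
qed

text \<open>The inequalities e_i e_j \<noteq> h include i = j: they separate each e_i from h/e_i
  and, as the e_i are distinct, the values e_i + h/e_i from each other. The last one says that m =
  h^4 k / (e_1 ... e_8) differs from h.\<close>

definition generic_params :: "(nat \<Rightarrow> 'a::field) \<Rightarrow> 'a \<Rightarrow> 'a \<Rightarrow> bool" where
  "generic_params e h k \<longleftrightarrow> h \<noteq> 0 \<and> k \<noteq> 0 \<and> h \<noteq> k \<and> (\<forall>i\<in>{1..8}. e i \<noteq> 0) \<and>
     (\<forall>i\<in>{1..8}. \<forall>j\<in>{1..8}. e i * e j \<noteq> h \<and> (e i = e j \<longrightarrow> i = j)) \<and>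
     e 1 * e 2 \<noteq> k \<and> (\<Prod>i=1..8. e i) \<noteq> h ^ 3 * k"

lemma pencil_coeffs:
  fixes h k m :: "'a::field" and e
  defines "c \<equiv> char_coeff e"
  shows "coeff (pencil_n0 h k m c) 4 = - (h * (k * h ^ 3 - m * c 0))"
    "coeff (pencil_n1 h k m c) 3 = h * (h ^ 4 - m * c 0)"
    "coeff (pencil_d0 h k m c) 3 = - (h * (k * h ^ 3 - h * c 0))"
    "coeff (pencil_d1 h k m c) 2 = h\<^sup>2 * (h ^ 3 - c 0)"
    "degree (pencil_n0 h k m c) \<le> 4" "degree (pencil_n1 h k m c) \<le> 3"
    "degree (pencil_d0 h k m c) \<le> 3" "degree (pencil_d1 h k m c) \<le> 2"
proof -
  have c6: "c 6 = 1"
    by (simp add: c_def char_coeff_6)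
  show "coeff (pencil_n0 h k m c) 4 = - (h * (k * h ^ 3 - m * c 0))"
    "coeff (pencil_n1 h k m c) 3 = h * (h ^ 4 - m * c 0)"
    "coeff (pencil_d0 h k m c) 3 = - (h * (k * h ^ 3 - h * c 0))"
    "coeff (pencil_d1 h k m c) 2 = h\<^sup>2 * (h ^ 3 - c 0)"
    by (simp_all only: pencil_defs antisym_defs c6)
      (simp_all add: coeff_pCons eval_nat_numeral algebra_simps)
  show "degree (pencil_n0 h k m c) \<le> 4" "degree (pencil_n1 h k m c) \<le> 3"
    "degree (pencil_d0 h k m c) \<le> 3" "degree (pencil_d1 h k m c) \<le> 2"
    by (rule degree_le; simp add: pencil_defs antisym_defs coeff_pCons split: nat.split)+
qed

text \<open>The resultant has the coefficient h^5 c_0 (h - k) (h - m) in degree 6, nonzero by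
  genericity. The six values e_i + h/e_i are distinct roots of it, hence all of its roots, and
  simple.\<close>

lemma generic_pencil:
  fixes r u v :: "'a::field poly poly fract" and e h k
  defines "m \<equiv> h ^ 4 * k / (\<Prod>i=1..8. e i)" and "c \<equiv> char_coeff e"
  assumes gen: "generic_params e h k" and indep: "alg_indep u v"
    and r: "r * (v * eval1 (pencil_d1 h k m c) u + eval1 (pencil_d0 h k m c) u)
      = v * eval1 (pencil_n1 h k m c) u + eval1 (pencil_n0 h k m c) u"
  shows "pencil u v r (pencil_n0 h k m c) (pencil_n1 h k m c) (pencil_d0 h k m c) (pencil_d1 h k m c)
      {3..8} (\<lambda>i. e i + h / e i) (\<lambda>i. e i + k / e i)"
    and "- coeff (pencil_n1 h k m c) 3 / coeff (pencil_n0 h k m c) 4 = (1 - e 1 * e 2 / k) / (1 - e 1 * e 2 / h)"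
    and "inj_on (\<lambda>i. e i + h / e i) {3..8}"
proof -
  let ?x = "\<lambda>i. e i + h / e i" and ?y = "\<lambda>i. e i + k / e i"
  let ?n0 = "pencil_n0 h k m c" and ?n1 = "pencil_n1 h k m c" and ?d0 = "pencil_d0 h k m c" and ?d1 = "pencil_d1 h k m c"
  let ?P = "\<lambda>z. \<Prod>i=3..8. z - e i" and ?res = "?n1 * ?d0 - ?n0 * ?d1"
  have nz: "h \<noteq> 0" "k \<noteq> 0" "h \<noteq> k" "e 1 * e 2 \<noteq> k" "e 1 * e 2 \<noteq> h"
    using gen by (auto simp: generic_params_def)
  have e0: "e i \<noteq> 0" if "i \<in> {1..8}" for i
    using gen that by (auto simp: generic_params_def)
  have ee: "e i * e j \<noteq> h" "e i = e j \<Longrightarrow> i = j" if "i \<in> {3..8}" "j \<in> {3..8}" for i j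
    using gen that by (auto simp: generic_params_def)
  have p12: "e 1 * e 2 \<noteq> 0"
    using e0[of 1] e0[of 2] by simp
  have c0: "c 0 = (\<Prod>i=3..8. e i)"
    by (simp add: c_def char_coeff_0)
  then have c0_nz: "c 0 \<noteq> 0"
    using e0 by (simp add: prod_3_8)
  have prod: "(\<Prod>i=1..8. e i) = e 1 * e 2 * c 0"
    by (simp only: c0 prod_1_8 prod_3_8 mult.assoc)
  have m: "m * c 0 = h ^ 4 * k / (e 1 * e 2)"
    using c0_nz unfolding m_def prod by simp
  have m_h: "m \<noteq> h"
  proof
    assume "m = h"
    then have "h ^ 4 * k = h * (\<Prod>i=1..8. e i)"
      using p12 c0_nz unfolding m_def prod by (simp add: divide_eq_eq)
    then have "h * (h ^ 3 * k) = h * (\<Prod>i=1..8. e i)"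
      by (simp add: eval_nat_numeral mult_ac)
    then show False
      using nz gen by (simp add: generic_params_def)
  qed
  note co = pencil_coeffs[of h k m e, folded c_def]
  have n0_4: "coeff ?n0 4 = - (h ^ 4 * k * (1 - h / (e 1 * e 2)))"
    unfolding co m using p12 by (simp add: eval_nat_numeral algebra_simps)
  have n1_3: "coeff ?n1 3 = h ^ 5 * (1 - k / (e 1 * e 2))"
    unfolding co m using p12 by (simp add: eval_nat_numeral algebra_simps)
  have lead: "coeff ?n0 4 \<noteq> 0" "coeff ?n1 3 \<noteq> 0"
    unfolding n0_4 n1_3 using nz p12 by auto
  have "coeff ?n1 3 * coeff ?d0 3 - coeff ?n0 4 * coeff ?d1 2 = h ^ 5 * c 0 * (h - k) * (h - m)"
    unfolding co by (simp add: algebra_simps eval_nat_numeral)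
  then have lead3: "coeff ?n1 3 * coeff ?d0 3 - coeff ?n0 4 * coeff ?d1 2 \<noteq> 0"
    using nz m_h c0_nz by simp
  show "- coeff ?n1 3 / coeff ?n0 4 = (1 - e 1 * e 2 / k) / (1 - e 1 * e 2 / h)"
    unfolding n0_4 n1_3 using nz p12 by (simp add: divide_simps eval_nat_numeral) (simp add: algebra_simps)
  show inj: "inj_on ?x {3..8}"
  proof (rule inj_onI)
    fix i j :: nat assume ij: "i \<in> {3..8}" "j \<in> {3..8}" "?x i = ?x j"
    have nzij: "e i \<noteq> 0" "e j \<noteq> 0"
      using e0 ij by auto
    then have "(e i - e j) * (e i * e j - h) = e i * e j * (?x i - ?x j)"
      by (simp add: field_simps)
    then have "e i = e j"
      using ij ee(1)[OF ij(1,2)] by simp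
    then show "i = j"
      using ee(2) ij by blast
  qed
  \<comment> \<open>\<open>poly_pencil\<close> at z = e_i, w = h/e_i: as P(z) = 0, one of the two
    terms drops out and both expressions become multiples of y - \<open>?y i\<close>.\<close>
  have at: "(e i - h / e i) \<noteq> 0"
    "(e i - h / e i) * (y * poly ?d1 (?x i) + poly ?d0 (?x i)) = - (h * (h * (y - ?y i)) * (e i ^ 3 * ?P (h / e i)))"
    "(e i - h / e i) * (y * poly ?n1 (?x i) + poly ?n0 (?x i))
        = - ((h * (h / e i) + m * e i) * (h * (y - ?y i)) * (e i ^ 3 * ?P (h / e i)))"
    if i: "i \<in> {3..8}" for i y
  proof -
    have ei: "e i \<noteq> 0"
      using e0 i by auto
    show "(e i - h / e i) \<noteq> 0"
      using ee(1)[OF i i] ei by (auto simp: field_simps)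
    have P0: "?P (e i) = 0"
      using i by (auto intro!: prod_zero)
    have h: "e i * (h / e i) = h" 
      using ei by simp
    have y: "h * y - (h * e i + k * (h / e i)) = h * (y - ?y i)"
      using ei by (simp add: algebra_simps)
    note pp = poly_pencil[of "e i" "h / e i" y k m e, folded c_def, unfolded h P0 y]
    show "(e i - h / e i) * (y * poly ?d1 (?x i) + poly ?d0 (?x i)) = - (h * (h * (y - ?y i)) * (e i ^ 3 * ?P (h / e i)))"
      unfolding pp(1) by (simp add: mult.assoc)
    show "(e i - h / e i) * (y * poly ?n1 (?x i) + poly ?n0 (?x i))
        = - ((h * (h / e i) + m * e i) * (h * (y - ?y i)) * (e i ^ 3 * ?P (h / e i)))"
      unfolding pp(2) by simp
  qed
  have base: "poly ?d1 (?x i) * ?y i + poly ?d0 (?x i) = 0" "poly ?n1 (?x i) * ?y i + poly ?n0 (?x i) = 0"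
    if "i \<in> {3..8}" for i
    using at(1)[OF that] at(2,3)[OF that, of "?y i"] by (simp_all add: mult.commute)
  have d1: "poly ?d1 (?x i) \<noteq> 0" if i: "i \<in> {3..8}" for i
  proof
    assume "poly ?d1 (?x i) = 0"
    then have "poly ?d0 (?x i) = 0"
      using base(1)[OF i] by simp
    \<comment> \<open>If d1 and d0 both vanished, the left side of \<open>at(2)\<close> would be 0
      for every y, but its right side is 0 only at \<open>?y i\<close>; the value
      \<open>?y i + 1\<close> is one witness.\<close>
    then have "h * (h * (?y i + 1 - ?y i)) * (e i ^ 3 * ?P (h / e i)) = 0"
      using at(2)[OF i, of "?y i + 1"] \<open>poly ?d1 (?x i) = 0\<close> by simp
    moreover have "?P (h / e i) \<noteq> 0" "e i \<noteq> 0"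
    proof -
      show ei: "e i \<noteq> 0"
        using e0 i by auto
      have "h / e i - e j \<noteq> 0" if "j \<in> {3..8}" for j
        using ee(1)[OF that i] ei by (auto simp: field_simps)
      then show "?P (h / e i) \<noteq> 0"
        by simp
    qed
    ultimately show False
      using nz by simp
  qed
  have top: "coeff (p * q) (a + b) = coeff p a * coeff q b" if "degree p \<le> a" "degree q \<le> b" for p q :: "'a poly" and a b
    using that
  proof -
    have "coeff p i * coeff q (a + b - i) = (if i = a then coeff p a * coeff q b else 0)" if "i \<le> a + b" for i
      using that \<open>degree p \<le> a\<close> \<open>degree q \<le> b\<close> by (cases "i < a") (auto simp: coeff_eq_0)
    then show ?thesis
      by (simp add: coeff_mult)
  qed
  have "coeff ?res 6 = coeff ?n1 3 * coeff ?d0 3 - coeff ?n0 4 * coeff ?d1 2"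
    using top[OF co(6,7)] top[OF co(5,8)] by simp
  then have res: "?res \<noteq> 0"
    using lead3 by auto
  have deg_res: "degree ?res \<le> 6"
    using order.trans[OF degree_mult_le add_mono[OF co(6,7)]] order.trans[OF degree_mult_le add_mono[OF co(5,8)]]
    by (intro degree_diff_le) simp_all
  have root: "poly ?res (?x i) = 0" if "i \<in> {3..8}" for i
  proof -
    have "poly ?n0 (?x i) = - (poly ?n1 (?x i) * ?y i)" "poly ?d0 (?x i) = - (poly ?d1 (?x i) * ?y i)"
      using base[OF that] by (simp_all add: add_eq_0_iff)
    then show ?thesis
      by simp
  qed
  have "card (?x ` {3..8}) = 6"
    by (simp add: card_image[OF inj])
  then have deg_card: "degree ?res \<le> card (?x ` {3..8})"
    using deg_res by simp
  have root': "\<forall>s\<in>?x ` {3..8}. poly ?res s = 0"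
    using root by blast
  note sr = simple_roots[OF deg_card res finite_imageI[OF finite_atLeastAtMost] root']
  show "pencil u v r ?n0 ?n1 ?d0 ?d1 {3..8} ?x ?y"
  proof
    show "\<exists>i\<in>{3..8}. a = ?x i" if "poly ?res a = 0" for a
      using sr(1)[OF that] by blast
    show "poly (pderiv ?res) (?x i) \<noteq> 0" if "i \<in> {3..8}" for i
      by (rule sr(2)[OF imageI[OF that]])
    show "coeff ?n1 3 * coeff ?d0 3 \<noteq> coeff ?n0 4 * coeff ?d1 2"
      using lead3 by simp
  qed (rule indep r co lead base d1 | assumption)+
qed

section \<open>Transfer of genericity to the fibre\<close>

lemma generic_fibre_neq:
  assumes "field_hom \<theta>" "\<theta> a = cst a'" "\<theta> b = cst b'" "a \<noteq> b"
  shows "a' \<noteq> b'"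
  using assms by (metis field_hom_eq_iff)

lemma to_fract_neq:
  assumes "cpoly_eval (\<lambda>c. c) \<tau> p \<noteq> cpoly_eval (\<lambda>c. c) \<tau> q"
  shows "to_fract p \<noteq> to_fract q"
  using assms by auto

lemma ge_inject: "i \<in> {1..8} \<Longrightarrow> j \<in> {1..8} \<Longrightarrow> ge i = ge j \<Longrightarrow> i = j"
  by (auto simp: ge_def numeral_eq_Suc le_Suc_eq)

lemma generic_params_par: "generic_params par_e par_h1 par_h2" "generic_params par_e par_h2 par_h1"
proof -
  note S = cpoly_eval_simps[OF field_hom_ident]
  have "to_fract (pvar (ge i) * pvar (ge j)) \<noteq> to_fract (pvar g)"
    if "i \<in> {1..8}" "j \<in> {1..8}" "g \<in> {Gh1, Gh2}" for i j g
    by (rule to_fract_neq[where \<tau> = "(\<lambda>_. 0)(g := 1)"]) (use that ge_neq[of i] in \<open>auto simp: S\<close>)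
  then have 1: "par_e i * par_e j \<noteq> par_h1" "par_e i * par_e j \<noteq> par_h2" if "i \<in> {1..8}" "j \<in> {1..8}" for i j
    using that by (simp_all add: to_fract_pvar Var_defs)
  have 2: "par_e i = par_e j \<longrightarrow> i = j" if "i \<in> {1..8}" "j \<in> {1..8}" for i j
  proof
    assume "par_e i = par_e j"
    then have "pvar (ge i) = pvar (ge j)"
      by (simp add: par_e_def flip: to_fract_pvar)
    then have "cpoly_eval (\<lambda>c. c) ((\<lambda>_. 0)(ge i := 1)) (pvar (ge i))
        = cpoly_eval (\<lambda>c. c) ((\<lambda>_. 0)(ge i := 1)) (pvar (ge j))"
      by (rule arg_cong)
    then have "ge i = ge j"
      by (simp add: S split: if_splits)
    then show "i = j"
      by (rule ge_inject[OF that])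
  qed
  have "to_fract (pvar Ge1 * pvar Ge2 * pvar Ge3 * pvar Ge4 * pvar Ge5 * pvar Ge6 * pvar Ge7 * pvar Ge8)
      \<noteq> to_fract (pvar g ^ 3 * pvar g')" if "g \<in> {Gh1, Gh2}" for g g'
    by (rule to_fract_neq[where \<tau> = "(\<lambda>_. 1)(g := 0)"]) (use that in \<open>auto simp: S\<close>)
  then have 3: "(\<Prod>i=1..8. par_e i) \<noteq> par_h1 ^ 3 * par_h2" "(\<Prod>i=1..8. par_e i) \<noteq> par_h2 ^ 3 * par_h1"
    by (simp_all add: to_fract_pvar to_fract_power Var_defs ge_def prod_1_8[simplified] mult_ac)
  show "generic_params par_e par_h1 par_h2" "generic_params par_e par_h2 par_h1"
    unfolding generic_params_def using 1 2 3 par_h1_neq_h2 1[of 1 2] by (auto simp del: One_nat_def)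
qed

lemma generic_params_transfer:
  assumes \<theta>: "field_hom \<theta>" and e: "\<forall>i\<in>{1..8}. \<theta> (par_e i) = cst (e i)"
    and hk: "\<theta> h' = cst h" "\<theta> k' = cst k" and gen: "generic_params par_e h' k'"
  shows "generic_params e h k"
proof -
  note t = field_hom_simps[OF \<theta>] and c = cst_simps
  have ee: "\<theta> (par_e i * par_e j) = cst (e i * e j)" if "i \<in> {1..8}" "j \<in> {1..8}" for i j
    using that by (simp add: t c e)
  have p: "\<theta> (\<Prod>i=1..8. par_e i) = cst (\<Prod>i=1..8. e i)"
    unfolding field_hom_prod[OF \<theta>] field_hom_prod[OF field_hom_cst] by (rule prod.cong) (simp_all add: e)
  have hk3: "\<theta> (h' ^ 3 * k') = cst (h ^ 3 * k)"
    by (simp add: t c hk)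
  have 0: "\<theta> 0 = cst 0"
    by (simp add: t c)
  note ne = generic_fibre_neq[OF \<theta>]
  show ?thesis
    unfolding generic_params_def
  proof (intro conjI ballI impI)
    show "h \<noteq> 0" "k \<noteq> 0" "h \<noteq> k" "(\<Prod>i=1..8. e i) \<noteq> h ^ 3 * k"
      using gen ne[OF hk(1) 0] ne[OF hk(2) 0] ne[OF hk] ne[OF p hk3] unfolding generic_params_def by blast+
    show "e 1 * e 2 \<noteq> k"
      using gen ne[OF ee[of 1 2] hk(2)] unfolding generic_params_def by simp
    fix i :: nat assume i: "i \<in> {1..8}"
    show "e i \<noteq> 0"
      using gen ne[OF bspec[OF e i] 0] i unfolding generic_params_def by blast
    fix j :: nat assume j: "j \<in> {1..8}"
    show "e i * e j \<noteq> h"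
      using gen ne[OF ee[OF i j] hk(1)] i j unfolding generic_params_def by blast
    show "i = j" if "e i = e j"
      using gen ne[OF bspec[OF e i] bspec[OF e j]] i j that unfolding generic_params_def by blast
  qed
qed

lemma weyl_R_coord_y_fibre:
  fixes \<theta> :: "K \<Rightarrow> 'a::field poly poly fract"
  assumes \<theta>: "field_hom \<theta>" and e: "\<forall>i\<in>{1..8}. \<theta> (par_e i) = cst (e i)"
    and hk: "\<theta> par_h1 = cst h" "\<theta> par_h2 = cst k"
  defines "m \<equiv> h ^ 4 * k / (\<Prod>i=1..8. e i)" and "c \<equiv> char_coeff e"
    and "u \<equiv> \<theta> coord_x" and "v \<equiv> \<theta> coord_y"
  shows "\<theta> (weyl_R coord_y) * (v * eval1 (pencil_d1 h k m c) u + eval1 (pencil_d0 h k m c) u)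
      = v * eval1 (pencil_n1 h k m c) u + eval1 (pencil_n0 h k m c) u"
proof -
  have prod: "\<theta> (\<Prod>i=1..8. par_e i) = cst (\<Prod>i=1..8. e i)"
    unfolding field_hom_prod[OF \<theta>] field_hom_prod[OF field_hom_cst] by (rule prod.cong) (simp_all add: e)
  have "par_q * par_h1\<^sup>2 / par_h2 = par_h1 ^ 4 * par_h2 / (\<Prod>i=1..8. par_e i)"
    by (simp add: par_q_def power2_eq_square power4_eq_xxxx)
  then have m: "\<theta> (par_q * par_h1\<^sup>2 / par_h2) = cst m"
    using prod by (simp add: m_def field_hom_simps[OF \<theta>] cst_simps hk)
  have char: "char_coeff (\<lambda>i. \<theta> (par_e i)) = char_coeff (\<lambda>i. cst (e i))"
    by (intro ext) (simp add: char_coeff_def e)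
  note P = map_poly_pencil[OF \<theta>, of par_h1 par_h2 "par_q * par_h1\<^sup>2 / par_h2" par_e, unfolded m hk char]
  note Q = map_poly_pencil[OF field_hom_cst, of h k m e, folded c_def]
  show ?thesis
    using arg_cong[OF weyl_R_coord_y, of \<theta>]
    unfolding eval1_def Q u_def v_def field_hom_mult[OF \<theta>] field_hom_add[OF \<theta>] field_hom_poly[OF \<theta>] P .
qed

theorem singular_points_eq:
  fixes \<theta> :: "K \<Rightarrow> 'f::field poly poly fract"
  assumes "generic_fibre \<theta> e h1 h2"
  shows "card (simple_point e h1 h2 ` {3..8}) = 6"
    and "singular_points \<theta> = simple_point e h1 h2 ` {3..8} \<union> {Proper Infinity Infinity, double_point_near e h1 h2}"
proof -
  have \<theta>: "field_hom \<theta>" and e: "\<forall>i\<in>{1..8}. \<theta> (par_e i) = cst (e i)"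
    and h: "\<theta> par_h1 = cst h1" "\<theta> par_h2 = cst h2" and xy: "\<theta> coord_x = fx" "\<theta> coord_y = fy"
    using assms by (auto simp: generic_fibre_def)
  \<comment> \<open>T(x) is s_2 applied to R(y), so it is treated as R(y) with x and y, h1 and h2
    exchanged.\<close>
  let ?\<theta> = "\<theta> \<circ> weyl_s 2"
  have \<theta>': "field_hom ?\<theta>"
    by (simp add: field_hom_comp field_hom_weyl_s \<theta>)
  have e': "\<forall>i\<in>{1..8}. ?\<theta> (par_e i) = cst (e i)"
    using e by (simp add: weyl_2_par_e)
  have h': "?\<theta> par_h1 = cst h2" "?\<theta> par_h2 = cst h1" and xy': "?\<theta> coord_x = fy" "?\<theta> coord_y = fx"
    by (simp_all add: weyl_2_simps h xy)
  have gen: "generic_params e h1 h2" "generic_params e h2 h1"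
    by (rule generic_params_transfer[OF \<theta> e h generic_params_par(1)]
        generic_params_transfer[OF \<theta> e h(2,1) generic_params_par(2)])+
  note E = weyl_R_coord_y_fibre[OF \<theta> e h, unfolded xy]
  note E' = weyl_R_coord_y_fibre[OF \<theta>' e' h', unfolded xy']
  note p = generic_pencil[OF gen(1) alg_indep_fx_fy E]
  note p' = generic_pencil[OF gen(2) alg_indep_commute[OF alg_indep_fx_fy] E']
  have simple: "simple_point e h1 h2 = (\<lambda>i. Proper (Affine (e i + h1 / e i)) (Affine (e i + h2 / e i)))"
    by (simp add: simple_point_def fun_eq_iff)
  have "inj_on (simple_point e h1 h2) {3..8}"
    using p(3) by (auto simp: simple inj_on_def)
  then show "card (simple_point e h1 h2 ` {3..8}) = 6"
    by (simp add: card_image)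
  have dbl: "double_point_near e h1 h2
      = Near (Proper Infinity Infinity) (Affine ((1 - e 1 * e 2 / h2) / (1 - e 1 * e 2 / h1)))"
    by (simp add: double_point_near_def)
  \<comment> \<open>The second pencil gives the ratio with h1 and h2 exchanged; its reciprocal is
    the direction found for the first, so both functions are indeterminate at the same
    points.\<close>
  have inv: "- a / b = d / c" if "- b / a = c / d" for a b c d :: 'f
  proof -
    have "inverse (- b / a) = inverse (c / d)"
      using that by simp
    then show ?thesis
      by (simp add: inverse_eq_divide)
  qed
  note x_iff = pencil_indeterminate_x[OF p(1), unfolded p(2)]
    and y_iff = pencil_indeterminate_y[OF p'(1), unfolded inv[OF p'(2)]]
  show "singular_points \<theta> = simple_point e h1 h2 ` {3..8} \<union> {Proper Infinity Infinity, double_point_near e h1 h2}"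
    unfolding singular_points_def T_inv_vals T_vals simple dbl x_iff y_iff[unfolded comp_apply]
      disj_absorb Collect_mem_eq ..
qed

theorem proposition4p3p1:
  shows
    "(\<forall>j\<le>7. is_aut_with (weyl_img j) (weyl_s j)) \<and> extends_T T_lam \<and>
     \<comment> \<open>the two equations, in an arbitrary extension field containing \<open>z\<close>\<close>
     (\<forall>(\<phi> :: K \<Rightarrow> 'l::field) z. field_hom \<phi> \<and> z \<noteq> 0 \<and> \<phi> coord_x = z + \<phi> par_h1 / z \<longrightarrow>
        eq_y (\<lambda>i. \<phi> (par_e i)) (\<phi> par_h1) (\<phi> par_h2) (\<phi> (T_inv par_h2))
             (\<phi> coord_y) (\<phi> (T_inv coord_y)) z) \<and>
     (\<forall>(\<phi> :: K \<Rightarrow> 'l) z. field_hom \<phi> \<and> z \<noteq> 0 \<and> \<phi> coord_y = z + \<phi> par_h2 / z \<longrightarrow>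
        eq_x (\<lambda>i. \<phi> (par_e i)) (\<phi> par_h1) (\<phi> par_h2) (\<phi> (T par_h1))
             (\<phi> coord_x) (\<phi> (T coord_x)) z) \<and>
     \<comment> \<open>the \<open>q\<close>-\<open>E\<^sub>7\<close> equation for \<open>f\<close>, \<open>g\<close>\<close>
     (\<forall>(\<psi> :: K_lam \<Rightarrow> 'm::field) u. field_hom \<psi> \<and> u \<noteq> 0 \<and> \<psi> var_f = u + \<psi> var_k1 / u \<longrightarrow>
        qE7_g (\<psi> (incl par_q)) (\<lambda>i. \<psi> (var_v i)) (\<psi> var_k1) (\<psi> var_k2)
              (\<psi> var_g) (\<psi> (T_lam_inv var_g)) u) \<and>
     (\<forall>(\<psi> :: K_lam \<Rightarrow> 'm) u. field_hom \<psi> \<and> u \<noteq> 0 \<and> \<psi> var_g = u + \<psi> var_k2 / u \<longrightarrow>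
        qE7_f (\<psi> (incl par_q)) (\<lambda>i. \<psi> (var_v i)) (\<psi> var_k1) (\<psi> var_k2)
              (\<psi> var_f) (\<psi> (T_lam var_f)) u) \<and>
     \<comment> \<open>equivalence of the two forms as equations: \<open>x, y, x', y'\<close> are arbitrary values
         in place of \<open>x, y, T(x), T\<^sup>-\<^sup>1(y)\<close>\<close>
     (\<forall>(\<psi> :: K_lam \<Rightarrow> 'm) x y x' y' z. field_hom \<psi> \<and> z \<noteq> 0 \<longrightarrow>
        (let l = \<psi> lam; u = z / l; f = x / l; g = y / l;
             f' = x' / \<psi> (T_lam lam); g' = y' / \<psi> (T_lam_inv lam);
             e = (\<lambda>i. \<psi> (incl (par_e i))); h1 = \<psi> (incl par_h1); h2 = \<psi> (incl par_h2);
             q = \<psi> (incl par_q); v = (\<lambda>i. \<psi> (var_v i)); k1 = \<psi> var_k1; k2 = \<psi> var_k2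
         in
         (x = z + h1 / z \<longleftrightarrow> f = u + k1 / u) \<and>
         (y = z + h2 / z \<longleftrightarrow> g = u + k2 / u) \<and>
         (eq_y e h1 h2 (\<psi> (incl (T_inv par_h2))) y y' z \<longleftrightarrow> qE7_g q v k1 k2 g g' u) \<and>
         (eq_x e h1 h2 (\<psi> (incl (T par_h1))) x x' z \<longleftrightarrow> qE7_f q v k1 k2 f f' u))) \<and>
     \<comment> \<open>the singular points\<close>
     (\<forall>(\<theta> :: K \<Rightarrow> 'f::field poly poly fract) e h1 h2. generic_fibre \<theta> e h1 h2 \<longrightarrow>
        card (simple_point e h1 h2 ` {3..8}) = 6 \<and>
        singular_points \<theta> =
          simple_point e h1 h2 ` {3..8} \<union>
          {Proper Infinity Infinity, double_point_near e h1 h2})"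
proof (intro conjI allI impI, goal_cases)
  case (1 j)
  then show ?case by (rule is_aut_with_weyl)
next
  case 2
  show ?case by (rule extends_T_T_lam)
next
  case (3 \<phi> z)
  then show ?case by (intro eq_y_holds) blast+
next
  case (4 \<phi> z)
  then show ?case by (intro eq_x_holds) blast+
next
  case (5 \<psi> u)
  then show ?case by (intro qE7_g_holds) blast+
next
  case (6 \<psi> u)
  then show ?case by (intro qE7_f_holds) blast+
next
  case (7 \<psi> x y x' y' z)
  then show ?case by (intro equations_equivalent) blast+
next
  case (8 \<theta> e h1 h2)
  then show ?case by (rule singular_points_eq)
next
  case (9 \<theta> e h1 h2)
  then show ?case by (rule singular_points_eq)
qed

end
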